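(* Let $A_1,\ldots,A_k$ be matrices with integer entries, where $A_i$ has dimensions $n_i\times s_i$ for $i=1,\ldots,k$, and let $c_1,\ldots,c_l\in\mathbb{Z}^N$ with $N\ge n_1+\cdots+n_k$. Let $s=s_1+\cdots+s_k+l$, and let $A\in\mathbb{Z}^{N\times s}$ be the matrix whose first $s_1+\cdots+s_k$ columns form the block matrix with $A_1,\ldots,A_k$ placed block-diagonally in the first $n_1+\cdots+n_k$ rows and zeros everywhere else, and whose last $l$ columns are $c_1,\ldots,c_l$. For each $i$ let $U_i=\{s_1+\cdots+s_{i-1}+1,\ldots,s_1+\cdots+s_i\}$ be the set of indices of the columns in which $A_i$ is located in $A$. Suppose that $$\ker(A)=\ker(A_1)\oplus\cdots\oplus\ker(A_k)\oplus\mathbb{Z}\tau$$ for some nonzero $\tau\in\mathbb{Z}^{s}$, and that for every $i\in\{1,\ldots,k\}$ the set $U_i$ is disjoint from either $\operatorname{supp}(\tau_+)$ or $\operatorname{supp}(\tau_-)$. Suppose in addition that $A$ induces an $\mathbb{N}^N$-grading on $R/I_A$, where $R=\mathbb{K}[x_1,\ldots,x_s]$. Then for all $i\ge 0$ and $\alpha\in\mathbb{N}^N$, $$\beta_{i,\alpha}(R/I_A)=\beta_{i,\alpha}(R/J)+\beta_{i-1,\alpha-\mu}(R/J),$$ where $J=I_{A_1}+\cdots+I_{A_k}\subseteq R$ and $\mu=\deg(x^{\tau_+}-x^{\tau_-})\in\mathbb{N}^N$.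
   Context: $\mathbb{K}$ is an algebraically closed field of characteristic zero; $\mathbb{N}$ contains $0$. For $\alpha=(a_1,\ldots,a_s)\in\mathbb{Z}^s$, $\operatorname{supp}(\alpha)=\{i : a_i\neq 0\}$, and $\alpha=\alpha_+-\alpha_-$ with $\alpha_+=\sum_{a_i>0}a_i\mathbf{e}_i$ and $\alpha_-=\sum_{a_i<0}(-a_i)\mathbf{e}_i$. For an integer $n\times s$ matrix $A$, $\ker(A)$ denotes the kernel of the induced map $\mathbb{Z}^s\to\mathbb{Z}^n$, and the toric ideal of $A$ is $I_A=\langle x^{\alpha_+}-x^{\alpha_-} : \alpha\in\ker(A)\rangle\subseteq\mathbb{K}[x_1,\ldots,x_s]$. Here $\ker(A_i)\subseteq\mathbb{Z}^{s_i}$ is regarded as a subgroup of $\mathbb{Z}^s$ by placing its coordinates in the positions $U_i$ and zeros elsewhere, and $I_{A_i}$ is regarded as an ideal of $R$ (in the variables $x_j$, $j\in U_i$). That $A$ induces an $\mathbb{N}^N$-grading means that the columns $\alpha_1,\ldots,\alpha_s$ of $A$ lie in $\mathbb{N}^N$ and $\ker(A)\cap\mathbb{N}^s=\{\mathbf{0}\}$, and that $R$, $I_A$, $R/I_A$ are graded by $\deg x_i=\alpha_i$. The multi-graded Betti numbers of a graded module $M$ are $\beta_{i,\alpha}(M)=\dim_{\mathbb{K}}\operatorname{Tor}_i^R(M,\mathbb{K})_\alpha$, all with respect to this grading; $\beta_{i,\alpha}=0$ when $i<0$ or $\alpha\notin\mathbb{N}^N$. *)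

theory Defs
  imports
    "Jordan_Normal_Form.Matrix_Kernel"
    "HOL-Library.Set_Algebras"
    "HOL-Library.Poly_Mapping"
begin

section \<open>The polynomial ring\<close>

text \<open>Polynomials in countably many variables; the ring K[x_0, ..., x_{s-1}] is the
  carrier set \<open>mpolys s\<close>. Indices start at 0 throughout.\<close>

type_synonym 'k mpoly = "(nat \<Rightarrow>\<^sub>0 nat) \<Rightarrow>\<^sub>0 'k"

definition mpolys :: "nat \<Rightarrow> 'k::zero mpoly set" where
  "mpolys s = {p. \<forall>m\<in>Poly_Mapping.keys p. Poly_Mapping.keys m \<subseteq> {..<s}}"

definition mideal :: "nat \<Rightarrow> 'k::comm_ring_1 mpoly set \<Rightarrow> 'k mpoly set" where
  "mideal s G = {\<Sum>g\<in>T. q g * g | T q. finite T \<and> T \<subseteq> G \<and> (\<forall>g\<in>T. q g \<in> mpolys s)}"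


section \<open>Integer vectors and toric ideals\<close>

definition vsupp :: "int vec \<Rightarrow> nat set" where
  "vsupp v = {j. j < dim_vec v \<and> v $ j \<noteq> 0}"

definition pos_vec :: "int vec \<Rightarrow> int vec" where
  "pos_vec v = vec (dim_vec v) (\<lambda>j. max 0 (v $ j))"

definition neg_vec :: "int vec \<Rightarrow> int vec" where
  "neg_vec v = vec (dim_vec v) (\<lambda>j. max 0 (- (v $ j)))"

text \<open>The monomial of a nonnegative exponent vector.\<close>

definition xpow :: "int vec \<Rightarrow> 'k::comm_ring_1 mpoly" where
  "xpow v = Poly_Mapping.single (\<Sum>j<dim_vec v. Poly_Mapping.single j (nat (v $ j))) 1"

definition binom :: "int vec \<Rightarrow> 'k::comm_ring_1 mpoly" where
  "binom v = xpow (pos_vec v) - xpow (neg_vec v)"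

definition toric_ideal :: "int mat \<Rightarrow> 'k::comm_ring_1 mpoly set" where
  "toric_ideal A = mideal (dim_col A) (binom ` mat_kernel A)"

text \<open>The vector of length \<open>s\<close> carrying \<open>v\<close> in the positions \<open>p\<close>, ..., \<open>p + dim_vec v - 1\<close>.\<close>

definition place_vec :: "nat \<Rightarrow> nat \<Rightarrow> int vec \<Rightarrow> int vec" where
  "place_vec s p v = vec s (\<lambda>j. if p \<le> j \<and> j < p + dim_vec v then v $ (j - p) else 0)"

definition col_offset :: "int mat list \<Rightarrow> nat \<Rightarrow> nat" where
  "col_offset As i = sum_list (map dim_col (take i As))"

definition block_cols :: "int mat list \<Rightarrow> nat \<Rightarrow> nat set" where
  "block_cols As i = {col_offset As i ..< col_offset As i + dim_col (As ! i)}"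

definition block_kernel :: "nat \<Rightarrow> int mat list \<Rightarrow> nat \<Rightarrow> int vec set" where
  "block_kernel s As i = place_vec s (col_offset As i) ` mat_kernel (As ! i)"

text \<open>The toric ideal of the \<open>i\<close>-th block, extended to the ring in all \<open>s\<close> variables.\<close>

definition block_toric_ideal :: "nat \<Rightarrow> int mat list \<Rightarrow> nat \<Rightarrow> 'k::comm_ring_1 mpoly set" where
  "block_toric_ideal s As i = mideal s (binom ` block_kernel s As i)"

definition block_matrix :: "nat \<Rightarrow> int mat list \<Rightarrow> int vec list \<Rightarrow> int mat" where
  "block_matrix N As cs =
     (let D = diag_block_mat As
      in mat N (dim_col D + length cs)
           (\<lambda>(r, j). if j < dim_col D
                     then (if r < dim_row D then D $$ (r, j) else 0)
                     else cs ! (j - dim_col D) $ r))"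

text \<open>\<open>L\<close> is the internal direct sum of the subgroups \<open>Hs\<close> of \<open>\<int>\<^sup>s\<close>: every sum of
  elements of the \<open>Hs\<close> lies in \<open>L\<close>, and every element of \<open>L\<close> is such a sum in exactly one way.\<close>

definition internal_direct_sum :: "nat \<Rightarrow> int vec set \<Rightarrow> int vec set list \<Rightarrow> bool" where
  "internal_direct_sum s L Hs \<longleftrightarrow>
     bij_betw (\<lambda>vs. foldr (+) vs (0\<^sub>v s)) (listset Hs) L"


section \<open>The grading\<close>

definition nonneg_vec :: "int vec \<Rightarrow> bool" where
  "nonneg_vec v \<longleftrightarrow> (\<forall>j<dim_vec v. 0 \<le> v $ j)"

definition induces_grading :: "int mat \<Rightarrow> bool" where
  "induces_grading A \<longleftrightarrow>
     (\<forall>j<dim_col A. nonneg_vec (col A j)) \<and>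
     {v \<in> mat_kernel A. nonneg_vec v} = {0\<^sub>v (dim_col A)}"

definition mon_deg :: "int mat \<Rightarrow> (nat \<Rightarrow>\<^sub>0 nat) \<Rightarrow> int vec" where
  "mon_deg A m = A *\<^sub>v vec (dim_col A) (\<lambda>j. int (Poly_Mapping.lookup m j))"

definition homog :: "int mat \<Rightarrow> int vec \<Rightarrow> 'k::zero mpoly set" where
  "homog A \<alpha> = {p \<in> mpolys (dim_col A). \<forall>m\<in>Poly_Mapping.keys p. mon_deg A m = \<alpha>}"

text \<open>Meaningful for nonzero homogeneous polynomials.\<close>

definition poly_deg :: "int mat \<Rightarrow> 'k::zero mpoly \<Rightarrow> int vec" where
  "poly_deg A p = (THE \<alpha>. p \<in> homog A \<alpha>)"


section \<open>Graded free resolutions and Betti numbers\<close>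

text \<open>A free module with basis \<open>B \<subseteq> \<nat>\<close> over a ring consists of the finitely supported
  functions with support in \<open>B\<close>. A linear map is given by its values on the basis.\<close>

definition pm_smult :: "'a::comm_ring_1 \<Rightarrow> (nat \<Rightarrow>\<^sub>0 'a) \<Rightarrow> (nat \<Rightarrow>\<^sub>0 'a)" where
  "pm_smult c f = Poly_Mapping.map ((*) c) f"

lemma lookup_pm_smult: "Poly_Mapping.lookup (pm_smult c f) b = c * Poly_Mapping.lookup f b"
  by (simp add: pm_smult_def Poly_Mapping.map.rep_eq when_def)

definition lin_ext :: "(nat \<Rightarrow> (nat \<Rightarrow>\<^sub>0 'a::comm_ring_1)) \<Rightarrow> (nat \<Rightarrow>\<^sub>0 'a) \<Rightarrow> (nat \<Rightarrow>\<^sub>0 'a)" where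
  "lin_ext \<phi> f = (\<Sum>b\<in>Poly_Mapping.keys f. pm_smult (Poly_Mapping.lookup f b) (\<phi> b))"

text \<open>Data of a complex \<open>\<dots> \<rightarrow> F\<^sub>1 \<rightarrow> F\<^sub>0 \<rightarrow> R/I\<close>: \<open>fbasis i\<close> is the basis of \<open>F\<^sub>i\<close>, with degrees
  \<open>fdeg i\<close>; \<open>faug b\<close> is a representative in \<open>R\<close> of the image in \<open>R/I\<close> of the basis element \<open>b\<close> of
  \<open>F\<^sub>0\<close>; and \<open>fdiff i b\<close> is the image in \<open>F\<^sub>i\<close> of the basis element \<open>b\<close> of \<open>F\<^bsub>i+1\<^esub>\<close>.\<close>

record (overloaded) 'k free_complex =
  fbasis :: "nat \<Rightarrow> nat set"
  fdeg :: "nat \<Rightarrow> nat \<Rightarrow> int vec"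
  faug :: "nat \<Rightarrow> 'k mpoly"
  fdiff :: "nat \<Rightarrow> nat \<Rightarrow> (nat \<Rightarrow>\<^sub>0 'k mpoly)"

definition fmod :: "nat \<Rightarrow> 'k::comm_ring_1 free_complex \<Rightarrow> nat \<Rightarrow> (nat \<Rightarrow>\<^sub>0 'k mpoly) set" where
  "fmod s F i = {f. Poly_Mapping.keys f \<subseteq> fbasis F i \<and> (\<forall>b. Poly_Mapping.lookup f b \<in> mpolys s)}"

definition fmod_deg ::
  "int mat \<Rightarrow> 'k::comm_ring_1 free_complex \<Rightarrow> nat \<Rightarrow> int vec \<Rightarrow> (nat \<Rightarrow>\<^sub>0 'k mpoly) set" where
  "fmod_deg A F i \<alpha> = {f \<in> fmod (dim_col A) F i.
     \<forall>b\<in>Poly_Mapping.keys f. \<forall>m\<in>Poly_Mapping.keys (Poly_Mapping.lookup f b). mon_deg A m + fdeg F i b = \<alpha>}"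

definition faug_map :: "'k::comm_ring_1 free_complex \<Rightarrow> (nat \<Rightarrow>\<^sub>0 'k mpoly) \<Rightarrow> 'k mpoly" where
  "faug_map F f = (\<Sum>b\<in>Poly_Mapping.keys f. Poly_Mapping.lookup f b * faug F b)"

abbreviation fdiff_map ::
  "'k::comm_ring_1 free_complex \<Rightarrow> nat \<Rightarrow> (nat \<Rightarrow>\<^sub>0 'k mpoly) \<Rightarrow> (nat \<Rightarrow>\<^sub>0 'k mpoly)" where
  "fdiff_map F i \<equiv> lin_ext (fdiff F i)"

text \<open>\<open>F\<close> is a graded free resolution of \<open>R/I\<close>, with \<open>R\<close> graded by the columns of \<open>A\<close>. The
  \<open>F\<^sub>i\<close> may have infinite rank, but only finitely many basis elements in each degree, so that the
  graded pieces of \<open>F\<^sub>i \<otimes> K\<close> are finite-dimensional.\<close>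

definition graded_free_resolution ::
  "int mat \<Rightarrow> 'k::comm_ring_1 mpoly set \<Rightarrow> 'k free_complex \<Rightarrow> bool" where
  "graded_free_resolution A I F \<longleftrightarrow>
     (\<forall>i. \<forall>b\<in>fbasis F i. fdeg F i b \<in> carrier_vec (dim_row A)) \<and>
     (\<forall>i \<alpha>. finite {b \<in> fbasis F i. fdeg F i b = \<alpha>}) \<and>
     (\<forall>b\<in>fbasis F 0. faug F b \<in> homog A (fdeg F 0 b)) \<and>
     (\<forall>i. \<forall>b\<in>fbasis F (Suc i). fdiff F i b \<in> fmod_deg A F i (fdeg F (Suc i) b)) \<and>
     (\<forall>p\<in>mpolys (dim_col A). \<exists>f\<in>fmod (dim_col A) F 0. p - faug_map F f \<in> I) \<and>
     {f \<in> fmod (dim_col A) F 0. faug_map F f \<in> I} = fdiff_map F 0 ` fmod (dim_col A) F 1 \<and>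
     (\<forall>i. {f \<in> fmod (dim_col A) F (Suc i). fdiff_map F i f = 0} =
            fdiff_map F (Suc i) ` fmod (dim_col A) F (Suc (Suc i)))"

text \<open>The complex \<open>F \<otimes> K\<close>, where \<open>K = R/(x\<^sub>0, \<dots>, x\<^bsub>s-1\<^esub>)\<close>: \<open>F\<^sub>i \<otimes> K\<close> is the vector space on the
  basis of \<open>F\<^sub>i\<close>, and the matrix of \<open>d \<otimes> K\<close> consists of the constant coefficients of the
  matrix of \<open>d\<close>.\<close>

definition kmod_deg ::
  "'k::comm_ring_1 free_complex \<Rightarrow> nat \<Rightarrow> int vec \<Rightarrow> (nat \<Rightarrow>\<^sub>0 'k) set" where
  "kmod_deg F i \<alpha> = {f. Poly_Mapping.keys f \<subseteq> {b \<in> fbasis F i. fdeg F i b = \<alpha>}}"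

definition kdiff_map ::
  "'k::comm_ring_1 free_complex \<Rightarrow> nat \<Rightarrow> (nat \<Rightarrow>\<^sub>0 'k) \<Rightarrow> (nat \<Rightarrow>\<^sub>0 'k)" where
  "kdiff_map F i = lin_ext (\<lambda>b. Poly_Mapping.map (\<lambda>p. Poly_Mapping.lookup p 0) (fdiff F i b))"

definition tor_cycles ::
  "'k::comm_ring_1 free_complex \<Rightarrow> nat \<Rightarrow> int vec \<Rightarrow> (nat \<Rightarrow>\<^sub>0 'k) set" where
  "tor_cycles F i \<alpha> =
     {f \<in> kmod_deg F i \<alpha>. case i of 0 \<Rightarrow> True | Suc j \<Rightarrow> kdiff_map F j f = 0}"

definition tor_boundaries ::
  "'k::comm_ring_1 free_complex \<Rightarrow> nat \<Rightarrow> int vec \<Rightarrow> (nat \<Rightarrow>\<^sub>0 'k) set" where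
  "tor_boundaries F i \<alpha> = kdiff_map F i ` kmod_deg F (Suc i) \<alpha>"

global_interpretation kvec: vector_space "pm_smult :: 'k::field \<Rightarrow> (nat \<Rightarrow>\<^sub>0 'k) \<Rightarrow> (nat \<Rightarrow>\<^sub>0 'k)"
  by unfold_locales
    (rule poly_mapping_eqI; simp add: lookup_pm_smult lookup_add algebra_simps)+

text \<open>The dimension of the homology of \<open>F \<otimes> K\<close>; both spaces are finite-dimensional when \<open>F\<close>
  is a graded free resolution.\<close>

definition tor_dim :: "'k::field free_complex \<Rightarrow> nat \<Rightarrow> int vec \<Rightarrow> nat" where
  "tor_dim F i \<alpha> = kvec.dim (tor_cycles F i \<alpha>) - kvec.dim (tor_boundaries F i \<alpha>)"

text \<open>The multigraded Betti number of \<open>R/I\<close>. As usual, \<open>Tor\<close> is computed from some graded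
  free resolution; the result does not depend on the choice.\<close>

definition betti :: "int mat \<Rightarrow> 'k::field mpoly set \<Rightarrow> int \<Rightarrow> int vec \<Rightarrow> nat" where
  "betti A I i \<alpha> =
     (if 0 \<le> i \<and> \<alpha> \<in> carrier_vec (dim_row A) \<and> nonneg_vec \<alpha>
      then tor_dim (SOME F. graded_free_resolution A I F) (nat i) \<alpha>
      else 0)"

end

theory Submission
  imports Defs "HOL-Library.Countable_Set"
begin

text \<open>Let \<open>L\<close> be the sum of the block lattices, so that the kernel of \<open>A\<close> is \<open>L \<oplus> \<int>\<tau>\<close>, and let
  \<open>f = binom \<tau>\<close>. A polynomial lies in \<open>J\<close> iff its coefficients sum to 0 over every class of monomials
  modulo \<open>L\<close>; as \<open>\<tau>\<close> has infinite order modulo \<open>L\<close>, \<open>f\<close> is a nonzerodivisor on \<open>R/J\<close>. The sign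
  condition on \<open>\<tau>\<close> in the blocks gives \<open>I\<^sub>A = J + (f)\<close>. Hence the mapping cone of multiplication by \<open>f\<close>
  on a graded free resolution of \<open>R/J\<close> resolves \<open>R/I\<^sub>A\<close>. Since \<open>f\<close> has no constant term, the
  cone tensored with \<open>K\<close> splits, and its homology gives the two Betti numbers. All this is computed with
  one resolution of \<open>R/J\<close> whose basis degrees are nonnegative, so that \<open>Tor\<close> vanishes in the degrees
  \<open>\<alpha> - \<mu>\<close> outside \<open>\<nat>\<^sup>N\<close>; the comparison theorem transfers the result to the resolutions
  chosen in the definition of \<open>betti\<close>.\<close>

text \<open>The class sums of a polynomial are the coefficients of its image in the group ring of
  Z^s/L, so membership in J is a family of linear conditions and multiplication by f becomes a
  difference of two translates along \<tau>. Directness of the sum gives \<tau> infinite order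
  modulo L. The sign condition shapes the proof of I_A = J + (f): a multiple of \<tau> has to be
  split off without making an exponent negative. Mixed signs in a block break this: for L =
  Z(1,-1,0,0) and \<tau> = (1,-1,1,-1), f is congruent to x_1 (x_3 - x_4) modulo J, while x_3 - x_4
  already lies in I_A. That f has no constant term comes from the grading: neither \<tau> nor
  -\<tau> is nonnegative, so both monomials of f are nontrivial. As \<open>betti\<close> refers to
  an arbitrarily chosen resolution, existence and independence of the choice both have to be proved.
  Everything is done one degree at a time, where all spaces are finite-dimensional, even if the
  modules have infinite rank.\<close>

abbreviation keys :: "('a \<Rightarrow>\<^sub>0 'b::zero) \<Rightarrow> 'a set" where "keys \<equiv> Poly_Mapping.keys"
abbreviation lookup :: "('a \<Rightarrow>\<^sub>0 'b::zero) \<Rightarrow> 'a \<Rightarrow> 'b" where "lookup \<equiv> Poly_Mapping.lookup"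
abbreviation single :: "'a \<Rightarrow> 'b \<Rightarrow> ('a \<Rightarrow>\<^sub>0 'b::zero)" where "single \<equiv> Poly_Mapping.single"

section \<open>Polynomials and linear maps of free modules\<close>

lemma poly_mapping_sum_single: "f = (\<Sum>b\<in>keys f. single b (lookup f b))"
  by (rule poly_mapping_eqI) (auto simp: lookup_sum lookup_single when_def in_keys_iff)

text \<open>Only terms of \<open>f\<close> itself enter the base case, so conditions on the support
  and the coefficients of \<open>f\<close> stay available during the induction.\<close>

lemma poly_mapping_add_induct [case_names zero single add]:
  fixes f :: "'a \<Rightarrow>\<^sub>0 'b::comm_monoid_add"
  assumes "P 0" "\<And>b. b \<in> keys f \<Longrightarrow> P (single b (lookup f b))" "\<And>g h. P g \<Longrightarrow> P h \<Longrightarrow> P (g + h)"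
  shows "P f"
proof -
  have "P (\<Sum>b\<in>B. single b (lookup f b))" if "finite B" "B \<subseteq> keys f" for B
    using that by (induction B rule: finite_induct) (auto intro: assms)
  then show ?thesis
    using poly_mapping_sum_single[of f] finite_keys[of f] by (metis order_refl)
qed

text \<open>A sum of exponents vanishes only if both summands do. Hence taking the constant
  coefficient is the ring homomorphism R -> K sending all variables to 0, which makes
  \<open>kred\<close> below compatible with composition.\<close>

lemma lookup_mult_0: "lookup (p * q) 0 = lookup p 0 * lookup q (0 :: 'a \<Rightarrow>\<^sub>0 nat)"
proof -
  have "(0 = l + k) \<longleftrightarrow> (l = 0 \<and> k = 0)" for l k :: "'a \<Rightarrow>\<^sub>0 nat"
  proof
    assume eq: "0 = l + k"
    have "lookup l x + lookup k x = 0" for x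
      by (metis eq lookup_add lookup_zero)
    then show "l = 0 \<and> k = 0" by (auto intro!: poly_mapping_eqI)
  qed auto
  then have "(\<Sum>k. lookup q k when 0 = l + k) = (lookup q 0 when l = 0)" for l
    by (cases "l = 0") simp_all
  then show ?thesis
    by (simp add: lookup_mult mult_when)
qed

lemma mpolysI: "(\<And>m. m \<in> keys p \<Longrightarrow> keys m \<subseteq> {..<s}) \<Longrightarrow> p \<in> mpolys s"
  by (auto simp: mpolys_def)

lemma mpolysD: "p \<in> mpolys s \<Longrightarrow> m \<in> keys p \<Longrightarrow> keys m \<subseteq> {..<s}"
  by (auto simp: mpolys_def)

lemma mpolys_0 [simp]: "0 \<in> mpolys s" and mpolys_1 [simp]: "1 \<in> mpolys s"
  by (auto simp: mpolys_def)

lemma mpolys_add [intro]: "p \<in> mpolys s \<Longrightarrow> q \<in> mpolys s \<Longrightarrow> p + q \<in> mpolys s"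
  using keys_add[of p q] by (auto simp: mpolys_def)

lemma mpolys_uminus_iff [simp]: "- p \<in> mpolys s \<longleftrightarrow> (p :: 'k::ab_group_add mpoly) \<in> mpolys s"
  by (auto simp: mpolys_def in_keys_iff)

lemma mpolys_diff [intro]: "p \<in> mpolys s \<Longrightarrow> q \<in> mpolys s \<Longrightarrow> p - q \<in> mpolys s"
  for p q :: "'k::ab_group_add mpoly"
  using mpolys_add[of p s "- q"] by simp

lemma mpolys_mult [intro]:
  assumes "p \<in> mpolys s" "q \<in> mpolys s" shows "p * q \<in> mpolys s"
proof (rule mpolysI)
  fix m assume "m \<in> keys (p * q)"
  then obtain a b where m: "m = a + b" "a \<in> keys p" "b \<in> keys q"
    using keys_mult[of p q] by auto
  have "keys m \<subseteq> keys a \<union> keys b" unfolding m by (rule keys_add)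
  then show "keys m \<subseteq> {..<s}" using m(2,3) assms mpolysD by blast
qed

lemma mpolys_single: "keys m \<subseteq> {..<s} \<Longrightarrow> single m c \<in> mpolys s"
  by (auto simp: mpolys_def)

lemma mpolys_induct [consumes 1, case_names zero single add]:
  fixes p :: "'k::comm_monoid_add mpoly"
  assumes "p \<in> mpolys s" "P 0" "\<And>m c. keys m \<subseteq> {..<s} \<Longrightarrow> P (single m c)"
    "\<And>p q. P p \<Longrightarrow> P q \<Longrightarrow> P (p + q)"
  shows "P p"
proof (induction p rule: poly_mapping_add_induct)
  case (single m)
  then show ?case using assms(3) mpolysD[OF assms(1)] by blast
qed (use assms in auto)

lemma pm_smult_add: "pm_smult c (f + g) = pm_smult c f + pm_smult c g"
  and pm_smult_add_left: "pm_smult (c + d) f = pm_smult c f + pm_smult d f"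
  and pm_smult_diff: "pm_smult c (f - g) = pm_smult c f - pm_smult c g"
  and pm_smult_mult: "pm_smult (c * d) f = pm_smult c (pm_smult d f)"
  and pm_smult_uminus: "pm_smult c (- f) = - pm_smult c f"
  and pm_smult_0 [simp]: "pm_smult c 0 = 0"
  and pm_smult_0_left [simp]: "pm_smult 0 f = 0"
  and pm_smult_1 [simp]: "pm_smult 1 f = f"
  and pm_smult_minus_1 [simp]: "pm_smult (- 1) f = - f"
  and pm_smult_single: "pm_smult c (single b d) = single b (c * d)"
  by (rule poly_mapping_eqI; simp add: lookup_pm_smult lookup_add lookup_minus lookup_single when_def algebra_simps)+

lemma pm_smult_sum: "pm_smult c (sum g T) = (\<Sum>x\<in>T. pm_smult c (g x))"
  by (induction T rule: infinite_finite_induct) (auto simp: pm_smult_add)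

lemma lin_ext_add: "lin_ext \<phi> (f + g) = lin_ext \<phi> f + lin_ext \<phi> g"
  unfolding lin_ext_def by (rule setsum_keys_plus_distrib) (auto simp: pm_smult_add_left)

lemma lin_ext_0 [simp]: "lin_ext \<phi> 0 = 0"
  by (simp add: lin_ext_def)

lemma lin_ext_single [simp]: "lin_ext \<phi> (single b c) = pm_smult c (\<phi> b)"
  by (simp add: lin_ext_def)

lemma lin_ext_smult: "lin_ext \<phi> (pm_smult c f) = pm_smult c (lin_ext \<phi> f)"
  by (induction f rule: poly_mapping_add_induct)
    (auto simp: pm_smult_add lin_ext_add pm_smult_single pm_smult_mult)

lemma lin_ext_uminus: "lin_ext \<phi> (- f) = - lin_ext \<phi> f"
  using lin_ext_smult[of \<phi> "- 1" f] by simp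

lemma lin_ext_diff: "lin_ext \<phi> (f - g) = lin_ext \<phi> f - lin_ext \<phi> g"
  using lin_ext_add[of \<phi> f "- g"] by (simp add: lin_ext_uminus)

lemma lin_ext_cong: "(\<And>b. b \<in> keys f \<Longrightarrow> \<phi> b = \<psi> b) \<Longrightarrow> lin_ext \<phi> f = lin_ext \<psi> f"
  by (simp add: lin_ext_def)

lemma lin_ext_compose: "lin_ext \<phi> (lin_ext \<psi> f) = lin_ext (\<lambda>b. lin_ext \<phi> (\<psi> b)) f"
  by (induction f rule: poly_mapping_add_induct) (auto simp: lin_ext_add lin_ext_smult)

lemma lin_ext_plus_fun: "lin_ext (\<lambda>b. \<phi> b + \<psi> b) f = lin_ext \<phi> f + lin_ext \<psi> f"
  by (simp add: lin_ext_def pm_smult_add sum.distrib)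

lemma lin_ext_diff_fun: "lin_ext (\<lambda>b. \<phi> b - \<psi> b) f = lin_ext \<phi> f - lin_ext \<psi> f"
  by (simp add: lin_ext_def pm_smult_diff sum_subtractf)

lemma lin_ext_zero_fun [simp]: "lin_ext (\<lambda>b. 0) f = 0"
  by (simp add: lin_ext_def)

lemma lin_ext_id [simp]: "lin_ext (\<lambda>b. single b 1) f = f"
  by (induction f rule: poly_mapping_add_induct) (auto simp: lin_ext_add pm_smult_single)

text \<open>Regards the augmentation as a linear map into the free module on the single basis
  element 0, so that facts about \<open>lin_ext\<close>, in particular about homogeneous components,
  carry over to it.\<close>

lemma faug_map_lin_ext: "lin_ext (\<lambda>b. single 0 (faug F b)) f = single 0 (faug_map F f)"
  unfolding lin_ext_def faug_map_def pm_smult_single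
  by (rule poly_mapping_eqI) (simp add: lookup_sum lookup_single when_def)

lemma faug_map_add: "faug_map F (f + g) = faug_map F f + faug_map F g"
  and faug_map_smult: "faug_map F (pm_smult c f) = c * faug_map F f"
  and faug_map_diff: "faug_map F (f - g) = faug_map F f - faug_map F g"
  and faug_map_single: "faug_map F (single b c) = c * faug F b"
proof -
  have eq: "faug_map F f = lookup (lin_ext (\<lambda>b. single 0 (faug F b)) f) 0" for f
    by (simp add: faug_map_lin_ext)
  show "faug_map F (f + g) = faug_map F f + faug_map F g"
    "faug_map F (pm_smult c f) = c * faug_map F f"
    "faug_map F (f - g) = faug_map F f - faug_map F g"
    "faug_map F (single b c) = c * faug F b"
    unfolding eq by (simp_all add: lin_ext_add lin_ext_smult lin_ext_diff lookup_add
        lookup_minus lookup_pm_smult)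
qed

text \<open>\<open>fmod\<close> ties the basis to a stage of a complex. Here the basis, and below
  the degree function, are free parameters, because the rank-one target of the augmentation and
  degree-shifted copies are needed too.\<close>

definition free_mod :: "nat \<Rightarrow> nat set \<Rightarrow> (nat \<Rightarrow>\<^sub>0 'k::zero mpoly) set" where
  "free_mod s B = {f. keys f \<subseteq> B \<and> (\<forall>b. lookup f b \<in> mpolys s)}"

definition free_mod_deg ::
  "int mat \<Rightarrow> nat set \<Rightarrow> (nat \<Rightarrow> int vec) \<Rightarrow> int vec \<Rightarrow> (nat \<Rightarrow>\<^sub>0 'k::zero mpoly) set" where
  "free_mod_deg A B d \<alpha> = {f \<in> free_mod (dim_col A) B.
     \<forall>b\<in>keys f. \<forall>m\<in>keys (lookup f b). mon_deg A m + d b = \<alpha>}"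

lemma fmod_eq: "fmod s F i = free_mod s (fbasis F i)"
  by (simp add: fmod_def free_mod_def)

lemma fmod_deg_eq: "fmod_deg A F i \<alpha> = free_mod_deg A (fbasis F i) (fdeg F i) \<alpha>"
  by (simp add: fmod_deg_def free_mod_deg_def fmod_eq)

lemma free_mod_0 [simp]: "0 \<in> free_mod s B"
  by (simp add: free_mod_def)

lemma free_mod_add [intro]: "f \<in> free_mod s B \<Longrightarrow> g \<in> free_mod s B \<Longrightarrow> f + g \<in> free_mod s B"
  using keys_add[of f g] by (auto simp: free_mod_def lookup_add)

lemma keys_pm_smult: "keys (pm_smult c f) \<subseteq> keys f"
  by (auto simp: in_keys_iff lookup_pm_smult)

lemma free_mod_smult [intro]: "c \<in> mpolys s \<Longrightarrow> f \<in> free_mod s B \<Longrightarrow> pm_smult c f \<in> free_mod s B"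
  using keys_pm_smult[of c f] by (auto simp: free_mod_def lookup_pm_smult)

lemma free_mod_uminus [intro]: "f \<in> free_mod s B \<Longrightarrow> - f \<in> free_mod s B"
  for f :: "nat \<Rightarrow>\<^sub>0 'k::ab_group_add mpoly"
  by (auto simp: free_mod_def in_keys_iff)

lemma free_mod_diff [intro]: "f \<in> free_mod s B \<Longrightarrow> g \<in> free_mod s B \<Longrightarrow> f - g \<in> free_mod s B"
  for f :: "nat \<Rightarrow>\<^sub>0 'k::ab_group_add mpoly"
  using free_mod_add[of f s B "- g"] by auto

lemma free_mod_single: "b \<in> B \<Longrightarrow> p \<in> mpolys s \<Longrightarrow> single b p \<in> free_mod s B"
  by (auto simp: free_mod_def lookup_single when_def)

lemma free_mod_induct [consumes 1, case_names zero single add]: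
  fixes f :: "nat \<Rightarrow>\<^sub>0 'k::comm_monoid_add mpoly"
  assumes "f \<in> free_mod s B" "P 0"
    "\<And>b m c. b \<in> B \<Longrightarrow> keys m \<subseteq> {..<s} \<Longrightarrow> P (single b (single m c))"
    "\<And>f g. P f \<Longrightarrow> P g \<Longrightarrow> P (f + g)"
  shows "P f"
proof (induction f rule: poly_mapping_add_induct)
  case (single b)
  have "lookup f b \<in> mpolys s" "b \<in> B" using assms(1) single by (auto simp: free_mod_def)
  then show ?case
    by (induction rule: mpolys_induct) (auto simp: assms single_add)
qed (use assms in auto)

lemma lin_ext_free_mod:
  assumes "f \<in> free_mod s B" "\<And>b. b \<in> B \<Longrightarrow> \<phi> b \<in> free_mod s B'"
  shows "lin_ext \<phi> f \<in> free_mod s B'"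
  using assms(1)
  by (induction rule: free_mod_induct)
    (auto simp: lin_ext_add intro: assms(2) mpolys_single)

section \<open>Homogeneous components\<close>

lemma mon_deg_carrier [simp]: "mon_deg A m \<in> carrier_vec (dim_row A)"
  by (rule carrier_vecI) (simp add: mon_deg_def)

lemma mon_deg_0 [simp]: "mon_deg A 0 = 0\<^sub>v (dim_row A)"
  by (auto simp: mon_deg_def scalar_prod_def)

lemma mon_deg_add: "mon_deg A (m + m') = mon_deg A m + mon_deg A m'"
proof -
  have "vec (dim_col A) (\<lambda>j. int (lookup (m + m') j)) =
      vec (dim_col A) (\<lambda>j. int (lookup m j)) + vec (dim_col A) (\<lambda>j. int (lookup m' j))"
    by (auto simp: lookup_add)
  then show ?thesis
    unfolding mon_deg_def by (simp add: mult_add_distrib_mat_vec[where nr = "dim_row A" and nc = "dim_col A"])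
qed

definition hpart :: "int mat \<Rightarrow> int vec \<Rightarrow> 'k::zero mpoly \<Rightarrow> 'k mpoly" where
  "hpart A \<alpha> p = Poly_Mapping.mapp (\<lambda>m c. if mon_deg A m = \<alpha> then c else 0) p"

definition hcomp ::
  "int mat \<Rightarrow> (nat \<Rightarrow> int vec) \<Rightarrow> int vec \<Rightarrow> (nat \<Rightarrow>\<^sub>0 'k::zero mpoly) \<Rightarrow> (nat \<Rightarrow>\<^sub>0 'k mpoly)" where
  "hcomp A d \<alpha> f =
     Poly_Mapping.mapp (\<lambda>b p. Poly_Mapping.mapp (\<lambda>m c. if mon_deg A m + d b = \<alpha> then c else 0) p) f"

definition homogeneous_ideal :: "int mat \<Rightarrow> 'k::zero mpoly set \<Rightarrow> bool" where
  "homogeneous_ideal A I \<longleftrightarrow> (\<forall>p\<in>I. \<forall>\<alpha>. hpart A \<alpha> p \<in> I)"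

lemma lookup_hpart: "lookup (hpart A \<alpha> p) m = (if mon_deg A m = \<alpha> then lookup p m else 0)"
  by (auto simp: hpart_def lookup_mapp when_def in_keys_iff)

lemma lookup_hcomp:
  "lookup (lookup (hcomp A d \<alpha> f) b) m = (if mon_deg A m + d b = \<alpha> then lookup (lookup f b) m else 0)"
  by (auto simp: hcomp_def lookup_mapp when_def in_keys_iff)

lemma nested_poly_mapping_eqI:
  "(\<And>b m. lookup (lookup f b) m = lookup (lookup g b) m) \<Longrightarrow> f = g"
  by (intro poly_mapping_eqI) simp

lemma hcomp_0 [simp]: "hcomp A d \<alpha> 0 = 0"
  by (rule nested_poly_mapping_eqI) (simp add: lookup_hcomp)

lemma hcomp_add: "hcomp A d \<alpha> (f + g) = hcomp A d \<alpha> f + hcomp A d \<alpha> g"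
  by (rule nested_poly_mapping_eqI) (simp add: lookup_hcomp lookup_add)

lemma hcomp_single_0:
  "hcomp A (\<lambda>_. 0\<^sub>v (dim_row A)) \<alpha> (single 0 p) = single 0 (hpart A \<alpha> p)"
  by (rule nested_poly_mapping_eqI) (auto simp: lookup_hcomp lookup_hpart lookup_single when_def)

lemma hpart_diff: "hpart A \<alpha> (p - q) = hpart A \<alpha> p - hpart A \<alpha> q"
  for p q :: "'k::ab_group_add mpoly"
  by (rule poly_mapping_eqI) (simp add: lookup_hpart lookup_minus)

lemma hpart_homog: "p \<in> homog A \<alpha> \<Longrightarrow> hpart A \<alpha> p = p"
  by (rule poly_mapping_eqI) (auto simp: lookup_hpart homog_def in_keys_iff)

lemma hcomp_in_free_mod_deg:
  assumes "f \<in> free_mod (dim_col A) B" shows "hcomp A d \<alpha> f \<in> free_mod_deg A B d \<alpha>"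
proof -
  have "keys (hcomp A d \<alpha> f) \<subseteq> keys f"
    unfolding hcomp_def by (rule keys_mapp_subset)
  moreover have "keys (lookup (hcomp A d \<alpha> f) b) \<subseteq> keys (lookup f b)" for b
    by (auto simp: in_keys_iff lookup_hcomp split: if_splits)
  ultimately have "hcomp A d \<alpha> f \<in> free_mod (dim_col A) B"
    using assms unfolding free_mod_def mpolys_def by blast
  then show ?thesis
    by (auto simp: free_mod_deg_def in_keys_iff lookup_hcomp split: if_splits)
qed

lemma free_mod_deg_D1: "f \<in> free_mod_deg A B d \<alpha> \<Longrightarrow> f \<in> free_mod (dim_col A) B"
  by (simp add: free_mod_deg_def)

lemma hcomp_same: "f \<in> free_mod_deg A B d \<alpha> \<Longrightarrow> hcomp A d \<alpha> f = f"
  by (rule nested_poly_mapping_eqI) (force simp: lookup_hcomp free_mod_deg_def in_keys_iff)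

lemma hcomp_other: "f \<in> free_mod_deg A B d \<beta> \<Longrightarrow> \<alpha> \<noteq> \<beta> \<Longrightarrow> hcomp A d \<alpha> f = 0"
  by (rule nested_poly_mapping_eqI) (force simp: lookup_hcomp free_mod_deg_def in_keys_iff)

lemma hcomp_decomp:
  obtains D where "finite D" "f = (\<Sum>\<alpha>\<in>D. hcomp A d \<alpha> f)"
proof -
  define D where "D = (\<lambda>(b, m). mon_deg A m + d b) ` (SIGMA b : keys f. keys (lookup f b))"
  have "finite D" by (auto simp: D_def)
  moreover have "f = (\<Sum>\<alpha>\<in>D. hcomp A d \<alpha> f)"
  proof (rule nested_poly_mapping_eqI)
    fix b m
    have "mon_deg A m + d b \<in> D" if "lookup (lookup f b) m \<noteq> 0"
      using that unfolding D_def by (force simp: in_keys_iff)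
    then show "lookup (lookup f b) m = lookup (lookup (\<Sum>\<alpha>\<in>D. hcomp A d \<alpha> f) b) m"
      using \<open>finite D\<close> by (auto simp: lookup_sum lookup_hcomp)
  qed
  ultimately show thesis using that by blast
qed

lemma free_mod_deg_0 [simp]: "0 \<in> free_mod_deg A B d \<alpha>"
  by (simp add: free_mod_deg_def)

lemma free_mod_deg_add [intro]:
  assumes "f \<in> free_mod_deg A B d \<alpha>" "g \<in> free_mod_deg A B d \<alpha>"
  shows "f + g \<in> free_mod_deg A B d \<alpha>"
proof -
  \<comment> \<open>Elements of degree \<alpha> are those fixed by the additive projection
    \<open>hcomp A d \<alpha>\<close>; arguing this way avoids tracking which terms of the sum
    cancel.\<close>
  have "hcomp A d \<alpha> (f + g) = f + g"
    using assms by (simp add: hcomp_add hcomp_same)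
  then show ?thesis
    using hcomp_in_free_mod_deg[of "f + g" A B d \<alpha>] assms by (auto dest: free_mod_deg_D1)
qed

lemma free_mod_deg_sum [intro]:
  "(\<And>x. x \<in> T \<Longrightarrow> g x \<in> free_mod_deg A B d \<alpha>) \<Longrightarrow> sum g T \<in> free_mod_deg A B d \<alpha>"
  by (induction T rule: infinite_finite_induct) auto

lemma free_mod_deg_smult:
  assumes p: "p \<in> mpolys (dim_col A)" "\<And>m. m \<in> keys p \<Longrightarrow> mon_deg A m + \<beta> = \<alpha>"
    and f: "f \<in> free_mod_deg A B d \<beta>" and d: "\<And>b. b \<in> B \<Longrightarrow> d b \<in> carrier_vec (dim_row A)"
  shows "pm_smult p f \<in> free_mod_deg A B d \<alpha>"
proof -
  have "mon_deg A m + d b = \<alpha>" if b: "b \<in> keys f" and m': "m \<in> keys (p * lookup f b)" for b m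
  proof -
    obtain m1 m2 where m: "m = m1 + m2" "m1 \<in> keys p" "m2 \<in> keys (lookup f b)"
      using keys_mult[of p "lookup f b"] m' by auto
    then have "mon_deg A m2 + d b = \<beta>" "mon_deg A m1 + \<beta> = \<alpha>" "b \<in> B"
      using f p(2) b by (auto simp: free_mod_deg_def free_mod_def)
    then show ?thesis
      using d[of b] by (auto simp: m(1) mon_deg_add assoc_add_vec[where n = "dim_row A"])
  qed
  then show ?thesis
    using f p(1) keys_pm_smult[of p f] unfolding free_mod_deg_def
    by (auto simp: lookup_pm_smult)
qed

lemma free_mod_deg_uminus [intro]:
  "f \<in> free_mod_deg A B d \<alpha> \<Longrightarrow> - f \<in> free_mod_deg A B d \<alpha>"
  for f :: "nat \<Rightarrow>\<^sub>0 'k::ab_group_add mpoly"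
  by (auto simp: free_mod_deg_def)

lemma free_mod_deg_diff [intro]:
  "f \<in> free_mod_deg A B d \<alpha> \<Longrightarrow> g \<in> free_mod_deg A B d \<alpha> \<Longrightarrow> f - g \<in> free_mod_deg A B d \<alpha>"
  for f :: "nat \<Rightarrow>\<^sub>0 'k::ab_group_add mpoly"
  using free_mod_deg_add[of f A B d \<alpha> "- g"] by auto

lemma free_mod_deg_single:
  "b \<in> B \<Longrightarrow> p \<in> mpolys (dim_col A) \<Longrightarrow> (\<And>m. m \<in> keys p \<Longrightarrow> mon_deg A m + d b = \<alpha>) \<Longrightarrow>
   single b p \<in> free_mod_deg A B d \<alpha>"
  using free_mod_single[of b B p "dim_col A"] by (auto simp: free_mod_deg_def split: if_splits)

lemma free_mod_deg_basis:
  "b \<in> B \<Longrightarrow> d b \<in> carrier_vec (dim_row A) \<Longrightarrow> single b 1 \<in> free_mod_deg A B d (d b)"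
  by (rule free_mod_deg_single) (auto split: if_splits)

text \<open>The dimension of the degree vectors is recorded as well, since the laws of vector
  addition hold only for matching dimensions.\<close>

definition graded_map ::
  "int mat \<Rightarrow> nat set \<Rightarrow> (nat \<Rightarrow> int vec) \<Rightarrow> nat set \<Rightarrow> (nat \<Rightarrow> int vec) \<Rightarrow>
   (nat \<Rightarrow> (nat \<Rightarrow>\<^sub>0 'k::zero mpoly)) \<Rightarrow> bool" where
  "graded_map A B d B' d' \<phi> \<longleftrightarrow>
     (\<forall>b\<in>B. d b \<in> carrier_vec (dim_row A)) \<and> (\<forall>b\<in>B'. d' b \<in> carrier_vec (dim_row A)) \<and>
     (\<forall>b\<in>B. \<phi> b \<in> free_mod_deg A B' d' (d b))"

lemma lin_ext_graded_map_free_mod: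
  "graded_map A B d B' d' \<phi> \<Longrightarrow> f \<in> free_mod (dim_col A) B \<Longrightarrow> lin_ext \<phi> f \<in> free_mod (dim_col A) B'"
  by (rule lin_ext_free_mod) (auto simp: graded_map_def dest: free_mod_deg_D1)

lemma lin_ext_graded_map:
  assumes \<phi>: "graded_map A B d B' d' \<phi>" and f: "f \<in> free_mod_deg A B d \<alpha>"
  shows "lin_ext \<phi> f \<in> free_mod_deg A B' d' \<alpha>"
  unfolding lin_ext_def
proof (rule free_mod_deg_sum)
  fix b assume "b \<in> keys f"
  then show "pm_smult (lookup f b) (\<phi> b) \<in> free_mod_deg A B' d' \<alpha>"
    using \<phi> f unfolding graded_map_def
    by (intro free_mod_deg_smult[where \<beta> = "d b"]) (auto simp: free_mod_deg_def free_mod_def)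
qed

text \<open>On a single term both sides are the image of that term or 0, and everything is additive.
  Consequently a component of a preimage is a preimage of the component, so lifts can be chosen
  homogeneous.\<close>

lemma hcomp_lin_ext:
  assumes \<phi>: "graded_map A B d B' d' \<phi>" and f: "f \<in> free_mod (dim_col A) B"
  shows "hcomp A d' \<alpha> (lin_ext \<phi> f) = lin_ext \<phi> (hcomp A d \<alpha> f)"
  using f
proof (induction rule: free_mod_induct)
  case (single b m c)
  define \<beta> where "\<beta> = mon_deg A m + d b"
  have *: "single b (single m c) \<in> free_mod_deg A B d \<beta>"
    using single by (intro free_mod_deg_single) (auto simp: mpolys_single \<beta>_def split: if_splits)
  note ** = lin_ext_graded_map[OF \<phi> *]
  show ?case
    using hcomp_same[OF *] hcomp_same[OF **] hcomp_other[OF *] hcomp_other[OF **]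
    by (cases "\<alpha> = \<beta>") auto
qed (auto simp: hcomp_add lin_ext_add)

lemma single_0_free_mod_deg_iff:
  "single 0 p \<in> free_mod_deg A {0} (\<lambda>_. 0\<^sub>v (dim_row A)) \<alpha> \<longleftrightarrow> p \<in> homog A \<alpha>"
  by (auto simp: free_mod_deg_def free_mod_def homog_def lookup_single when_def mpolys_def)

section \<open>Independence of the resolution\<close>

definition is_ideal :: "nat \<Rightarrow> 'k::comm_ring_1 mpoly set \<Rightarrow> bool" where
  "is_ideal s I \<longleftrightarrow> 0 \<in> I \<and> (\<forall>p\<in>I. \<forall>q\<in>I. p + q \<in> I) \<and> (\<forall>c\<in>mpolys s. \<forall>p\<in>I. c * p \<in> I)"

lemma is_ideal_0: "is_ideal s I \<Longrightarrow> 0 \<in> I"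
  and is_ideal_add: "is_ideal s I \<Longrightarrow> p \<in> I \<Longrightarrow> q \<in> I \<Longrightarrow> p + q \<in> I"
  and is_ideal_mult: "is_ideal s I \<Longrightarrow> c \<in> mpolys s \<Longrightarrow> p \<in> I \<Longrightarrow> c * p \<in> I"
  by (simp_all add: is_ideal_def)

lemma is_ideal_uminus: "is_ideal s I \<Longrightarrow> p \<in> I \<Longrightarrow> - p \<in> I"
  using is_ideal_mult[of s I "- 1" p] by simp

lemma is_ideal_diff: "is_ideal s I \<Longrightarrow> p \<in> I \<Longrightarrow> q \<in> I \<Longrightarrow> p - q \<in> I"
  using is_ideal_add[of s I p "- q"] by (simp add: is_ideal_uminus)

lemma is_ideal_sum: "is_ideal s I \<Longrightarrow> (\<And>x. x \<in> T \<Longrightarrow> g x \<in> I) \<Longrightarrow> sum g T \<in> I"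
  by (induction T rule: infinite_finite_induct) (auto simp: is_ideal_0 is_ideal_add)

text \<open>At stage 0 the next module is R/I, so vanishing there means lying in I. With this
  convention exactness has the same form at every stage.\<close>

definition cycle :: "'k::comm_ring_1 mpoly set \<Rightarrow> 'k free_complex \<Rightarrow> nat \<Rightarrow> (nat \<Rightarrow>\<^sub>0 'k mpoly) \<Rightarrow> bool" where
  "cycle I F i f \<longleftrightarrow> (case i of 0 \<Rightarrow> faug_map F f \<in> I | Suc j \<Rightarrow> fdiff_map F j f = 0)"

lemma cycle_0 [simp]: "cycle I F 0 f \<longleftrightarrow> faug_map F f \<in> I"
  and cycle_Suc [simp]: "cycle I F (Suc i) f \<longleftrightarrow> fdiff_map F i f = 0"
  by (simp_all add: cycle_def)

text \<open>Collects dimension and homogeneity conditions into \<open>graded_map\<close> and merges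
  the two exactness conditions, so that inductions over the stages can treat them uniformly.\<close>

lemma graded_free_resolution_iff:
  "graded_free_resolution A I F \<longleftrightarrow>
     (\<forall>i \<alpha>. finite {b \<in> fbasis F i. fdeg F i b = \<alpha>}) \<and>
     graded_map A (fbasis F 0) (fdeg F 0) {0} (\<lambda>_. 0\<^sub>v (dim_row A)) (\<lambda>b. single 0 (faug F b)) \<and>
     (\<forall>i. graded_map A (fbasis F (Suc i)) (fdeg F (Suc i)) (fbasis F i) (fdeg F i) (fdiff F i)) \<and>
     (\<forall>p\<in>mpolys (dim_col A). \<exists>f\<in>fmod (dim_col A) F 0. p - faug_map F f \<in> I) \<and>
     (\<forall>i. {f \<in> fmod (dim_col A) F i. cycle I F i f} = fdiff_map F i ` fmod (dim_col A) F (Suc i))"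
proof -
  have all_nat: "(\<forall>i. P i) \<longleftrightarrow> P 0 \<and> (\<forall>i. P (Suc i))" for P :: "nat \<Rightarrow> bool"
    by (metis not0_implies_Suc)
  define C where "C i \<longleftrightarrow> (\<forall>b\<in>fbasis F i. fdeg F i b \<in> carrier_vec (dim_row A))" for i
  define E where "E i \<longleftrightarrow> {f \<in> fmod (dim_col A) F i. cycle I F i f} = fdiff_map F i ` fmod (dim_col A) F (Suc i)" for i
  define D where "D i \<longleftrightarrow> (\<forall>b\<in>fbasis F (Suc i).
      fdiff F i b \<in> free_mod_deg A (fbasis F i) (fdeg F i) (fdeg F (Suc i) b))" for i
  define H where "H \<longleftrightarrow> (\<forall>b\<in>fbasis F 0. faug F b \<in> homog A (fdeg F 0 b))"
  define X where "X \<longleftrightarrow> (\<forall>i \<alpha>. finite {b \<in> fbasis F i. fdeg F i b = \<alpha>})"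
  define S where "S \<longleftrightarrow> (\<forall>p\<in>mpolys (dim_col A). \<exists>f\<in>fmod (dim_col A) F 0. p - faug_map F f \<in> I)"
  have "graded_free_resolution A I F \<longleftrightarrow>
      (\<forall>i. C i) \<and> X \<and> H \<and> (\<forall>i. D i) \<and> S \<and> E 0 \<and> (\<forall>i. E (Suc i))"
    by (simp add: graded_free_resolution_def C_def D_def E_def H_def X_def S_def fmod_deg_eq)
  moreover have "graded_map A (fbasis F 0) (fdeg F 0) {0} (\<lambda>_. 0\<^sub>v (dim_row A)) (\<lambda>b. single 0 (faug F b)) \<longleftrightarrow> C 0 \<and> H"
    by (simp add: graded_map_def single_0_free_mod_deg_iff C_def H_def)
  moreover have "graded_map A (fbasis F (Suc i)) (fdeg F (Suc i)) (fbasis F i) (fdeg F i) (fdiff F i)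
      \<longleftrightarrow> C (Suc i) \<and> C i \<and> D i" for i
    by (simp add: graded_map_def C_def D_def)
  ultimately show ?thesis
    unfolding X_def[symmetric] S_def[symmetric] E_def[symmetric] using all_nat[of C] all_nat[of E] by auto
qed

lemma
  assumes "graded_free_resolution A I F"
  shows resolution_finite: "finite {b \<in> fbasis F i. fdeg F i b = \<alpha>}"
    and resolution_aug: "graded_map A (fbasis F 0) (fdeg F 0) {0} (\<lambda>_. 0\<^sub>v (dim_row A)) (\<lambda>b. single 0 (faug F b))"
    and resolution_diff: "graded_map A (fbasis F (Suc i)) (fdeg F (Suc i)) (fbasis F i) (fdeg F i) (fdiff F i)"
    and resolution_surj: "p \<in> mpolys (dim_col A) \<Longrightarrow> \<exists>f\<in>free_mod (dim_col A) (fbasis F 0). p - faug_map F f \<in> I"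
    and resolution_exact: "f \<in> free_mod (dim_col A) (fbasis F i) \<Longrightarrow> cycle I F i f \<Longrightarrow>
          \<exists>g\<in>free_mod (dim_col A) (fbasis F (Suc i)). f = fdiff_map F i g"
    and resolution_complex: "g \<in> free_mod (dim_col A) (fbasis F (Suc i)) \<Longrightarrow> cycle I F i (fdiff_map F i g)"
    and resolution_deg: "b \<in> fbasis F i \<Longrightarrow> fdeg F i b \<in> carrier_vec (dim_row A)"
proof -
  note * = assms[unfolded graded_free_resolution_iff fmod_eq]
  show "finite {b \<in> fbasis F i. fdeg F i b = \<alpha>}" using * by simp
  show "graded_map A (fbasis F 0) (fdeg F 0) {0} (\<lambda>_. 0\<^sub>v (dim_row A)) (\<lambda>b. single 0 (faug F b))"
    using * by simp
  show "graded_map A (fbasis F (Suc i)) (fdeg F (Suc i)) (fbasis F i) (fdeg F i) (fdiff F i)"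
    using * by simp
  show "p \<in> mpolys (dim_col A) \<Longrightarrow> \<exists>f\<in>free_mod (dim_col A) (fbasis F 0). p - faug_map F f \<in> I"
    using * by simp
  have **: "{f \<in> free_mod (dim_col A) (fbasis F i). cycle I F i f} = fdiff_map F i ` free_mod (dim_col A) (fbasis F (Suc i))"
    using * by simp
  show "f \<in> free_mod (dim_col A) (fbasis F i) \<Longrightarrow> cycle I F i f \<Longrightarrow>
          \<exists>g\<in>free_mod (dim_col A) (fbasis F (Suc i)). f = fdiff_map F i g"
    "g \<in> free_mod (dim_col A) (fbasis F (Suc i)) \<Longrightarrow> cycle I F i (fdiff_map F i g)"
    using ** by blast+
  show "b \<in> fbasis F i \<Longrightarrow> fdeg F i b \<in> carrier_vec (dim_row A)"
    using assms by (simp add: graded_free_resolution_def)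
qed

section \<open>Homogeneous lifting and the comparison theorem\<close>

lemma faug_map_hcomp:
  assumes "graded_free_resolution A I F" "f \<in> free_mod (dim_col A) (fbasis F 0)"
  shows "faug_map F (hcomp A (fdeg F 0) \<alpha> f) = hpart A \<alpha> (faug_map F f)"
  using hcomp_lin_ext[OF resolution_aug[OF assms(1)] assms(2), of \<alpha>]
  by (metis faug_map_lin_ext hcomp_single_0 lookup_single_eq)

text \<open>Surjectivity gives some lift of \<open>p\<close>. Its component of degree \<alpha> is
  again a lift, because the new error is a homogeneous component of the old one and I is
  homogeneous.\<close>

lemma aug_lift:
  assumes F: "graded_free_resolution A I F" and I: "homogeneous_ideal A I" and p: "p \<in> homog A \<alpha>"
  shows "\<exists>f\<in>free_mod_deg A (fbasis F 0) (fdeg F 0) \<alpha>. p - faug_map F f \<in> I"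
proof -
  obtain f where f: "f \<in> free_mod (dim_col A) (fbasis F 0)" "p - faug_map F f \<in> I"
    using resolution_surj[OF F, of p] p by (auto simp: homog_def)
  have "hpart A \<alpha> (p - faug_map F f) = p - faug_map F (hcomp A (fdeg F 0) \<alpha> f)"
    by (simp add: hpart_diff hpart_homog[OF p] faug_map_hcomp[OF F f(1)])
  then have "p - faug_map F (hcomp A (fdeg F 0) \<alpha> f) \<in> I"
    using I f(2) unfolding homogeneous_ideal_def by metis
  then show ?thesis
    using hcomp_in_free_mod_deg[OF f(1)] by blast
qed

text \<open>Exactness gives some preimage, and its component of degree \<alpha> is again a
  preimage.\<close>

lemma cycle_lift:
  assumes F: "graded_free_resolution A I F"
    and y: "y \<in> free_mod_deg A (fbasis F i) (fdeg F i) \<alpha>" "cycle I F i y"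
  shows "\<exists>z\<in>free_mod_deg A (fbasis F (Suc i)) (fdeg F (Suc i)) \<alpha>. fdiff_map F i z = y"
proof -
  obtain z where z: "z \<in> free_mod (dim_col A) (fbasis F (Suc i))" "y = fdiff_map F i z"
    using resolution_exact[OF F free_mod_deg_D1[OF y(1)] y(2)] by blast
  have "fdiff_map F i (hcomp A (fdeg F (Suc i)) \<alpha> z) = y"
    using hcomp_lin_ext[OF resolution_diff[OF F] z(1), of \<alpha>] hcomp_same[OF y(1)] z(2) by simp
  then show ?thesis using hcomp_in_free_mod_deg[OF z(1)] by blast
qed

text \<open>Lifts the identity of R/I stage by stage: on a free module it is enough to choose the
  images of the basis elements, and each choice solves a homogeneous lifting problem in G.\<close>

lemma chain_map_exists:
  assumes F: "graded_free_resolution A I F" and G: "graded_free_resolution A I G"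
    and I: "is_ideal (dim_col A) I" "homogeneous_ideal A I"
  obtains \<phi> where
    "\<And>i. graded_map A (fbasis F i) (fdeg F i) (fbasis G i) (fdeg G i) (\<phi> i)"
    "\<And>b. b \<in> fbasis F 0 \<Longrightarrow> faug F b - faug_map G (\<phi> 0 b) \<in> I"
    "\<And>i b. b \<in> fbasis F (Suc i) \<Longrightarrow> fdiff_map G i (\<phi> (Suc i) b) = lin_ext (\<phi> i) (fdiff F i b)"
proof -
  let ?gr = "\<lambda>i \<phi>. graded_map A (fbasis F i) (fdeg F i) (fbasis G i) (fdeg G i) \<phi>"
  \<comment> \<open>That cycles go to cycles is carried along in the recursion: it is what makes the
    next lifting problem solvable.\<close>
  define P where "P i \<phi> \<longleftrightarrow> ?gr i \<phi> \<and>
      (\<forall>f\<in>free_mod (dim_col A) (fbasis F i). cycle I F i f \<longrightarrow> cycle I G i (lin_ext \<phi> f)) \<and>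
      (i = 0 \<longrightarrow> (\<forall>b\<in>fbasis F 0. faug F b - faug_map G (\<phi> b) \<in> I))" for i \<phi>
  define Q where "Q i \<phi> \<phi>' \<longleftrightarrow>
      (\<forall>b\<in>fbasis F (Suc i). fdiff_map G i (\<phi>' b) = lin_ext \<phi> (fdiff F i b))" for i \<phi> \<phi>'
  have "\<exists>\<phi>. P 0 \<phi>"
  proof -
    have "\<forall>b\<in>fbasis F 0. \<exists>f\<in>free_mod_deg A (fbasis G 0) (fdeg G 0) (fdeg F 0 b). faug F b - faug_map G f \<in> I"
      using F by (intro ballI aug_lift[OF G I(2)]) (auto simp: graded_free_resolution_def)
    then obtain \<phi> where \<phi>: "\<And>b. b \<in> fbasis F 0 \<Longrightarrow> \<phi> b \<in> free_mod_deg A (fbasis G 0) (fdeg G 0) (fdeg F 0 b)"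
      "\<And>b. b \<in> fbasis F 0 \<Longrightarrow> faug F b - faug_map G (\<phi> b) \<in> I" by metis
    have "faug_map F f - faug_map G (lin_ext \<phi> f) \<in> I" if "f \<in> free_mod (dim_col A) (fbasis F 0)" for f
      using that
    proof (induction rule: free_mod_induct)
      case zero then show ?case using is_ideal_0[OF I(1)] by (simp add: faug_map_def)
    next
      case (single b m c)
      then show ?case
        using is_ideal_mult[OF I(1) mpolys_single \<phi>(2)]
        by (simp add: faug_map_single faug_map_smult right_diff_distrib)
    next
      case (add f g)
      then show ?case using is_ideal_add[OF I(1) add]
        by (simp add: faug_map_add lin_ext_add algebra_simps)
    qed
    then have "faug_map G (lin_ext \<phi> f) \<in> I"
      if "f \<in> free_mod (dim_col A) (fbasis F 0)" "faug_map F f \<in> I" for f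
      using is_ideal_diff[OF I(1) that(2), of "faug_map F f - faug_map G (lin_ext \<phi> f)"] that(1) by simp
    then have "P 0 \<phi>"
      using \<phi> resolution_deg[OF F] resolution_deg[OF G] by (auto simp: P_def graded_map_def)
    then show ?thesis by blast
  qed
  moreover have "\<exists>\<phi>'. P (Suc i) \<phi>' \<and> Q i \<phi> \<phi>'" if "P i \<phi>" for i \<phi>
  proof -
    have "\<exists>z\<in>free_mod_deg A (fbasis G (Suc i)) (fdeg G (Suc i)) (fdeg F (Suc i) b).
        fdiff_map G i z = lin_ext \<phi> (fdiff F i b)" if b: "b \<in> fbasis F (Suc i)" for b
    proof (rule cycle_lift[OF G])
      have "fdiff F i b \<in> free_mod_deg A (fbasis F i) (fdeg F i) (fdeg F (Suc i) b)"
        using resolution_diff[OF F, of i] b by (auto simp: graded_map_def)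
      moreover have "cycle I F i (fdiff F i b)"
        using resolution_complex[OF F free_mod_single[OF b, of 1]] by simp
      ultimately show "lin_ext \<phi> (fdiff F i b) \<in> free_mod_deg A (fbasis G i) (fdeg G i) (fdeg F (Suc i) b)"
        "cycle I G i (lin_ext \<phi> (fdiff F i b))"
        using \<open>P i \<phi>\<close> unfolding P_def by (auto intro: lin_ext_graded_map free_mod_deg_D1)
    qed
    then obtain \<phi>' where \<phi>': "\<And>b. b \<in> fbasis F (Suc i) \<Longrightarrow>
        \<phi>' b \<in> free_mod_deg A (fbasis G (Suc i)) (fdeg G (Suc i)) (fdeg F (Suc i) b)"
      "\<And>b. b \<in> fbasis F (Suc i) \<Longrightarrow> fdiff_map G i (\<phi>' b) = lin_ext \<phi> (fdiff F i b)" by metis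
    have "fdiff_map G i (lin_ext \<phi>' f) = lin_ext \<phi> (fdiff_map F i f)"
      if "f \<in> free_mod (dim_col A) (fbasis F (Suc i))" for f
      unfolding lin_ext_compose using that by (intro lin_ext_cong) (auto simp: \<phi>'(2) free_mod_def)
    then show ?thesis
      using \<phi>' resolution_deg[OF F] resolution_deg[OF G]
      by (auto simp: P_def Q_def graded_map_def intro!: exI[of _ \<phi>'])
  qed
  ultimately obtain \<phi> where "\<forall>i. P i (\<phi> i)" "\<forall>i. Q i (\<phi> i) (\<phi> (Suc i))"
    using dependent_nat_choice[of P Q] by blast
  then show thesis using that[of \<phi>] unfolding P_def Q_def by blast
qed

text \<open>Since \<chi> induces 0 on R/I, the equation d h = \<chi> - h d can be solved recursively
  on basis elements. The use is for \<chi> the difference between a composite of comparison maps and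
  the identity.\<close>

lemma homotopy_exists:
  assumes F: "graded_free_resolution A I F"
    and \<chi>: "\<And>i. graded_map A (fbasis F i) (fdeg F i) (fbasis F i) (fdeg F i) (\<chi> i)"
      "\<And>b. b \<in> fbasis F 0 \<Longrightarrow> faug_map F (\<chi> 0 b) \<in> I"
      "\<And>i b. b \<in> fbasis F (Suc i) \<Longrightarrow> fdiff_map F i (\<chi> (Suc i) b) = lin_ext (\<chi> i) (fdiff F i b)"
  obtains h where
    "\<And>i. graded_map A (fbasis F i) (fdeg F i) (fbasis F (Suc i)) (fdeg F (Suc i)) (h i)"
    "\<And>b. b \<in> fbasis F 0 \<Longrightarrow> fdiff_map F 0 (h 0 b) = \<chi> 0 b"
    "\<And>i b. b \<in> fbasis F (Suc i) \<Longrightarrow>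
       fdiff_map F (Suc i) (h (Suc i) b) = \<chi> (Suc i) b - lin_ext (h i) (fdiff F i b)"
proof -
  \<comment> \<open>On cycles the term h d vanishes, so d h agrees with \<chi> there. Applied to the
    cycle \<open>fdiff F i b\<close>, this shows that the next right-hand side \<chi> - h d is again
    a cycle.\<close>
  define P where "P i h \<longleftrightarrow>
      graded_map A (fbasis F i) (fdeg F i) (fbasis F (Suc i)) (fdeg F (Suc i)) h \<and>
      (\<forall>f\<in>free_mod (dim_col A) (fbasis F i). cycle I F i f \<longrightarrow> fdiff_map F i (lin_ext h f) = lin_ext (\<chi> i) f) \<and>
      (i = 0 \<longrightarrow> (\<forall>b\<in>fbasis F 0. fdiff_map F 0 (h b) = \<chi> 0 b))" for i h
  define Q where "Q i h h' \<longleftrightarrow>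
      (\<forall>b\<in>fbasis F (Suc i). fdiff_map F (Suc i) (h' b) = \<chi> (Suc i) b - lin_ext h (fdiff F i b))" for i h h'
  have "\<exists>h. P 0 h"
  proof -
    have "\<forall>b\<in>fbasis F 0. \<exists>z\<in>free_mod_deg A (fbasis F (Suc 0)) (fdeg F (Suc 0)) (fdeg F 0 b). fdiff_map F 0 z = \<chi> 0 b"
      using \<chi>(1)[of 0] \<chi>(2) by (intro ballI cycle_lift[OF F]) (auto simp: graded_map_def)
    then obtain h where h: "\<And>b. b \<in> fbasis F 0 \<Longrightarrow> h b \<in> free_mod_deg A (fbasis F (Suc 0)) (fdeg F (Suc 0)) (fdeg F 0 b)"
      "\<And>b. b \<in> fbasis F 0 \<Longrightarrow> fdiff_map F 0 (h b) = \<chi> 0 b" by metis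
    have "fdiff_map F 0 (lin_ext h f) = lin_ext (\<chi> 0) f" if "f \<in> free_mod (dim_col A) (fbasis F 0)" for f
      unfolding lin_ext_compose using that by (intro lin_ext_cong) (auto simp: h(2) free_mod_def)
    then have "P 0 h"
      using h resolution_deg[OF F] by (auto simp: P_def graded_map_def)
    then show ?thesis by blast
  qed
  moreover have "\<exists>h'. P (Suc i) h' \<and> Q i h h'" if "P i h" for i h
  proof -
    have "\<exists>z\<in>free_mod_deg A (fbasis F (Suc (Suc i))) (fdeg F (Suc (Suc i))) (fdeg F (Suc i) b).
        fdiff_map F (Suc i) z = \<chi> (Suc i) b - lin_ext h (fdiff F i b)" if b: "b \<in> fbasis F (Suc i)" for b
    proof (rule cycle_lift[OF F])
      have d: "fdiff F i b \<in> free_mod_deg A (fbasis F i) (fdeg F i) (fdeg F (Suc i) b)"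
        using resolution_diff[OF F, of i] b by (auto simp: graded_map_def)
      have c: "cycle I F i (fdiff F i b)"
        using resolution_complex[OF F free_mod_single[OF b, of 1]] by simp
      have "\<chi> (Suc i) b \<in> free_mod_deg A (fbasis F (Suc i)) (fdeg F (Suc i)) (fdeg F (Suc i) b)"
        using \<chi>(1)[of "Suc i"] b by (auto simp: graded_map_def)
      then show "\<chi> (Suc i) b - lin_ext h (fdiff F i b)
          \<in> free_mod_deg A (fbasis F (Suc i)) (fdeg F (Suc i)) (fdeg F (Suc i) b)"
        using d \<open>P i h\<close> unfolding P_def by (auto intro: lin_ext_graded_map)
      show "cycle I F (Suc i) (\<chi> (Suc i) b - lin_ext h (fdiff F i b))"
        using c free_mod_deg_D1[OF d] \<open>P i h\<close> \<chi>(3)[OF b] unfolding P_def by (simp add: lin_ext_diff)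
    qed
    then obtain h' where h': "\<And>b. b \<in> fbasis F (Suc i) \<Longrightarrow>
        h' b \<in> free_mod_deg A (fbasis F (Suc (Suc i))) (fdeg F (Suc (Suc i))) (fdeg F (Suc i) b)"
      "\<And>b. b \<in> fbasis F (Suc i) \<Longrightarrow> fdiff_map F (Suc i) (h' b) = \<chi> (Suc i) b - lin_ext h (fdiff F i b)" by metis
    have "fdiff_map F (Suc i) (lin_ext h' f) = lin_ext (\<chi> (Suc i)) f - lin_ext h (fdiff_map F i f)"
      if "f \<in> free_mod (dim_col A) (fbasis F (Suc i))" for f
      unfolding lin_ext_compose lin_ext_diff_fun[symmetric]
      using that by (intro lin_ext_cong) (auto simp: h'(2) free_mod_def)
    then show ?thesis
      using h' resolution_deg[OF F] by (auto simp: P_def Q_def graded_map_def intro!: exI[of _ h'])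
  qed
  ultimately obtain h where "\<forall>i. P i (h i)" "\<forall>i. Q i (h i) (h (Suc i))"
    using dependent_nat_choice[of P Q] by blast
  then show thesis using that[of h] unfolding P_def Q_def by blast
qed

text \<open>If \<open>f\<close> induces a surjection \<open>Z'/B' \<rightarrow> Z/B\<close>, then \<open>dim (Z/B) \<le> dim (Z'/B')\<close>; stated additively because
  \<open>dim\<close> has values in \<open>nat\<close>.\<close>

lemma (in vector_space) dim_add_le:
  assumes B: "subspace B" "B \<subseteq> span W" "finite W"
    and Z': "Z' \<subseteq> span W'" "finite W'" and B': "subspace B'" "B' \<subseteq> Z'"
    and f: "\<And>x y. f (x + y) = f x + f y" "\<And>c x. f (scale c x) = scale c (f x)"
    and fB: "\<And>x. x \<in> B' \<Longrightarrow> f x \<in> B"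
    and Z: "\<And>z. z \<in> Z \<Longrightarrow> \<exists>z'\<in>Z'. \<exists>b\<in>B. z = f z' + b"
  shows "dim Z + dim B' \<le> dim Z' + dim B"
proof -
  obtain b where b: "b \<subseteq> B" "independent b" "B \<subseteq> span b" "card b = dim B"
    using basis_exists .
  obtain b' where b': "b' \<subseteq> B'" "independent b'" "B' \<subseteq> span b'" "card b' = dim B'"
    using basis_exists .
  obtain c where c: "b' \<subseteq> c" "c \<subseteq> Z'" "independent c" "Z' \<subseteq> span c"
    using maximal_independent_subset_extend[of b' Z'] b' B' by blast
  have fin: "finite b" "finite c"
    using independent_span_bound[OF B(3) b(2)] independent_span_bound[OF Z'(2) c(3)] b(1) c(2) B(2) Z'(1)
    by auto
  \<comment> \<open>\<open>f\<close> sends the span of \<open>b'\<close> into B, so modulo B only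
    the basis vectors in \<open>c - b'\<close> contribute.\<close>
  let ?S = "f ` (c - b') \<union> b"
  have "Z \<subseteq> span ?S"
  proof
    fix z assume "z \<in> Z"
    then obtain z' b0 where z: "z' \<in> Z'" "b0 \<in> B" "z = f z' + b0" using Z by blast
    have "z' \<in> span ((c - b') \<union> b')"
      using z(1) c(1,4) by (auto simp: Un_absorb2)
    then obtain x y where xy: "x \<in> span (c - b')" "y \<in> span b'" "z' = x + y"
      unfolding span_Un by blast
    have "f 0 = 0" using f(2)[of 0 0] by simp
    then have "subspace {x. f x \<in> span ?S}"
      by (auto simp: subspace_def f span_add span_scale span_zero)
    then have "span (c - b') \<subseteq> {x. f x \<in> span ?S}"
      by (intro span_minimal) (auto intro: span_base)
    moreover have "y \<in> B'" using xy(2) span_minimal[OF b'(1) B'(1)] by blast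
    then have "f y + b0 \<in> B" using fB z(2) B(1) by (simp add: subspace_add)
    then have "f y + b0 \<in> span ?S" using b(3) span_mono[of b ?S] by blast
    ultimately have "f x + (f y + b0) \<in> span ?S" using xy(1) by (blast intro: span_add)
    then show "z \<in> span ?S" by (simp add: z(3) xy(3) f(1) add.assoc)
  qed
  then have "dim Z \<le> card ?S" using fin by (intro dim_le_card) auto
  also have "\<dots> \<le> card (c - b') + card b"
    using card_Un_le[of "f ` (c - b')" b] card_image_le[of "c - b'" f] fin by simp
  also have "card (c - b') = dim Z' - dim B'"
    using c b' fin(2) finite_subset[OF c(1)] basis_card_eq_dim[OF c(2,4,3)] by (simp add: card_Diff_subset)
  also have "dim B' \<le> dim Z'"
    using b'(4) basis_card_eq_dim[OF c(2,4,3)] card_mono[OF fin(2) c(1)] by simp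
  then have "dim Z' - dim B' + card b + dim B' = dim Z' + dim B" using b(4) by simp
  finally show ?thesis by simp
qed

section \<open>Reduction modulo the variables, and Tor\<close>

definition kred :: "(nat \<Rightarrow>\<^sub>0 'k::zero mpoly) \<Rightarrow> (nat \<Rightarrow>\<^sub>0 'k)" where
  "kred f = Poly_Mapping.map (\<lambda>p. lookup p 0) f"

lemma lookup_kred: "lookup (kred f) b = lookup (lookup f b) 0"
  by (simp add: kred_def Poly_Mapping.map.rep_eq when_def)

lemma kred_add: "kred (f + g) = kred f + kred g"
  and kred_diff: "kred (f' - g') = kred f' - kred g'"
  for f g :: "nat \<Rightarrow>\<^sub>0 'k::comm_monoid_add mpoly" and f' g' :: "nat \<Rightarrow>\<^sub>0 'l::ab_group_add mpoly"
  by (rule poly_mapping_eqI; simp add: lookup_kred lookup_add lookup_minus)+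

lemma kred_0 [simp]: "kred 0 = 0"
  by (rule poly_mapping_eqI) (simp add: lookup_kred)

lemma kred_smult: "kred (pm_smult p f) = pm_smult (lookup p 0) (kred f)"
  by (rule poly_mapping_eqI) (simp add: lookup_kred lookup_pm_smult lookup_mult_0)

lemma kred_single: "kred (single b p) = single b (lookup p 0)"
  by (rule poly_mapping_eqI) (simp add: lookup_kred lookup_single when_def)

text \<open>Taking constant coefficients is a ring homomorphism, so reduction is functorial:
  identities between maps over R, such as d d = 0 or a homotopy, pass to the reduced
  complex.\<close>

lemma kred_lin_ext: "kred (lin_ext \<phi> f) = lin_ext (\<lambda>b. kred (\<phi> b)) (kred f)"
  by (induction f rule: poly_mapping_add_induct)
    (auto simp: lin_ext_add kred_add kred_smult kred_single)

lemma lin_ext_kred_compose: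
  "lin_ext (\<lambda>b. kred (\<phi> b)) (lin_ext (\<lambda>b. kred (\<psi> b)) g) = lin_ext (\<lambda>b. kred (lin_ext \<phi> (\<psi> b))) g"
  by (simp add: lin_ext_compose kred_lin_ext)

lemma kdiff_map_eq: "kdiff_map F i = lin_ext (\<lambda>b. kred (fdiff F i b))"
  by (simp add: kdiff_map_def kred_def)

lemma kmod_deg_sum: "(\<And>x. x \<in> T \<Longrightarrow> g x \<in> kmod_deg F i \<alpha>) \<Longrightarrow> sum g T \<in> kmod_deg F i \<alpha>"
  using keys_sum[of g T] by (fastforce simp: kmod_deg_def)

lemma kmod_deg_iff: "f \<in> kmod_deg F i \<alpha> \<longleftrightarrow> (\<forall>b. lookup f b \<noteq> 0 \<longrightarrow> b \<in> fbasis F i \<and> fdeg F i b = \<alpha>)"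
  by (auto simp: kmod_deg_def in_keys_iff)

lemma subspace_kmod_deg: "kvec.subspace (kmod_deg F i \<alpha>)"
  by (auto simp: kvec.subspace_def kmod_deg_iff lookup_add lookup_pm_smult) (metis add_0)+

lemma subspace_tor_cycles: "kvec.subspace (tor_cycles F i \<alpha>)"
  using subspace_kmod_deg[of F i \<alpha>]
  by (auto simp: kvec.subspace_def tor_cycles_def kdiff_map_eq lin_ext_add lin_ext_smult split: nat.split)

lemma subspace_tor_boundaries: "kvec.subspace (tor_boundaries F i \<alpha>)"
  unfolding kvec.subspace_def
proof (intro conjI ballI allI)
  note sub = subspace_kmod_deg[of F "Suc i" \<alpha>]
  show "0 \<in> tor_boundaries F i \<alpha>"
    using kvec.subspace_0[OF sub] lin_ext_0 unfolding tor_boundaries_def kdiff_map_eq by (metis image_eqI)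
  show "x + y \<in> tor_boundaries F i \<alpha>" if "x \<in> tor_boundaries F i \<alpha>" "y \<in> tor_boundaries F i \<alpha>" for x y
    using that kvec.subspace_add[OF sub] unfolding tor_boundaries_def kdiff_map_eq
    by (auto simp flip: lin_ext_add)
  show "pm_smult c x \<in> tor_boundaries F i \<alpha>" if "x \<in> tor_boundaries F i \<alpha>" for c x
    using that kvec.subspace_scale[OF sub] unfolding tor_boundaries_def kdiff_map_eq
    by (auto simp flip: lin_ext_smult)
qed

lemma kmod_deg_span: "kmod_deg F i \<alpha> \<subseteq> kvec.span ((\<lambda>b. single b 1) ` {b \<in> fbasis F i. fdeg F i b = \<alpha>})"
proof
  fix f :: "nat \<Rightarrow>\<^sub>0 'a" assume f: "f \<in> kmod_deg F i \<alpha>"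
  have "f = (\<Sum>b\<in>keys f. pm_smult (lookup f b) (single b 1))"
    using poly_mapping_sum_single[of f] by (simp add: pm_smult_single)
  also have "\<dots> \<in> kvec.span ((\<lambda>b. single b 1) ` {b \<in> fbasis F i. fdeg F i b = \<alpha>})"
    using f by (intro kvec.span_sum kvec.span_scale kvec.span_base) (auto simp: kmod_deg_def)
  finally show "f \<in> kvec.span ((\<lambda>b. single b 1) ` {b \<in> fbasis F i. fdeg F i b = \<alpha>})" .
qed

text \<open>A constant term has degree 0, so a nonzero reduced matrix entry can only join basis
  elements of equal degree.\<close>

lemma graded_map_kmod_deg:
  fixes F G :: "'k::field free_complex"
  assumes \<phi>: "graded_map A (fbasis F i) (fdeg F i) (fbasis G j) (fdeg G j) \<phi>" and f: "f \<in> kmod_deg F i \<alpha>"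
  shows "lin_ext (\<lambda>b. kred (\<phi> b)) f \<in> kmod_deg G j \<alpha>"
  unfolding lin_ext_def
proof (rule kmod_deg_sum)
  fix b assume "b \<in> keys f"
  then have b: "b \<in> fbasis F i" "fdeg F i b = \<alpha>" using f by (auto simp: kmod_deg_def)
  show "pm_smult (lookup f b) (kred (\<phi> b)) \<in> kmod_deg G j \<alpha>"
    unfolding kmod_deg_iff
  proof (intro allI impI)
    fix c assume "lookup (pm_smult (lookup f b) (kred (\<phi> b))) c \<noteq> 0"
    then have "0 \<in> keys (lookup (\<phi> b) c)" "c \<in> keys (\<phi> b)"
      by (auto simp: lookup_pm_smult lookup_kred in_keys_iff)
    then have "c \<in> fbasis G j" "mon_deg A 0 + fdeg G j c = \<alpha>"
      using \<phi> b by (force simp: graded_map_def free_mod_deg_def free_mod_def)+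
    then show "c \<in> fbasis G j \<and> fdeg G j c = \<alpha>"
      using \<phi> by (auto simp: graded_map_def)
  qed
qed

lemma tor_cycles_D: "f \<in> tor_cycles F i \<alpha> \<Longrightarrow> f \<in> kmod_deg F i \<alpha>"
  by (simp add: tor_cycles_def)

lemma tor_boundaries_subset:
  fixes F :: "'k::field free_complex"
  assumes F: "graded_free_resolution A I F"
  shows "tor_boundaries F i \<alpha> \<subseteq> tor_cycles F i \<alpha>"
proof
  fix f assume "f \<in> tor_boundaries F i \<alpha>"
  then obtain g where g: "g \<in> kmod_deg F (Suc i) \<alpha>" "f = kdiff_map F i g"
    by (auto simp: tor_boundaries_def)
  have "kdiff_map F j (kdiff_map F (Suc j) g) = 0" if "i = Suc j" for j
  proof -
    have "lin_ext (\<lambda>b. kred (fdiff_map F j (fdiff F (Suc j) b))) g = lin_ext (\<lambda>b. 0) g"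
    proof (rule lin_ext_cong)
      fix b assume "b \<in> keys g"
      then have "b \<in> fbasis F (Suc (Suc j))" using g that by (auto simp: kmod_deg_def)
      then have "cycle I F (Suc j) (fdiff_map F (Suc j) (single b 1))"
        by (intro resolution_complex[OF F] free_mod_single) auto
      then show "kred (fdiff_map F j (fdiff F (Suc j) b)) = 0" by simp
    qed
    then show ?thesis by (simp add: kdiff_map_eq lin_ext_kred_compose)
  qed
  then show "f \<in> tor_cycles F i \<alpha>"
    using g graded_map_kmod_deg[OF resolution_diff[OF F] g(1)]
    by (auto simp: tor_cycles_def kdiff_map_eq split: nat.split)
qed

text \<open>The finiteness condition on each degree supplies \<open>W\<close>; a finite spanning set
  is what makes the natural-number valued \<open>dim\<close> behave as a dimension.\<close>

lemma tor_dims: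
  fixes F :: "'k::field free_complex"
  assumes F: "graded_free_resolution A I F"
  obtains W where "finite W" "tor_cycles F i \<alpha> \<subseteq> kvec.span W" "tor_boundaries F i \<alpha> \<subseteq> kvec.span W"
proof
  let ?W = "(\<lambda>b. single b 1) ` {b \<in> fbasis F i. fdeg F i b = \<alpha>} :: (nat \<Rightarrow>\<^sub>0 'k) set"
  show "finite ?W" using resolution_finite[OF F] by simp
  show "tor_cycles F i \<alpha> \<subseteq> kvec.span ?W"
    using kmod_deg_span[of F i \<alpha>] tor_cycles_D by blast
  then show "tor_boundaries F i \<alpha> \<subseteq> kvec.span ?W"
    using tor_boundaries_subset[OF F] by blast
qed

text \<open>Comparison maps in both directions compose on F to a map homotopic to the identity, so
  Tor computed with G maps onto Tor computed with F. \<open>dim_add_le\<close> turns this into the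
  inequality.\<close>

lemma tor_dim_le:
  fixes F G :: "'k::field free_complex"
  assumes F: "graded_free_resolution A I F" and G: "graded_free_resolution A I G"
    and I: "is_ideal (dim_col A) I" "homogeneous_ideal A I"
  shows "tor_dim F i \<alpha> \<le> tor_dim G i \<alpha>"
proof -
  let ?R = "dim_col A"
  obtain \<phi> where \<phi>: "\<And>i. graded_map A (fbasis F i) (fdeg F i) (fbasis G i) (fdeg G i) (\<phi> i)"
    "\<And>b. b \<in> fbasis F 0 \<Longrightarrow> faug F b - faug_map G (\<phi> 0 b) \<in> I"
    "\<And>i b. b \<in> fbasis F (Suc i) \<Longrightarrow> fdiff_map G i (\<phi> (Suc i) b) = lin_ext (\<phi> i) (fdiff F i b)"
    by (rule chain_map_exists[OF F G I]) blast
  obtain \<psi> where \<psi>: "\<And>i. graded_map A (fbasis G i) (fdeg G i) (fbasis F i) (fdeg F i) (\<psi> i)"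
    "\<And>b. b \<in> fbasis G 0 \<Longrightarrow> faug G b - faug_map F (\<psi> 0 b) \<in> I"
    "\<And>i b. b \<in> fbasis G (Suc i) \<Longrightarrow> fdiff_map F i (\<psi> (Suc i) b) = lin_ext (\<psi> i) (fdiff G i b)"
    by (rule chain_map_exists[OF G F I]) blast
  \<comment> \<open>This map induces 0 on R/I, hence is null-homotopic.\<close>
  define \<chi> where "\<chi> i b = lin_ext (\<psi> i) (\<phi> i b) - single b 1" for i b
  have lin_ext_\<chi>: "lin_ext (\<chi> i) f = lin_ext (\<psi> i) (lin_ext (\<phi> i) f) - f" for i f
    unfolding \<chi>_def lin_ext_diff_fun by (simp add: lin_ext_compose)
  have \<psi>_chain: "fdiff_map F i (lin_ext (\<psi> (Suc i)) g) = lin_ext (\<psi> i) (fdiff_map G i g)"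
    if "g \<in> free_mod ?R (fbasis G (Suc i))" for i g
    unfolding lin_ext_compose using that by (intro lin_ext_cong \<psi>(3)) (auto simp: free_mod_def)
  have \<psi>_aug: "faug_map G g - faug_map F (lin_ext (\<psi> 0) g) \<in> I"
    if "g \<in> free_mod ?R (fbasis G 0)" for g
    using that
  proof (induction rule: free_mod_induct)
    case zero then show ?case using is_ideal_0[OF I(1)] by (simp add: faug_map_def)
  next
    case (single b m c)
    then show ?case
      using is_ideal_mult[OF I(1) mpolys_single \<psi>(2)]
      by (simp add: faug_map_single faug_map_smult right_diff_distrib)
  next
    case (add f g)
    then show ?case using is_ideal_add[OF I(1) add]
      by (simp add: faug_map_add lin_ext_add algebra_simps)
  qed
  have \<phi>_mod: "\<phi> i b \<in> free_mod_deg A (fbasis G i) (fdeg G i) (fdeg F i b)" if "b \<in> fbasis F i" for i b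
    using \<phi>(1)[of i] that by (auto simp: graded_map_def)
  obtain h where h: "\<And>i. graded_map A (fbasis F i) (fdeg F i) (fbasis F (Suc i)) (fdeg F (Suc i)) (h i)"
    "\<And>b. b \<in> fbasis F 0 \<Longrightarrow> fdiff_map F 0 (h 0 b) = \<chi> 0 b"
    "\<And>i b. b \<in> fbasis F (Suc i) \<Longrightarrow>
       fdiff_map F (Suc i) (h (Suc i) b) = \<chi> (Suc i) b - lin_ext (h i) (fdiff F i b)"
  proof (rule homotopy_exists[OF F])
    show "graded_map A (fbasis F i) (fdeg F i) (fbasis F i) (fdeg F i) (\<chi> i)" for i
      using resolution_deg[OF F] \<phi>_mod lin_ext_graded_map[OF \<psi>(1)[of i]]
      unfolding graded_map_def \<chi>_def by (auto intro!: free_mod_deg_diff free_mod_deg_basis)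
    show "faug_map F (\<chi> 0 b) \<in> I" if "b \<in> fbasis F 0" for b
    proof -
      have "faug_map F (\<chi> 0 b) = - ((faug F b - faug_map G (\<phi> 0 b)) +
          (faug_map G (\<phi> 0 b) - faug_map F (lin_ext (\<psi> 0) (\<phi> 0 b))))"
        by (simp add: \<chi>_def faug_map_diff faug_map_single)
      also have "\<dots> \<in> I"
        by (rule is_ideal_uminus[OF I(1) is_ideal_add[OF I(1) \<phi>(2)[OF that]
              \<psi>_aug[OF free_mod_deg_D1[OF \<phi>_mod[OF that]]]]])
      finally show ?thesis .
    qed
    show "fdiff_map F i (\<chi> (Suc i) b) = lin_ext (\<chi> i) (fdiff F i b)" if "b \<in> fbasis F (Suc i)" for i b
      using \<phi>(3)[OF that] \<psi>_chain[OF free_mod_deg_D1[OF \<phi>_mod[OF that]]]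
      by (simp add: lin_ext_\<chi>) (simp add: \<chi>_def lin_ext_diff)
  qed blast
  let ?k = "\<lambda>\<phi>. lin_ext (\<lambda>b. kred (\<phi> b))"
  have \<psi>_cyc: "?k (\<psi> i) z \<in> tor_boundaries F i \<alpha>" if z: "z \<in> tor_boundaries G i \<alpha>" for z
  proof -
    obtain w where w: "w \<in> kmod_deg G (Suc i) \<alpha>" "z = kdiff_map G i w"
      using z by (auto simp: tor_boundaries_def)
    have "?k (\<psi> i) z = kdiff_map F i (?k (\<psi> (Suc i)) w)"
      unfolding w(2) kdiff_map_eq lin_ext_kred_compose
      using w(1) by (intro lin_ext_cong) (auto simp: \<psi>(3) kmod_deg_def)
    then show ?thesis using graded_map_kmod_deg[OF \<psi>(1) w(1)] by (auto simp: tor_boundaries_def)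
  qed
  have \<phi>_cyc: "?k (\<phi> i) z \<in> tor_cycles G i \<alpha>" if z: "z \<in> tor_cycles F i \<alpha>" for z
  proof -
    have "kdiff_map G j (?k (\<phi> (Suc j)) z) = 0" if "i = Suc j" for j
    proof -
      have "kdiff_map G j (?k (\<phi> (Suc j)) z) = ?k (\<phi> j) (kdiff_map F j z)"
        unfolding kdiff_map_eq lin_ext_kred_compose
        using tor_cycles_D[OF z] that by (intro lin_ext_cong) (auto simp: \<phi>(3) kmod_deg_def)
      then show ?thesis using z that by (simp add: tor_cycles_def)
    qed
    then show ?thesis
      using graded_map_kmod_deg[OF \<phi>(1) tor_cycles_D[OF z]]
      by (auto simp: tor_cycles_def split: nat.split)
  qed
  have hom: "?k (\<psi> i) (?k (\<phi> i) z) - z \<in> tor_boundaries F i \<alpha>" if z: "z \<in> tor_cycles F i \<alpha>" for z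
  proof -
    have \<chi>_eq: "?k (\<chi> i) z = ?k (\<psi> i) (?k (\<phi> i) z) - z"
      by (simp add: \<chi>_def kred_diff kred_single lin_ext_diff_fun lin_ext_kred_compose)
    \<comment> \<open>On a cycle the term h d of the homotopy identity vanishes, which leaves d
      h.\<close>
    have "?k (\<chi> i) z = kdiff_map F i (?k (h i) z)"
    proof (cases i)
      case 0
      then show ?thesis unfolding kdiff_map_eq lin_ext_kred_compose
        using tor_cycles_D[OF z] by (intro lin_ext_cong) (auto simp: h(2) kmod_deg_def)
    next
      case (Suc j)
      have "kdiff_map F i (?k (h i) z) = lin_ext (\<lambda>b. kred (\<chi> (Suc j) b) - kred (lin_ext (h j) (fdiff F j b))) z"
        unfolding kdiff_map_eq lin_ext_kred_compose
        using tor_cycles_D[OF z] Suc by (intro lin_ext_cong) (auto simp: h(3) kmod_deg_def kred_diff)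
      also have "\<dots> = ?k (\<chi> i) z - ?k (h j) (kdiff_map F j z)"
        by (simp add: lin_ext_diff_fun kdiff_map_eq lin_ext_kred_compose Suc)
      finally show ?thesis using z Suc by (simp add: tor_cycles_def)
    qed
    then show ?thesis
      using graded_map_kmod_deg[OF h(1) tor_cycles_D[OF z]] unfolding \<chi>_eq[symmetric]
      by (auto simp: tor_boundaries_def)
  qed
  obtain W where W: "finite W" "tor_boundaries F i \<alpha> \<subseteq> kvec.span W" using tor_dims[OF F] by metis
  obtain W' where W': "finite W'" "tor_cycles G i \<alpha> \<subseteq> kvec.span W'" using tor_dims[OF G] by metis
  \<comment> \<open>Surjectivity on homology: by \<open>hom\<close>, a cycle \<open>z\<close> is the
    image under \<psi> of the cycle \<phi> \<open>z\<close>, up to a boundary.\<close>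
  have "kvec.dim (tor_cycles F i \<alpha>) + kvec.dim (tor_boundaries G i \<alpha>) \<le>
      kvec.dim (tor_cycles G i \<alpha>) + kvec.dim (tor_boundaries F i \<alpha>)"
  proof (rule kvec.dim_add_le[OF subspace_tor_boundaries W(2,1) W'(2,1) subspace_tor_boundaries
        tor_boundaries_subset[OF G]])
    show "\<exists>z'\<in>tor_cycles G i \<alpha>. \<exists>b\<in>tor_boundaries F i \<alpha>. z = ?k (\<psi> i) z' + b"
      if "z \<in> tor_cycles F i \<alpha>" for z
      using \<phi>_cyc[OF that] kvec.subspace_neg[OF subspace_tor_boundaries hom[OF that]]
      by (intro bexI[of _ "?k (\<phi> i) z"] bexI[of _ "- (?k (\<psi> i) (?k (\<phi> i) z) - z)"]) auto
  qed (auto simp: lin_ext_add lin_ext_smult \<psi>_cyc)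
  then show ?thesis unfolding tor_dim_def by linarith
qed

lemma tor_dim_unique:
  fixes F G :: "'k::field free_complex"
  assumes "graded_free_resolution A I F" "graded_free_resolution A I G"
    and "is_ideal (dim_col A) I" "homogeneous_ideal A I"
  shows "tor_dim F i \<alpha> = tor_dim G i \<alpha>"
  using assms by (intro order.antisym tor_dim_le)

text \<open>The witness F makes the object chosen by \<open>SOME\<close> a genuine resolution, and
  the dimension does not depend on which one it is.\<close>

lemma betti_eq:
  fixes F :: "'k::field free_complex"
  assumes "graded_free_resolution A I F" "is_ideal (dim_col A) I" "homogeneous_ideal A I"
    and "\<alpha> \<in> carrier_vec (dim_row A)" "nonneg_vec \<alpha>"
  shows "betti A I (int i) \<alpha> = tor_dim F i \<alpha>"
  using tor_dim_unique[OF someI[of "graded_free_resolution A I" F] assms(1-3)] assms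
  by (simp add: betti_def)

section \<open>Existence of resolutions\<close>

text \<open>Every variable has a nonzero degree in N^N. This consequence of
  \<open>induces_grading\<close> makes the graded pieces finite-dimensional, on which the existence
  of resolutions rests.\<close>

definition positive_grading :: "int mat \<Rightarrow> bool" where
  "positive_grading A \<longleftrightarrow> (\<forall>i<dim_row A. \<forall>j<dim_col A. 0 \<le> A $$ (i, j)) \<and>
     (\<forall>j<dim_col A. \<exists>i<dim_row A. A $$ (i, j) \<noteq> 0)"

lemma positive_gradingD:
  assumes "positive_grading A" "j < dim_col A"
  shows "i < dim_row A \<Longrightarrow> 0 \<le> A $$ (i, j)" "\<exists>i<dim_row A. A $$ (i, j) \<noteq> 0"
  using assms unfolding positive_grading_def by blast+

lemma mon_deg_index:
  "i < dim_row A \<Longrightarrow> mon_deg A m $ i = (\<Sum>j<dim_col A. A $$ (i, j) * int (lookup m j))"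
  by (simp add: mon_deg_def scalar_prod_def lessThan_atLeast0)

lemma mon_deg_nonneg: "positive_grading A \<Longrightarrow> nonneg_vec (mon_deg A m)"
  unfolding nonneg_vec_def
  by (auto simp: carrier_vecD[OF mon_deg_carrier] mon_deg_index intro!: sum_nonneg mult_nonneg_nonneg positive_gradingD(1))

lemma nonneg_vec_add: "nonneg_vec v \<Longrightarrow> nonneg_vec w \<Longrightarrow> dim_vec v = dim_vec w \<Longrightarrow> nonneg_vec (v + w)"
  by (simp add: nonneg_vec_def)

text \<open>A zero column would put a unit vector into the kernel, which is nonzero and
  nonnegative.\<close>

lemma positive_gradingI:
  assumes "induces_grading A" shows "positive_grading A"
proof -
  have nn: "\<forall>i<dim_row A. \<forall>j<dim_col A. 0 \<le> A $$ (i, j)"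
    using assms by (auto simp: induces_grading_def nonneg_vec_def)
  have "\<exists>i<dim_row A. A $$ (i, j) \<noteq> 0" if j: "j < dim_col A" for j
  proof (rule ccontr)
    assume *: "\<not> ?thesis"
    have "A *\<^sub>v unit_vec (dim_col A) j = 0\<^sub>v (dim_row A)"
      using * j by (auto simp: scalar_prod_right_unit)
    then have "unit_vec (dim_col A) j \<in> mat_kernel A"
      by (auto simp: mat_kernel_def)
    moreover have "nonneg_vec (unit_vec (dim_col A) j :: int vec)"
      by (auto simp: nonneg_vec_def unit_vec_def)
    ultimately have "unit_vec (dim_col A) j = (0\<^sub>v (dim_col A) :: int vec)"
      using assms by (auto simp: induces_grading_def)
    then have "unit_vec (dim_col A) j $ j = (0\<^sub>v (dim_col A) :: int vec) $ j" by simp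
    then show False using j by simp
  qed
  then show ?thesis using nn by (simp add: positive_grading_def)
qed

text \<open>A nonzero entry in the column of a variable is at least 1, so the exponent of that
  variable is at most some coordinate of \<gamma>. The sum of the absolute values bounds all
  exponents at once.\<close>

lemma finite_monomials_of_degree:
  assumes A: "positive_grading A"
  shows "finite {m. keys m \<subseteq> {..<dim_col A} \<and> mon_deg A m = \<gamma>}" (is "finite ?M")
proof -
  define K where "K = nat (\<Sum>i<dim_row A. \<bar>\<gamma> $ i\<bar>)"
  have bound: "lookup m j \<le> K" if m: "mon_deg A m = \<gamma>" and j: "j < dim_col A" for m j
  proof -
    obtain i where i: "i < dim_row A" "A $$ (i, j) \<noteq> 0" using positive_gradingD(2)[OF A j] by blast
    then have "1 \<le> A $$ (i, j)" using positive_gradingD(1)[OF A j i(1)] by simp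
    then have "int (lookup m j) \<le> A $$ (i, j) * int (lookup m j)"
      using mult_right_mono[of 1 "A $$ (i, j)" "int (lookup m j)"] by simp
    also have "\<dots> \<le> (\<Sum>j<dim_col A. A $$ (i, j) * int (lookup m j))"
      using positive_gradingD(1)[OF A _ i(1)] j by (intro member_le_sum) auto
    also have "\<dots> = \<gamma> $ i" using mon_deg_index[OF i(1), of m] unfolding m by (rule sym)
    also have "\<dots> \<le> \<bar>\<gamma> $ i\<bar>" by simp
    also have "\<dots> \<le> (\<Sum>i<dim_row A. \<bar>\<gamma> $ i\<bar>)"
      using i by (intro member_le_sum) auto
    finally show ?thesis by (simp add: K_def)
  qed
  have "lookup ` ?M \<subseteq> {f. \<forall>j. (j \<in> {..<dim_col A} \<longrightarrow> f j \<in> {..K}) \<and> (j \<notin> {..<dim_col A} \<longrightarrow> f j = 0)}"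
    using bound by (auto simp: in_keys_iff subset_iff)
  then have "finite (lookup ` ?M)"
    by (rule finite_subset) (intro finite_set_of_finite_funs; simp)
  then show ?thesis
    by (rule finite_imageD) (auto simp: inj_on_def intro: poly_mapping_eqI)
qed

lemma finite_vec_box: "finite {v \<in> carrier_vec n. \<forall>i<n. 0 \<le> v $ i \<and> v $ i \<le> (u $ i :: int)}" (is "finite ?V")
proof -
  have "?V \<subseteq> (\<lambda>f. vec n f) ` (\<Pi>\<^sub>E i\<in>{..<n}. {0..u $ i})"
  proof
    fix v assume v: "v \<in> ?V"
    then have "v = vec n (\<lambda>i\<in>{..<n}. v $ i)" by auto
    moreover have "(\<lambda>i\<in>{..<n}. v $ i) \<in> (\<Pi>\<^sub>E i\<in>{..<n}. {0..u $ i})" using v by auto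
    ultimately show "v \<in> (\<lambda>f. vec n f) ` (\<Pi>\<^sub>E i\<in>{..<n}. {0..u $ i})" by (rule image_eqI)
  qed
  then show ?thesis by (rule finite_subset) (auto intro: finite_PiE)
qed

lemma countable_UNIV_int_vec: "countable (UNIV :: int vec set)"
proof -
  have "(UNIV :: int vec set) = range vec_of_list"
    by (metis surj_def vec_list)
  then show ?thesis by (metis countableI_type countable_image)
qed

section \<open>Homogeneous generators of graded submodules, with K acting through constant
  polynomials\<close>

lemma vector_space_free_mod:
  "vector_space (\<lambda>c :: 'k::field. pm_smult (single 0 c) :: (nat \<Rightarrow>\<^sub>0 'k mpoly) \<Rightarrow> _)"
  by unfold_locales
    (auto simp: pm_smult_add single_add pm_smult_add_left mult_single simp flip: pm_smult_mult)

text \<open>For a term of degree \<alpha>, the degrees of its monomial and of its basis element both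
  lie in the box between 0 and \<alpha>, so the whole piece is finite-dimensional and a maximal
  independent subset is finite. Excluding 0 from \<open>S\<close> allows the degree of a generator
  to be read off from one of its terms later.\<close>

lemma degree_finite_generators:
  fixes Z :: "(nat \<Rightarrow>\<^sub>0 'k::field mpoly) set"
  assumes A: "positive_grading A"
    and d: "\<And>b. b \<in> B \<Longrightarrow> d b \<in> carrier_vec (dim_row A) \<and> nonneg_vec (d b)"
    and fin: "\<And>\<alpha>. finite {b \<in> B. d b = \<alpha>}"
  shows "\<exists>S. finite S \<and> 0 \<notin> S \<and> S \<subseteq> Z \<inter> free_mod_deg A B d \<alpha> \<and>
     Z \<inter> free_mod_deg A B d \<alpha> \<subseteq> module.span (\<lambda>c :: 'k. pm_smult (single 0 c)) S"
proof -
  interpret fv: vector_space "\<lambda>c :: 'k. pm_smult (single 0 c) :: (nat \<Rightarrow>\<^sub>0 'k mpoly) \<Rightarrow> _"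
    by (rule vector_space_free_mod)
  define N where "N = dim_row A"
  define V where "V = {v \<in> carrier_vec N. \<forall>i<N. 0 \<le> v $ i \<and> v $ i \<le> \<alpha> $ i}"
  define T where "T = (\<Union>\<beta>\<in>V. {b \<in> B. d b = \<beta>}) \<times> (\<Union>\<beta>\<in>V. {m. keys m \<subseteq> {..<dim_col A} \<and> mon_deg A m = \<beta>})"
  define W where "W = (\<lambda>(b, m). single b (single m 1) :: nat \<Rightarrow>\<^sub>0 'k mpoly) ` T"
  have "finite V" unfolding V_def by (rule finite_vec_box)
  then have "finite W" using fin finite_monomials_of_degree[OF A] by (auto simp: W_def T_def)
  have W: "free_mod_deg A B d \<alpha> \<subseteq> fv.span W"
  proof
    fix f :: "nat \<Rightarrow>\<^sub>0 'k mpoly" assume f: "f \<in> free_mod_deg A B d \<alpha>"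
    have in_W: "single b (single m 1) \<in> W" if "b \<in> keys f" "m \<in> keys (lookup f b)" for b m
    proof -
      have b: "b \<in> B" "keys m \<subseteq> {..<dim_col A}" and \<alpha>: "mon_deg A m + d b = \<alpha>"
        using f that by (auto simp: free_mod_deg_def free_mod_def dest: mpolysD)
      have m: "mon_deg A m \<in> carrier_vec N" "nonneg_vec (mon_deg A m)"
        using mon_deg_nonneg[OF A] by (auto simp: N_def)
      have "mon_deg A m \<in> V" "d b \<in> V"
        unfolding V_def \<alpha>[symmetric] using m d[OF b(1)] by (auto simp: nonneg_vec_def N_def carrier_vecD[OF mon_deg_carrier])
      then have "(b, m) \<in> T" using b by (auto simp: T_def)
      then show ?thesis by (auto simp: W_def)
    qed
    have single_sum: "single b (sum g U) = (\<Sum>x\<in>U. single b (g x))"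
      for b and g :: "(nat \<Rightarrow>\<^sub>0 nat) \<Rightarrow> 'k mpoly" and U
      by (induction U rule: infinite_finite_induct) (auto simp: single_add)
    have "single b p = (\<Sum>m\<in>keys p. pm_smult (single 0 (lookup p m)) (single b (single m 1)))"
      for b and p :: "'k mpoly"
    proof -
      have "single b p = single b (\<Sum>m\<in>keys p. single m (lookup p m))"
        by (rule arg_cong[OF poly_mapping_sum_single])
      also have "\<dots> = (\<Sum>m\<in>keys p. pm_smult (single 0 (lookup p m)) (single b (single m 1)))"
        unfolding single_sum by (simp add: pm_smult_single mult_single)
      finally show ?thesis .
    qed
    then have "(\<Sum>b\<in>keys f. single b (lookup f b)) = (\<Sum>b\<in>keys f. \<Sum>m\<in>keys (lookup f b).
        pm_smult (single 0 (lookup (lookup f b) m)) (single b (single m 1)))"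
      by (intro sum.cong refl)
    also have "\<dots> \<in> fv.span W"
      by (intro fv.span_sum fv.span_scale fv.span_base in_W)
    finally show "f \<in> fv.span W"
      by (subst poly_mapping_sum_single[of f])
  qed
  obtain S where S: "S \<subseteq> Z \<inter> free_mod_deg A B d \<alpha>" "fv.independent S" "Z \<inter> free_mod_deg A B d \<alpha> \<subseteq> fv.span S"
    by (rule fv.maximal_independent_subset[of "Z \<inter> free_mod_deg A B d \<alpha>"])
  have "S \<subseteq> fv.span W" using S(1) W by (meson Int_lower2 order_trans)
  then have "finite S"
    using fv.independent_span_bound[OF \<open>finite W\<close> S(2)] by simp
  moreover have "0 \<notin> S" using S(2) fv.dependent_zero by metis
  ultimately show ?thesis using S(1,3) by (intro exI[of _ S] conjI)
qed

text \<open>The generators are \<open>K\<close>-spanning sets of all graded pieces of \<open>Z\<close>. There may be infinitely many,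
  but only finitely many in each degree, so no Noetherian argument is needed.\<close>

lemma free_cover_exists:
  fixes Z :: "(nat \<Rightarrow>\<^sub>0 'k::field mpoly) set"
  assumes A: "positive_grading A"
    and d: "\<And>b. b \<in> B \<Longrightarrow> d b \<in> carrier_vec (dim_row A) \<and> nonneg_vec (d b)"
    and fin: "\<And>\<alpha>. finite {b \<in> B. d b = \<alpha>}"
    and Z: "Z \<subseteq> free_mod (dim_col A) B" "0 \<in> Z" "\<And>f g. f \<in> Z \<Longrightarrow> g \<in> Z \<Longrightarrow> f + g \<in> Z"
      "\<And>c f. c \<in> mpolys (dim_col A) \<Longrightarrow> f \<in> Z \<Longrightarrow> pm_smult c f \<in> Z"
      "\<And>f \<alpha>. f \<in> Z \<Longrightarrow> hcomp A d \<alpha> f \<in> Z"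
  obtains B' d' \<delta> where "\<And>b. b \<in> B' \<Longrightarrow> d' b \<in> carrier_vec (dim_row A) \<and> nonneg_vec (d' b)"
    "\<And>\<alpha>. finite {b \<in> B'. d' b = \<alpha>}" "graded_map A B' d' B d \<delta>"
    "lin_ext \<delta> ` free_mod (dim_col A) B' = Z"
proof -
  interpret fv: vector_space "\<lambda>c :: 'k. pm_smult (single 0 c) :: (nat \<Rightarrow>\<^sub>0 'k mpoly) \<Rightarrow> _"
    by (rule vector_space_free_mod)
  let ?R = "dim_col A"
  have "\<forall>\<alpha>. \<exists>S. finite S \<and> 0 \<notin> S \<and> S \<subseteq> Z \<inter> free_mod_deg A B d \<alpha> \<and>
     Z \<inter> free_mod_deg A B d \<alpha> \<subseteq> fv.span S"
    by (intro allI degree_finite_generators[OF A d fin])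
  then obtain S where S: "\<And>\<alpha>. finite (S \<alpha>)" "\<And>\<alpha>. 0 \<notin> S \<alpha>" "\<And>\<alpha>. S \<alpha> \<subseteq> Z \<inter> free_mod_deg A B d \<alpha>"
    "\<And>\<alpha>. Z \<inter> free_mod_deg A B d \<alpha> \<subseteq> fv.span (S \<alpha>)" by metis
  \<comment> \<open>Generators are tagged with their degree, and the countable set of pairs is
    numbered because a basis has to consist of naturals.\<close>
  define T where "T = (SIGMA \<alpha> : UNIV. S \<alpha>)"
  define e where "e = to_nat_on T"
  have "countable T"
    unfolding T_def using countable_UNIV_int_vec S(1) by (intro countable_SIGMA) (auto intro: countable_finite)
  then have inj: "inj_on e T" unfolding e_def by (rule inj_on_to_nat_on)
  define B' where "B' = e ` T"
  define d' where "d' n = fst (inv_into T e n)" for n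
  define \<delta> where "\<delta> n = snd (inv_into T e n)" for n
  have B'D: "\<delta> b \<in> S (d' b)" if "b \<in> B'" for b
    using inv_into_into[of b e T] that by (auto simp: B'_def d'_def \<delta>_def T_def)
  have e: "e (\<alpha>, z) \<in> B'" "d' (e (\<alpha>, z)) = \<alpha>" "\<delta> (e (\<alpha>, z)) = z" if "z \<in> S \<alpha>" for \<alpha> z
    using that inj by (auto simp: B'_def d'_def \<delta>_def T_def)
  \<comment> \<open>A generator is nonzero, so it has a term, whose degree is a sum of two
    nonnegative vectors. This keeps the basis degrees nonnegative throughout the recursion.\<close>
  have d': "d' b \<in> carrier_vec (dim_row A) \<and> nonneg_vec (d' b)" if "b \<in> B'" for b
  proof -
    have "\<delta> b \<noteq> 0" "\<delta> b \<in> free_mod_deg A B d (d' b)" using B'D[OF that] S(2,3) by auto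
    then obtain c where c: "c \<in> keys (\<delta> b)" by (metis all_not_in_conv keys_eq_empty)
    then obtain m where "m \<in> keys (lookup (\<delta> b) c)"
      by (metis all_not_in_conv in_keys_iff keys_eq_empty)
    then have "c \<in> B" and eq: "mon_deg A m + d c = d' b"
      using \<open>\<delta> b \<in> _\<close> c by (auto simp: free_mod_deg_def free_mod_def)
    then show ?thesis
      unfolding eq[symmetric] using d[of c] mon_deg_nonneg[OF A, of m] carrier_vecD[OF mon_deg_carrier[of A m]]
      by (auto intro!: nonneg_vec_add add_carrier_vec)
  qed
  have fin': "finite {b \<in> B'. d' b = \<alpha>}" for \<alpha>
  proof (rule finite_subset)
    show "{b \<in> B'. d' b = \<alpha>} \<subseteq> e ` ({\<alpha>} \<times> S \<alpha>)"
      using inj by (auto simp: B'_def d'_def T_def)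
  qed (simp add: S(1))
  have gr: "graded_map A B' d' B d \<delta>"
    unfolding graded_map_def using d d' B'D S(3) by (meson Int_iff subsetD)
  have "lin_ext \<delta> f \<in> Z" if "f \<in> free_mod ?R B'" for f
    using that
  proof (induction rule: free_mod_induct)
    case (single b m c)
    then have "\<delta> b \<in> Z" using B'D S(3) by (meson Int_iff subsetD)
    then show ?case using single by (simp add: mpolys_single Z(4))
  qed (auto simp: Z lin_ext_add)
  moreover have "z \<in> lin_ext \<delta> ` free_mod ?R B'" if z: "z \<in> Z" for z
  proof -
    let ?Im = "lin_ext \<delta> ` free_mod ?R B'"
    have 0: "0 \<in> ?Im" by (rule image_eqI[of _ _ 0]) auto
    have add: "f + g \<in> ?Im" if "f \<in> ?Im" "g \<in> ?Im" for f g
      using that by (auto simp flip: lin_ext_add)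
    have sub: "fv.subspace ?Im"
      unfolding fv.subspace_def using 0 add
      by (auto simp flip: lin_ext_smult intro!: imageI free_mod_smult mpolys_single)
    have "S \<alpha> \<subseteq> ?Im" for \<alpha>
    proof
      fix z assume "z \<in> S \<alpha>"
      then show "z \<in> ?Im"
        using e[of z \<alpha>] by (intro image_eqI[of _ _ "single (e (\<alpha>, z)) 1"]) (auto intro: free_mod_single)
    qed
    then have "fv.span (S \<alpha>) \<subseteq> ?Im" for \<alpha>
      by (rule fv.span_minimal[OF _ sub])
    moreover have "hcomp A d \<alpha> z \<in> fv.span (S \<alpha>)" for \<alpha>
      using S(4)[of \<alpha>] Z(5)[OF z, of \<alpha>] hcomp_in_free_mod_deg[of z A B d \<alpha>] z Z(1) by (meson IntI subsetD)
    ultimately have comp: "hcomp A d \<alpha> z \<in> ?Im" for \<alpha>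
      by (meson subsetD)
    obtain D where "finite D" and D: "z = (\<Sum>\<alpha>\<in>D. hcomp A d \<alpha> z)" by (rule hcomp_decomp)
    have "(\<Sum>\<alpha>\<in>D. hcomp A d \<alpha> z) \<in> ?Im" using comp 0 add
      by (induction D rule: infinite_finite_induct) auto
    then show ?thesis unfolding D[symmetric] .
  qed
  ultimately have "lin_ext \<delta> ` free_mod ?R B' = Z" by blast
  then show thesis using that[OF d' fin' gr] by blast
qed

text \<open>Dependent choice iterates \<open>free_cover_exists\<close> on the successive kernels,
  starting from R itself with the generator 1 in degree 0.\<close>

lemma resolution_exists:
  fixes I :: "'k::field mpoly set"
  assumes A: "positive_grading A" and I: "is_ideal (dim_col A) I" "homogeneous_ideal A I"
  obtains F where "graded_free_resolution A I F" "\<And>i b. b \<in> fbasis F i \<Longrightarrow> nonneg_vec (fdeg F i b)"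
proof -
  let ?R = "dim_col A" and ?o = "\<lambda>_ :: nat. 0\<^sub>v (dim_row A) :: int vec"
  define good :: "nat set \<times> (nat \<Rightarrow> int vec) \<times> (nat \<Rightarrow> nat \<Rightarrow>\<^sub>0 'k mpoly) \<Rightarrow> bool" where
    "good = (\<lambda>(B, d, \<delta>). (\<forall>b\<in>B. d b \<in> carrier_vec (dim_row A) \<and> nonneg_vec (d b)) \<and>
        (\<forall>\<alpha>. finite {b \<in> B. d b = \<alpha>}))"
  \<comment> \<open>Stage 0 maps to R/I, so its kernel is the set of elements whose value lies in I;
    that value sits in coordinate 0 of the rank-one target.\<close>
  define K where "K i = (\<lambda>(B, d :: nat \<Rightarrow> int vec, \<delta> :: nat \<Rightarrow> nat \<Rightarrow>\<^sub>0 'k mpoly).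
      {f \<in> free_mod ?R B. if i = 0 then lookup (lin_ext \<delta> f) 0 \<in> I else lin_ext \<delta> f = 0})" for i :: nat
  define init :: "nat set \<times> (nat \<Rightarrow> int vec) \<times> (nat \<Rightarrow> nat \<Rightarrow>\<^sub>0 'k mpoly)" where
    "init = ({0}, ?o, \<lambda>_. single 0 1)"
  \<comment> \<open>From stage 1 on it is enough to remember that \<delta> is graded for some
    target: this already makes its kernel homogeneous, so that it can be covered again.\<close>
  define P where "P i x \<longleftrightarrow> good x \<and> (case x of (B, d, \<delta>) \<Rightarrow>
      if i = 0 then x = init else \<exists>B0 d0. graded_map A B d B0 d0 \<delta>)" for i :: nat and x
  define Q where "Q i = (\<lambda>(B, d, \<delta> :: nat \<Rightarrow> nat \<Rightarrow>\<^sub>0 'k mpoly) (B', d', \<delta>').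
      graded_map A B' d' B d \<delta>' \<and> lin_ext \<delta>' ` free_mod ?R B' = K i (B, d, \<delta>))" for i
  have init_gr: "graded_map A {0} ?o {0} ?o (\<lambda>_. single 0 1 :: nat \<Rightarrow>\<^sub>0 'k mpoly)"
  proof -
    have "single 0 (1 :: 'k mpoly) \<in> free_mod_deg A {0} ?o (0\<^sub>v (dim_row A))"
      by (rule free_mod_deg_single) (auto split: if_splits)
    then show ?thesis by (simp add: graded_map_def)
  qed
  have "P 0 init"
    by (auto simp: P_def good_def init_def nonneg_vec_def)
  moreover have "\<exists>y. P (Suc i) y \<and> Q i x y" if "P i x" for i x
  proof -
    obtain B d \<delta> where x: "x = (B, d, \<delta>)" by (cases x)
    have good: "b \<in> B \<Longrightarrow> d b \<in> carrier_vec (dim_row A) \<and> nonneg_vec (d b)"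
      "finite {b \<in> B. d b = \<alpha>}" for b \<alpha>
      using that by (auto simp: P_def good_def x)
    obtain B0 d0 where gr: "graded_map A B d B0 d0 \<delta>" and i0: "i = 0 \<Longrightarrow> d0 = ?o"
    proof (cases "i = 0")
      case True
      then have "graded_map A B d {0} ?o \<delta>" using \<open>P i x\<close> init_gr by (simp add: P_def x init_def)
      then show thesis by (rule that(1)) simp
    next
      case False
      then show thesis using \<open>P i x\<close> that by (auto simp: P_def x)
    qed
    obtain B' d' \<delta>' where y: "\<And>b. b \<in> B' \<Longrightarrow> d' b \<in> carrier_vec (dim_row A) \<and> nonneg_vec (d' b)"
      "\<And>\<alpha>. finite {b \<in> B'. d' b = \<alpha>}" "graded_map A B' d' B d \<delta>'"
      "lin_ext \<delta>' ` free_mod ?R B' = K i x"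
    proof (rule free_cover_exists[OF A good, of "K i x"])
      show "hcomp A d \<alpha> f \<in> K i x" if f: "f \<in> K i x" for f \<alpha>
      proof -
        have "f \<in> free_mod ?R B" using f by (simp add: K_def x)
        then have eq: "lin_ext \<delta> (hcomp A d \<alpha> f) = hcomp A d0 \<alpha> (lin_ext \<delta> f)"
          using hcomp_lin_ext[OF gr, of f \<alpha>] by simp
        have "lookup (hcomp A ?o \<alpha> g) 0 = hpart A \<alpha> (lookup g 0)" for g :: "nat \<Rightarrow>\<^sub>0 'k mpoly"
          by (rule poly_mapping_eqI) (auto simp: lookup_hcomp lookup_hpart)
        then show ?thesis
          using f I(2) free_mod_deg_D1[OF hcomp_in_free_mod_deg[OF \<open>f \<in> free_mod ?R B\<close>]] i0
          by (auto simp: K_def x eq homogeneous_ideal_def)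
      qed
    qed (auto simp: K_def x lin_ext_add lookup_add lin_ext_smult lookup_pm_smult
        is_ideal_0[OF I(1)] is_ideal_add[OF I(1)] is_ideal_mult[OF I(1)])
    then have "P (Suc i) (B', d', \<delta>') \<and> Q i x (B', d', \<delta>')"
      by (auto simp: P_def Q_def good_def x)
    then show ?thesis by blast
  qed
  ultimately obtain X where X: "\<And>i. P i (X i)" "\<And>i. Q i (X i) (X (Suc i))"
    using dependent_nat_choice[of P Q] by metis
  have X0: "X 0 = init" using X(1)[of 0] by (simp add: P_def split_beta)
  define F where "F = \<lparr>fbasis = \<lambda>i. fst (X i), fdeg = \<lambda>i. fst (snd (X i)),
      faug = \<lambda>b. lookup (snd (snd (X 0)) b) 0, fdiff = \<lambda>i. snd (snd (X (Suc i)))\<rparr>"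
  have F0: "fbasis F 0 = {0}" "fdeg F 0 = ?o" "faug F = (\<lambda>_. 1)"
    by (simp_all add: F_def X0 init_def)
  have aug_single: "lin_ext (\<lambda>_. single 0 1) f = single 0 (faug_map F f)" for f :: "nat \<Rightarrow>\<^sub>0 'k mpoly"
    using faug_map_lin_ext[of F f] by (simp add: F0)
  have Q: "graded_map A (fbasis F (Suc i)) (fdeg F (Suc i)) (fbasis F i) (fdeg F i) (fdiff F i)"
    "fdiff_map F i ` free_mod ?R (fbasis F (Suc i)) = K i (X i)" for i
    using X(2)[of i] by (simp_all add: Q_def F_def split_beta)
  have good: "\<forall>b\<in>fbasis F i. fdeg F i b \<in> carrier_vec (dim_row A) \<and> nonneg_vec (fdeg F i b)"
    "\<forall>\<alpha>. finite {b \<in> fbasis F i. fdeg F i b = \<alpha>}" for i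
    using X(1)[of i] by (simp_all add: P_def good_def F_def split_beta)
  have K: "K i (X i) = {f \<in> free_mod ?R (fbasis F i). cycle I F i f}" for i
  proof (cases i)
    case 0
    then show ?thesis
      using aug_single by (auto simp: K_def X0 init_def F0)
  next
    case (Suc j)
    then show ?thesis by (simp add: K_def F_def split_beta)
  qed
  have surj: "\<exists>f\<in>fmod ?R F 0. p - faug_map F f \<in> I" if "p \<in> mpolys ?R" for p
    using that is_ideal_0[OF I(1)]
    by (intro bexI[of _ "single 0 p"]) (auto simp: faug_map_single F0 fmod_eq intro: free_mod_single)
  have "graded_free_resolution A I F"
    unfolding graded_free_resolution_iff using good Q(1) surj init_gr
    by (auto simp: fmod_eq Q(2) K) (auto simp: F0)
  then show thesis using that good by blast
qed

section \<open>The mapping cone\<close>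

text \<open>Bases are sets of naturals, so a direct sum of two free modules is encoded by parity:
  even indices for the first summand, odd ones for the second.\<close>

definition emb_even :: "(nat \<Rightarrow>\<^sub>0 'a::comm_ring_1) \<Rightarrow> (nat \<Rightarrow>\<^sub>0 'a)" where
  "emb_even = lin_ext (\<lambda>b. single (2 * b) 1)"

definition emb_odd :: "(nat \<Rightarrow>\<^sub>0 'a::comm_ring_1) \<Rightarrow> (nat \<Rightarrow>\<^sub>0 'a)" where
  "emb_odd = lin_ext (\<lambda>b. single (Suc (2 * b)) 1)"

definition proj_even :: "(nat \<Rightarrow>\<^sub>0 'a::comm_ring_1) \<Rightarrow> (nat \<Rightarrow>\<^sub>0 'a)" where
  "proj_even = lin_ext (\<lambda>c. if even c then single (c div 2) 1 else 0)"

definition proj_odd :: "(nat \<Rightarrow>\<^sub>0 'a::comm_ring_1) \<Rightarrow> (nat \<Rightarrow>\<^sub>0 'a)" where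
  "proj_odd = lin_ext (\<lambda>c. if even c then 0 else single (c div 2) 1)"

lemmas emb_defs = emb_even_def emb_odd_def proj_even_def proj_odd_def

lemma emb_add: "emb_even (f + g) = emb_even f + emb_even g" "emb_odd (f + g) = emb_odd f + emb_odd g"
  "proj_even (f + g) = proj_even f + proj_even g" "proj_odd (f + g) = proj_odd f + proj_odd g"
  by (simp_all add: emb_defs lin_ext_add)

lemma emb_smult:
  "emb_even (pm_smult c f) = pm_smult c (emb_even f)" "emb_odd (pm_smult c f) = pm_smult c (emb_odd f)"
  "proj_even (pm_smult c f) = pm_smult c (proj_even f)" "proj_odd (pm_smult c f) = pm_smult c (proj_odd f)"
  by (simp_all add: emb_defs lin_ext_smult)

lemma emb_uminus: "emb_even (- f) = - emb_even f" "emb_odd (- f) = - emb_odd f"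
  by (simp_all add: emb_defs lin_ext_uminus)

lemma emb_0 [simp]: "emb_even 0 = 0" "emb_odd 0 = 0" "proj_even 0 = 0" "proj_odd 0 = 0"
  by (simp_all add: emb_defs)

lemma proj_emb [simp]: "proj_even (emb_even f) = f" "proj_even (emb_odd f) = 0"
  "proj_odd (emb_even f) = 0" "proj_odd (emb_odd f) = f"
  by (simp_all add: emb_defs lin_ext_compose)

lemma emb_proj: "emb_even (proj_even f) + emb_odd (proj_odd f) = f"
proof -
  have *: "lin_ext (\<lambda>b. single (2 * b) 1) (if even c then single (c div 2) 1 else 0) +
      lin_ext (\<lambda>b. single (Suc (2 * b)) 1) (if even c then 0 else single (c div 2) (1 :: 'a)) = single c 1" for c
    by auto
  show ?thesis
    unfolding emb_defs lin_ext_compose lin_ext_plus_fun[symmetric] * by simp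
qed

lemma emb_sum_eq_iff: "emb_even x + emb_odd y = emb_even x' + emb_odd y' \<longleftrightarrow> x = x' \<and> y = y'"
  by (metis add.left_neutral add.right_neutral emb_add(3,4) proj_emb)

lemma emb_sum_eq_0_iff: "emb_even x + emb_odd y = 0 \<longleftrightarrow> x = 0 \<and> y = 0"
  using emb_sum_eq_iff[of x y 0 0] by simp

lemma lin_ext_emb: "lin_ext \<phi> (emb_even f) = lin_ext (\<lambda>b. \<phi> (2 * b)) f"
  "lin_ext \<phi> (emb_odd f) = lin_ext (\<lambda>b. \<phi> (Suc (2 * b))) f"
  by (simp_all add: emb_defs lin_ext_compose)

lemma lin_ext_emb_fun: "lin_ext (\<lambda>b. emb_even (\<phi> b)) f = emb_even (lin_ext \<phi> f)"
  "lin_ext (\<lambda>b. emb_odd (\<phi> b)) f = emb_odd (lin_ext \<phi> f)"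
  by (simp_all add: emb_defs lin_ext_compose)

lemma lin_ext_smult_fun: "lin_ext (\<lambda>b. pm_smult p (\<phi> b)) f = pm_smult p (lin_ext \<phi> f)"
  unfolding lin_ext_def pm_smult_sum by (simp add: mult.commute flip: pm_smult_mult)

lemma lin_ext_uminus_fun: "lin_ext (\<lambda>b. - \<phi> b) f = - lin_ext \<phi> f"
  using lin_ext_diff_fun[of "\<lambda>_. 0" \<phi> f] by simp

lemma kred_emb: "kred (emb_even f) = emb_even (kred f)" "kred (emb_odd f) = emb_odd (kred f)"
  for f :: "nat \<Rightarrow>\<^sub>0 'k::comm_ring_1 mpoly"
  by (simp_all add: emb_defs kred_lin_ext kred_single)

lemma lookup_emb_sum: "lookup (emb_even x + emb_odd y) (2 * b) = lookup x b"
  "lookup (emb_even x + emb_odd y) (Suc (2 * b)) = lookup y b"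
proof -
  have "lookup (emb_even x) (2 * b) = lookup x b" "lookup (emb_even x) (Suc (2 * b)) = 0"
    by (induction x rule: poly_mapping_add_induct)
      (auto simp: emb_add lookup_add, auto simp: emb_defs lookup_pm_smult lookup_single when_def, presburger)
  moreover have "lookup (emb_odd y) (2 * b) = 0" "lookup (emb_odd y) (Suc (2 * b)) = lookup y b"
    by (induction y rule: poly_mapping_add_induct)
      (auto simp: emb_add lookup_add, auto simp: emb_defs lookup_pm_smult lookup_single when_def, presburger)
  ultimately show "lookup (emb_even x + emb_odd y) (2 * b) = lookup x b"
    "lookup (emb_even x + emb_odd y) (Suc (2 * b)) = lookup y b"
    by (simp_all add: lookup_add)
qed

definition join_basis :: "nat set \<Rightarrow> nat set \<Rightarrow> nat set" where
  "join_basis B B' = (\<lambda>b. 2 * b) ` B \<union> (\<lambda>b. Suc (2 * b)) ` B'"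

lemma join_basis_iff: "2 * b \<in> join_basis B B' \<longleftrightarrow> b \<in> B" "Suc (2 * b) \<in> join_basis B B' \<longleftrightarrow> b \<in> B'"
  by (auto simp: join_basis_def) presburger+

lemma all_nat_even_odd: "(\<forall>c :: nat. P c) \<longleftrightarrow> (\<forall>b. P (2 * b)) \<and> (\<forall>b. P (Suc (2 * b)))"
  by (metis oddE Suc_eq_plus1 evenE)

lemma emb_sum_free_mod_iff:
  fixes x y :: "nat \<Rightarrow>\<^sub>0 'k::comm_ring_1 mpoly"
  shows "emb_even x + emb_odd y \<in> free_mod s (join_basis B B') \<longleftrightarrow> x \<in> free_mod s B \<and> y \<in> free_mod s B'"
proof -
  have "f \<in> free_mod s C \<longleftrightarrow> (\<forall>c. (lookup f c \<noteq> 0 \<longrightarrow> c \<in> C) \<and> lookup f c \<in> mpolys s)"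
    for f :: "nat \<Rightarrow>\<^sub>0 'k mpoly" and C
    by (auto simp: free_mod_def in_keys_iff)
  then show ?thesis
    by (simp only:) (subst all_nat_even_odd, auto simp: lookup_emb_sum join_basis_iff)
qed

text \<open>\<open>2 b\<close> stands for the basis element \<open>b\<close> of \<open>F\<^sub>i\<close> and \<open>2 b + 1\<close> for the basis element \<open>b\<close> of
  \<open>F\<^bsub>i-1\<^esub>\<close>, shifted by \<open>\<mu>\<close>; for \<open>i = 0\<close> there is no odd basis element, so the truncated \<open>i - 1\<close> is harmless.\<close>

definition cone :: "'k::comm_ring_1 mpoly \<Rightarrow> int vec \<Rightarrow> 'k free_complex \<Rightarrow> 'k free_complex" where
  "cone p \<mu> F = \<lparr>
     fbasis = \<lambda>i. join_basis (fbasis F i) (case i of 0 \<Rightarrow> {} | Suc j \<Rightarrow> fbasis F j),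
     fdeg = \<lambda>i c. if even c then fdeg F i (c div 2) else fdeg F (i - 1) (c div 2) + \<mu>,
     faug = \<lambda>c. faug F (c div 2),
     fdiff = \<lambda>i c. if even c then emb_even (fdiff F i (c div 2))
       else single (c - 1) p - (case i of 0 \<Rightarrow> 0 | Suc j \<Rightarrow> emb_odd (fdiff F j (c div 2)))\<rparr>"

lemma cone_simps:
  "fbasis (cone p \<mu> F) i = join_basis (fbasis F i) (case i of 0 \<Rightarrow> {} | Suc j \<Rightarrow> fbasis F j)"
  "fdeg (cone p \<mu> F) i (2 * b) = fdeg F i b"
  "fdeg (cone p \<mu> F) (Suc j) (Suc (2 * b)) = fdeg F j b + \<mu>"
  "faug (cone p \<mu> F) (2 * b) = faug F b"
  "fdiff (cone p \<mu> F) i (2 * b) = emb_even (fdiff F i b)"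
  "fdiff (cone p \<mu> F) i (Suc (2 * b)) =
     single (2 * b) p - (case i of 0 \<Rightarrow> 0 | Suc j \<Rightarrow> emb_odd (fdiff F j b))"
  by (simp_all add: cone_def split: nat.split)

text \<open>The minus sign on the second component makes the square vanish, as d (p y) and p (- d y)
  cancel. At stage 0 the target has no second component, hence the value 0.\<close>

lemma cone_diff:
  "fdiff_map (cone p \<mu> F) i (emb_even x + emb_odd y) =
     emb_even (fdiff_map F i x + pm_smult p y) +
     emb_odd (- (case i of 0 \<Rightarrow> 0 | Suc j \<Rightarrow> fdiff_map F j y))"
proof -
  have "lin_ext (\<lambda>b. single (2 * b) p) y = pm_smult p (emb_even y)"
    unfolding emb_defs lin_ext_smult_fun[symmetric] by (simp add: pm_smult_single)
  then have "lin_ext (\<lambda>b. single (2 * b) p - (case i of 0 \<Rightarrow> 0 | Suc j \<Rightarrow> emb_odd (fdiff F j b))) y =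
      pm_smult p (emb_even y) - emb_odd (case i of 0 \<Rightarrow> 0 | Suc j \<Rightarrow> fdiff_map F j y)"
    by (cases i) (simp_all add: lin_ext_diff_fun lin_ext_emb_fun)
  then show ?thesis
    by (simp add: lin_ext_add lin_ext_emb cone_simps lin_ext_emb_fun emb_add emb_smult emb_uminus)
qed

text \<open>The off-diagonal entry \<open>p\<close> reduces to its constant coefficient, which is 0,
  so the reduced differential is diagonal with respect to the two summands.\<close>

lemma cone_kdiff:
  assumes "lookup p 0 = 0"
  shows "kdiff_map (cone p \<mu> F) i (emb_even x + emb_odd y) =
     emb_even (kdiff_map F i x) + emb_odd (- (case i of 0 \<Rightarrow> 0 | Suc j \<Rightarrow> kdiff_map F j y))"
proof -
  have "lin_ext (\<lambda>b. kred (single (2 * b) p - (case i of 0 \<Rightarrow> 0 | Suc j \<Rightarrow> emb_odd (fdiff F j b)))) y =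
      - emb_odd (case i of 0 \<Rightarrow> 0 | Suc j \<Rightarrow> kdiff_map F j y)"
    using assms
    by (cases i) (simp_all add: kred_diff kred_single kred_emb lin_ext_uminus_fun lin_ext_emb_fun kdiff_map_eq)
  then show ?thesis
    by (simp add: kdiff_map_eq lin_ext_add lin_ext_emb cone_simps kred_emb lin_ext_emb_fun emb_uminus)
qed

lemma cone_aug: "faug_map (cone p \<mu> F) (emb_even x) = faug_map F x"
proof -
  have "single (0 :: nat) (faug_map (cone p \<mu> F) (emb_even x)) = single 0 (faug_map F x)"
    unfolding faug_map_lin_ext[symmetric] lin_ext_emb by (simp add: cone_simps)
  then show ?thesis by (metis lookup_single_eq)
qed

lemma free_mod_empty [simp]: "free_mod s {} = {0}"
  by (auto simp: free_mod_def)

lemma free_mod_deg_shift: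
  assumes "f \<in> free_mod_deg A B d \<alpha>" "\<And>b. b \<in> B \<Longrightarrow> d b \<in> carrier_vec (dim_row A)" "\<mu> \<in> carrier_vec (dim_row A)"
  shows "f \<in> free_mod_deg A B (\<lambda>b. d b + \<mu>) (\<alpha> + \<mu>)"
proof -
  have "mon_deg A m + (d b + \<mu>) = (mon_deg A m + d b) + \<mu>" if "b \<in> B" for m b
    using assms(2)[OF that] assms(3) by (simp add: assoc_add_vec[where n = "dim_row A"])
  then show ?thesis using assms(1) by (force simp: free_mod_deg_def free_mod_def)
qed

text \<open>Multiplication by \<open>p\<close> raises degrees by \<mu>, so it preserves degrees
  exactly when its source is the copy of F shifted by \<mu>.\<close>

lemma cone_graded:
  assumes F: "graded_free_resolution A I F" and p: "p \<in> homog A \<mu>" and \<mu>: "\<mu> \<in> carrier_vec (dim_row A)"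
  defines "C \<equiv> cone p \<mu> F"
  shows "c \<in> fbasis C i \<Longrightarrow> fdeg C i c \<in> carrier_vec (dim_row A)"
    and "finite {c \<in> fbasis C i. fdeg C i c = \<alpha>}"
    and "graded_map A (fbasis C (Suc i)) (fdeg C (Suc i)) (fbasis C i) (fdeg C i) (fdiff C i)"
proof -
  note deg = resolution_deg[OF F]
  show carr: "c \<in> fbasis C i \<Longrightarrow> fdeg C i c \<in> carrier_vec (dim_row A)" for c i
    using deg \<mu> unfolding C_def by (auto simp: cone_def join_basis_def split: nat.splits)
  have "{c \<in> fbasis C i. fdeg C i c = \<alpha>} \<subseteq> (\<lambda>b. 2 * b) ` {b \<in> fbasis F i. fdeg F i b = \<alpha>} \<union>
      (\<lambda>b. Suc (2 * b)) ` {b \<in> fbasis F (i - 1). fdeg F (i - 1) b = \<alpha> - \<mu>}"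
  proof
    fix c assume c: "c \<in> {c \<in> fbasis C i. fdeg C i c = \<alpha>}"
    show "c \<in> (\<lambda>b. 2 * b) ` {b \<in> fbasis F i. fdeg F i b = \<alpha>} \<union>
      (\<lambda>b. Suc (2 * b)) ` {b \<in> fbasis F (i - 1). fdeg F (i - 1) b = \<alpha> - \<mu>}"
    proof (cases "even c")
      case True
      then show ?thesis using c by (auto simp: C_def cone_simps join_basis_iff elim!: evenE)
    next
      case False
      then obtain b where b: "c = Suc (2 * b)" by (auto elim: oddE)
      then obtain j where j: "i = Suc j" "b \<in> fbasis F j"
        using c by (cases i) (auto simp: C_def cone_simps join_basis_iff)
      have "fdeg F j b + \<mu> = \<alpha>" using c j b by (simp add: C_def cone_simps)
      then have "fdeg F j b = \<alpha> - \<mu>" using deg[OF j(2)] \<mu> by auto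
      then show ?thesis using b j by auto
    qed
  qed
  then show "finite {c \<in> fbasis C i. fdeg C i c = \<alpha>}"
    by (rule finite_subset) (use resolution_finite[OF F] in auto)
  have even: "graded_map A (fbasis F i) (fdeg F i) (fbasis C i) (fdeg C i) (\<lambda>b. single (2 * b) 1)"
    using deg carr free_mod_deg_basis[of "2 * _" "fbasis C i" "fdeg C i" A]
    by (auto simp: graded_map_def C_def cone_simps join_basis_iff)
  have "fdiff C i c \<in> free_mod_deg A (fbasis C i) (fdeg C i) (fdeg C (Suc i) c)"
    if c: "c \<in> fbasis C (Suc i)" for c
  proof (cases "even c")
    case True
    then obtain b where b: "c = 2 * b" by (auto elim: evenE)
    then have "fdiff F i b \<in> free_mod_deg A (fbasis F i) (fdeg F i) (fdeg F (Suc i) b)"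
      using resolution_diff[OF F, of i] c by (auto simp: graded_map_def C_def cone_simps join_basis_iff)
    then show ?thesis
      using lin_ext_graded_map[OF even] by (simp add: b C_def cone_simps emb_even_def)
  next
    case False
    then obtain b where b: "c = Suc (2 * b)" by (auto elim: oddE)
    then have bF: "b \<in> fbasis F i" using c by (auto simp: C_def cone_simps join_basis_iff)
    have "single (2 * b) p \<in> free_mod_deg A (fbasis C i) (fdeg C i) (fdeg F i b + \<mu>)"
      using bF p comm_add_vec[OF \<mu> deg[OF bF]]
      by (intro free_mod_deg_single) (auto simp: C_def cone_simps join_basis_iff homog_def)
    moreover have "(case i of 0 \<Rightarrow> 0 | Suc j \<Rightarrow> emb_odd (fdiff F j b))
        \<in> free_mod_deg A (fbasis C i) (fdeg C i) (fdeg F i b + \<mu>)"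
    proof (cases i)
      case (Suc j)
      have "fdiff F j b \<in> free_mod_deg A (fbasis F j) (fdeg F j) (fdeg F i b)"
        using resolution_diff[OF F, of j] bF Suc by (auto simp: graded_map_def)
      then have d: "fdiff F j b \<in> free_mod_deg A (fbasis F j) (\<lambda>b. fdeg F j b + \<mu>) (fdeg F i b + \<mu>)"
        by (rule free_mod_deg_shift) (auto simp: deg \<mu>)
      have "graded_map A (fbasis F j) (\<lambda>b. fdeg F j b + \<mu>) (fbasis C i) (fdeg C i) (\<lambda>b. single (Suc (2 * b)) 1)"
        using deg \<mu> carr free_mod_deg_basis[of "Suc (2 * _)" "fbasis C i" "fdeg C i" A]
        by (auto simp: graded_map_def C_def cone_simps join_basis_iff Suc)
      from lin_ext_graded_map[OF this d] show ?thesis by (simp add: Suc emb_odd_def)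
    qed simp
    ultimately show ?thesis
      unfolding b C_def cone_simps by (rule free_mod_deg_diff)
  qed
  then show "graded_map A (fbasis C (Suc i)) (fdeg C (Suc i)) (fbasis C i) (fdeg C i) (fdiff C i)"
    using carr by (auto simp: graded_map_def)
qed

text \<open>To bound a cycle (x, y) of the cone, the second component is dealt with first, and what
  then remains of the first is lifted in F. The nonzerodivisor hypothesis enters at stage 1, where
  it turns p * \<open>faug_map F y\<close> in J into \<open>faug_map F y\<close> in J.\<close>

lemma cone_resolution:
  assumes F: "graded_free_resolution A J F" and J: "is_ideal (dim_col A) J"
    and p: "p \<in> homog A \<mu>" and \<mu>: "\<mu> \<in> carrier_vec (dim_row A)"
    and nzd: "\<And>r. r \<in> mpolys (dim_col A) \<Longrightarrow> p * r \<in> J \<Longrightarrow> r \<in> J"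
    and I: "\<And>q. q \<in> I \<longleftrightarrow> (\<exists>r\<in>mpolys (dim_col A). q - r * p \<in> J)"
  shows "graded_free_resolution A I (cone p \<mu> F)"
proof -
  let ?R = "dim_col A"
  define C where "C = cone p \<mu> F"
  let ?F = "\<lambda>i. free_mod ?R (fbasis F i)"
  let ?S = "\<lambda>i. case i of 0 \<Rightarrow> {0} | Suc j \<Rightarrow> ?F j"
  let ?d = "\<lambda>i. fdiff_map F i"
  let ?d' = "\<lambda>i y. case i of 0 \<Rightarrow> 0 | Suc j \<Rightarrow> ?d j y"
  have pR: "p \<in> mpolys ?R" using p by (simp add: homog_def)
  have d_mod: "?d i x \<in> ?F i" if "x \<in> ?F (Suc i)" for i x
    using lin_ext_graded_map_free_mod[OF resolution_diff[OF F] that] .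
  have dd: "?d' i (?d i y) = 0" if "y \<in> ?F (Suc i)" for i y
    using resolution_complex[OF F that] by (cases i) auto
  have faug_mod: "faug_map F y \<in> mpolys ?R" if "y \<in> ?F 0" for y
  proof -
    have "single 0 (faug_map F y) \<in> free_mod ?R {0}"
      using lin_ext_graded_map_free_mod[OF resolution_aug[OF F] that] by (simp add: faug_map_lin_ext)
    then show ?thesis by (auto simp: free_mod_def dest!: spec[of _ 0])
  qed
  have C_mod: "emb_even x + emb_odd y \<in> free_mod ?R (fbasis C i) \<longleftrightarrow> x \<in> ?F i \<and> y \<in> ?S i" for x y i
    unfolding C_def cone_simps emb_sum_free_mod_iff by (cases i) auto
  have C_elem: "\<exists>x\<in>?F i. \<exists>y\<in>?S i. g = emb_even x + emb_odd y" if "g \<in> free_mod ?R (fbasis C i)" for i g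
    using that emb_proj[of g] C_mod by metis
  have C_diff: "fdiff_map C i (emb_even x + emb_odd y) =
      emb_even (?d i x + pm_smult p y) + emb_odd (- ?d' i y)" for i x y
    unfolding C_def by (rule cone_diff)
  have C_cycle: "fdiff_map C i (emb_even x + emb_odd y) = 0 \<longleftrightarrow> ?d i x + pm_smult p y = 0 \<and> ?d' i y = 0" for i x y
    unfolding C_diff emb_sum_eq_0_iff by simp
  have C_diff_mod: "fdiff_map C i g \<in> free_mod ?R (fbasis C i)" if "g \<in> free_mod ?R (fbasis C (Suc i))" for i g
    using lin_ext_graded_map_free_mod[OF cone_graded(3)[OF F p \<mu>] that[unfolded C_def]] by (simp add: C_def)
  have sub: "cycle I C i (fdiff_map C i g)" if g: "g \<in> free_mod ?R (fbasis C (Suc i))" for i g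
  proof -
    obtain x y where xy: "x \<in> ?F (Suc i)" "y \<in> ?F i" "g = emb_even x + emb_odd y"
      using C_elem[OF g] by auto
    show ?thesis
    proof (cases i)
      case 0
      have "faug_map F (?d 0 x) \<in> J" using resolution_complex[OF F xy(1)[unfolded 0]] by simp
      then have "faug_map F (?d 0 x + pm_smult p y) \<in> I"
        unfolding I using faug_mod[of y] xy(2) 0
        by (auto simp: faug_map_add faug_map_smult mult.commute intro!: bexI[of _ "faug_map F y"])
      then show ?thesis by (simp add: 0 xy(3) C_diff) (simp add: C_def cone_aug)
    next
      case (Suc j)
      have "?d j (?d i x) = 0" "?d' j (?d j y) = 0"
        using dd[OF xy(1)] dd[of y j] xy(2) Suc by simp_all
      then show ?thesis
        unfolding xy(3) C_diff Suc cycle_Suc C_cycle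
        by (cases j) (auto simp: lin_ext_add lin_ext_smult lin_ext_uminus pm_smult_uminus Suc)
    qed
  qed
  have exact: "\<exists>g'\<in>free_mod ?R (fbasis C (Suc i)). g = fdiff_map C i g'"
    if g: "g \<in> free_mod ?R (fbasis C i)" "cycle I C i g" for i g
  proof (cases i)
    case 0
    then obtain x where x: "x \<in> ?F 0" "g = emb_even x" using C_elem[OF g(1)] by auto
    have "faug_map F x \<in> I" using g(2) 0 x(2) by (simp add: C_def cone_aug)
    then obtain r where r: "r \<in> mpolys ?R" "faug_map F x - r * p \<in> J" unfolding I by blast
    obtain y where y: "y \<in> ?F 0" "r - faug_map F y \<in> J" using resolution_surj[OF F r(1)] by blast
    \<comment> \<open>The value of \<open>x\<close> is r p modulo J, and \<open>y\<close> lifts r;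
      so subtracting p y moves \<open>x\<close> from the kernel over I to the kernel over J, where F
      is exact.\<close>
    have "faug_map F (x - pm_smult p y) = (faug_map F x - r * p) + p * (r - faug_map F y)"
      by (simp add: faug_map_diff faug_map_smult algebra_simps)
    also have "\<dots> \<in> J" by (intro is_ideal_add[OF J] r is_ideal_mult[OF J pR] y)
    finally obtain x1 where x1: "x1 \<in> ?F (Suc 0)" "x - pm_smult p y = ?d 0 x1"
      using resolution_exact[OF F, of "x - pm_smult p y" 0] x(1) y(1) pR by auto
    then have "g = fdiff_map C 0 (emb_even x1 + emb_odd y)"
      unfolding C_diff x(2) x1(2)[symmetric] by simp
    then show ?thesis using C_mod[of x1 y "Suc 0"] x1(1) y(1) 0 by auto
  next
    case (Suc j)
    obtain x y where xy: "x \<in> ?F (Suc j)" "y \<in> ?F j" "g = emb_even x + emb_odd y"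
      using C_elem[OF g(1)] Suc by auto
    have cyc: "?d j x + pm_smult p y = 0" "?d' j y = 0"
      using g(2) by (simp_all add: Suc xy(3) C_cycle)
    have "cycle J F j y"
    proof (cases j)
      case 0
      have "faug_map F (?d 0 x) \<in> J" using resolution_complex[OF F xy(1)] 0 by simp
      moreover have "faug_map F (?d 0 x) + p * faug_map F y = 0"
        using arg_cong[OF cyc(1), of "faug_map F"] 0
        by (simp add: faug_map_add faug_map_smult) (simp add: faug_map_def)
      ultimately have "p * faug_map F y \<in> J"
        using is_ideal_uminus[OF J] by (metis add.commute eq_neg_iff_add_eq_0)
      then show ?thesis using nzd[OF faug_mod] xy(2) 0 by simp
    next
      case (Suc k)
      then show ?thesis using cyc(2) by simp
    qed
    then obtain y1 where y1: "y1 \<in> ?F (Suc j)" "y = ?d j y1"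
      using resolution_exact[OF F xy(2)] by blast
    \<comment> \<open>With \<open>y\<close> = d \<open>y1\<close> the cycle condition d x + p y = 0
      becomes d (x + p \<open>y1\<close>) = 0. The bounding element has second component -
      \<open>y1\<close> because of the sign in the cone differential.\<close>
    have "?d j (x + pm_smult p y1) = 0"
      using cyc(1) by (simp add: lin_ext_add lin_ext_smult y1(2))
    then obtain x1 where x1: "x1 \<in> ?F (Suc (Suc j))" "x + pm_smult p y1 = ?d (Suc j) x1"
      using resolution_exact[OF F, of "x + pm_smult p y1" "Suc j"] xy(1) y1(1) pR by auto
    then have "g = fdiff_map C i (emb_even x1 + emb_odd (- y1))"
      unfolding C_diff xy(3) Suc x1(2)[symmetric] by (simp add: lin_ext_uminus pm_smult_uminus y1(2))
    moreover have "emb_even x1 + emb_odd (- y1) \<in> free_mod ?R (fbasis C (Suc i))"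
      using C_mod[of x1 "- y1" "Suc i"] x1(1) y1(1) Suc by auto
    ultimately show ?thesis by blast
  qed
  have "{f \<in> free_mod ?R (fbasis C i). cycle I C i f} = fdiff_map C i ` free_mod ?R (fbasis C (Suc i))" for i
    using sub exact C_diff_mod by blast
  moreover have "\<exists>f\<in>free_mod ?R (fbasis C 0). q - faug_map C f \<in> I" if q: "q \<in> mpolys ?R" for q
  proof -
    obtain f where f: "f \<in> ?F 0" "q - faug_map F f \<in> J" using resolution_surj[OF F q] by blast
    then have "q - faug_map F f \<in> I" unfolding I by (intro bexI[of _ 0]) auto
    then show ?thesis
      using C_mod[of f 0 0] f(1) by (intro bexI[of _ "emb_even f"]) (auto simp: C_def cone_aug)
  qed
  moreover have "graded_map A (fbasis C 0) (fdeg C 0) {0} (\<lambda>_. 0\<^sub>v (dim_row A)) (\<lambda>b. single 0 (faug C b))"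
    using resolution_aug[OF F]
    by (auto simp: graded_map_def C_def cone_simps join_basis_def)
  ultimately show ?thesis
    unfolding graded_free_resolution_iff fmod_eq C_def[symmetric]
    using cone_graded(2,3)[OF F p \<mu>] by (simp add: C_def)
qed

text \<open>Counts dimensions along 0 -> X -> X + Y -> Y -> 0 by four uses of
  \<open>dim_add_le\<close>: two with zero subspaces identify the dimension of the even copy with
  that of X, and two modulo the even copy give the inequalities in both directions.\<close>

lemma kvec_dim_emb_sum:
  fixes X Y :: "(nat \<Rightarrow>\<^sub>0 'k::field) set"
  assumes X: "kvec.subspace X" "X \<subseteq> kvec.span W" "finite W"
    and Y: "kvec.subspace Y" "Y \<subseteq> kvec.span W'" "finite W'"
  shows "kvec.dim {emb_even x + emb_odd y | x y. x \<in> X \<and> y \<in> Y} = kvec.dim X + kvec.dim Y"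
proof -
  let ?S = "{emb_even x + emb_odd y | x y. x \<in> X \<and> y \<in> Y}" and ?E = "emb_even ` X"
  have sub0: "kvec.subspace {0 :: nat \<Rightarrow>\<^sub>0 'k}" "{0 :: nat \<Rightarrow>\<^sub>0 'k} \<subseteq> kvec.span {}" by auto
  have dim0: "kvec.dim {0 :: nat \<Rightarrow>\<^sub>0 'k} = 0"
    using kvec.dim_span[of "{} :: (nat \<Rightarrow>\<^sub>0 'k) set"] kvec.dim_eq_card_independent[OF kvec.independent_empty]
    by simp
  have X0: "0 \<in> X" and Y0: "0 \<in> Y" using X(1) Y(1) by (auto simp: kvec.subspace_0)
  have span_image: "f ` V \<subseteq> kvec.span (f ` U)"
    if "V \<subseteq> kvec.span U" "\<And>x y. f (x + y) = f x + f y" "\<And>c x. f (pm_smult c x) = pm_smult c (f x)"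
    for f :: "(nat \<Rightarrow>\<^sub>0 'k) \<Rightarrow> (nat \<Rightarrow>\<^sub>0 'k)" and U V
  proof -
    have "f 0 = 0" using that(3)[of 0 0] by simp
    then have "kvec.subspace {x. f x \<in> kvec.span (f ` U)}"
      by (auto simp: kvec.subspace_def that kvec.span_add kvec.span_scale kvec.span_zero)
    then have "kvec.span U \<subseteq> {x. f x \<in> kvec.span (f ` U)}"
      by (intro kvec.span_minimal) (auto intro: kvec.span_base)
    then show ?thesis using that(1) by blast
  qed
  have E: "kvec.subspace ?E"
    using X(1) unfolding kvec.subspace_def
    by (auto simp flip: emb_add emb_smult intro!: image_eqI[of 0 emb_even 0])
  have E_span: "?E \<subseteq> kvec.span (emb_even ` W)" by (rule span_image[OF X(2) emb_add(1) emb_smult(1)])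
  have S_span: "?S \<subseteq> kvec.span (emb_even ` W \<union> emb_odd ` W')"
  proof -
    have "emb_even x \<in> kvec.span (emb_even ` W \<union> emb_odd ` W')" if "x \<in> X" for x
      using E_span kvec.span_mono[of "emb_even ` W" "emb_even ` W \<union> emb_odd ` W'"] that by blast
    moreover have "emb_odd y \<in> kvec.span (emb_even ` W \<union> emb_odd ` W')" if "y \<in> Y" for y
      using span_image[OF Y(2) emb_add(2) emb_smult(2)]
        kvec.span_mono[of "emb_odd ` W'" "emb_even ` W \<union> emb_odd ` W'"] that by blast
    ultimately show ?thesis by (auto intro: kvec.span_add)
  qed
  have "kvec.dim ?E + kvec.dim {0 :: nat \<Rightarrow>\<^sub>0 'k} \<le> kvec.dim X + kvec.dim {0 :: nat \<Rightarrow>\<^sub>0 'k}"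
    by (rule kvec.dim_add_le[OF sub0 _ X(2,3) sub0(1), of emb_even]) (auto simp: X0 emb_add emb_smult)
  moreover have "kvec.dim X + kvec.dim {0 :: nat \<Rightarrow>\<^sub>0 'k} \<le> kvec.dim ?E + kvec.dim {0 :: nat \<Rightarrow>\<^sub>0 'k}"
    by (rule kvec.dim_add_le[OF sub0 _ E_span _ sub0(1), of proj_even])
      (use X in \<open>auto simp: emb_add emb_smult intro: kvec.subspace_0[OF E]\<close>)
  moreover have "kvec.dim ?S + kvec.dim {0 :: nat \<Rightarrow>\<^sub>0 'k} \<le> kvec.dim Y + kvec.dim ?E"
    by (rule kvec.dim_add_le[OF E E_span _ Y(2,3) sub0(1), of emb_odd])
      (use X Y0 kvec.subspace_0[OF E] in \<open>auto simp: emb_add emb_smult add.commute\<close>)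
  moreover have "kvec.dim Y + kvec.dim ?E \<le> kvec.dim ?S + kvec.dim {0 :: nat \<Rightarrow>\<^sub>0 'k}"
  proof (rule kvec.dim_add_le[OF sub0 _ S_span _ E, of proj_odd])
    show "?E \<subseteq> ?S" using Y0 by force
    show "\<exists>z'\<in>?S. \<exists>b\<in>{0}. z = proj_odd z' + b" if "z \<in> Y" for z
    proof -
      have "emb_odd z = emb_even 0 + emb_odd z" by simp
      then have "emb_odd z \<in> ?S" using that X0 by blast
      then show ?thesis by (rule bexI[rotated]) simp
    qed
  qed (use X Y in \<open>auto simp: emb_add emb_smult\<close>)
  ultimately show ?thesis using dim0 by simp
qed

text \<open>An odd basis element has degree \<alpha> exactly if the corresponding basis element of F
  has degree \<alpha> - \<mu>. As the reduced differential does not mix the summands, cycles and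
  boundaries are sets of pairs.\<close>

lemma cone_tor_dim:
  fixes F :: "'k::field free_complex"
  assumes F: "graded_free_resolution A J F" and p0: "lookup p 0 = 0"
    and \<mu>: "\<mu> \<in> carrier_vec (dim_row A)" and \<alpha>: "\<alpha> \<in> carrier_vec (dim_row A)"
  shows "tor_dim (cone p \<mu> F) i \<alpha> =
     tor_dim F i \<alpha> + (case i of 0 \<Rightarrow> 0 | Suc j \<Rightarrow> tor_dim F j (\<alpha> - \<mu>))"
proof -
  define C where "C = cone p \<mu> F"
  let ?pair = "\<lambda>X Y. {emb_even x + emb_odd y | x y. x \<in> X \<and> y \<in> Y} :: (nat \<Rightarrow>\<^sub>0 'k) set"
  let ?M = "\<lambda>i. case i of 0 \<Rightarrow> {0} | Suc j \<Rightarrow> kmod_deg F j (\<alpha> - \<mu>)"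
  let ?Z = "\<lambda>i. case i of 0 \<Rightarrow> {0} | Suc j \<Rightarrow> tor_cycles F j (\<alpha> - \<mu>)"
  let ?B = "\<lambda>i. case i of 0 \<Rightarrow> {0} | Suc j \<Rightarrow> tor_boundaries F j (\<alpha> - \<mu>)"
  let ?k = "\<lambda>i. kdiff_map F i"
  let ?k' = "\<lambda>i y. case i of 0 \<Rightarrow> 0 | Suc j \<Rightarrow> ?k j y"
  have k_diff: "kdiff_map C i (emb_even x + emb_odd y) = emb_even (?k i x) + emb_odd (- ?k' i y)" for i x y
    unfolding C_def by (rule cone_kdiff[OF p0])
  have mod_iff: "emb_even x + emb_odd y \<in> kmod_deg C i \<alpha> \<longleftrightarrow> x \<in> kmod_deg F i \<alpha> \<and> y \<in> ?M i" for i x y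
  proof -
    have shift: "b \<in> fbasis F j \<Longrightarrow> fdeg F j b + \<mu> = \<alpha> \<longleftrightarrow> fdeg F j b = \<alpha> - \<mu>" for j b
      using resolution_deg[OF F, of b j] \<mu> \<alpha> by auto
    show ?thesis
    proof (cases i)
      case 0
      then show ?thesis unfolding kmod_deg_iff
        by (subst all_nat_even_odd)
          (auto simp: lookup_emb_sum C_def cone_simps join_basis_iff intro: poly_mapping_eqI)
    next
      case (Suc j)
      then show ?thesis unfolding kmod_deg_iff using shift
        by (subst all_nat_even_odd) (auto simp: lookup_emb_sum C_def cone_simps join_basis_iff kmod_deg_iff)
    qed
  qed
  have mod: "kmod_deg C i \<alpha> = ?pair (kmod_deg F i \<alpha>) (?M i)" for i
  proof (intro equalityI subsetI)
    fix g assume "g \<in> kmod_deg C i \<alpha>"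
    then show "g \<in> ?pair (kmod_deg F i \<alpha>) (?M i)"
      using emb_proj[of g] mod_iff[of "proj_even g" "proj_odd g"] by (metis (mono_tags, lifting) mem_Collect_eq)
  qed (use mod_iff in auto)
  have Z: "tor_cycles C i \<alpha> = ?pair (tor_cycles F i \<alpha>) (?Z i)"
  proof (cases i)
    case 0
    then show ?thesis by (simp add: tor_cycles_def mod)
  next
    case (Suc j)
    have "kdiff_map C j (emb_even x + emb_odd y) = 0 \<longleftrightarrow> ?k j x = 0 \<and> ?k' j y = 0" for x y
      unfolding k_diff emb_sum_eq_0_iff by simp
    moreover have "y \<in> tor_cycles F j (\<alpha> - \<mu>) \<longleftrightarrow> y \<in> kmod_deg F j (\<alpha> - \<mu>) \<and> ?k' j y = 0" for y
      by (simp add: tor_cycles_def split: nat.split)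
    moreover have "tor_cycles C i \<alpha> = {g \<in> ?pair (kmod_deg F i \<alpha>) (kmod_deg F j (\<alpha> - \<mu>)). kdiff_map C j g = 0}"
      by (simp add: tor_cycles_def mod Suc)
    moreover have "tor_cycles F i \<alpha> = {x \<in> kmod_deg F i \<alpha>. ?k j x = 0}"
      by (simp add: tor_cycles_def Suc)
    ultimately show ?thesis
      unfolding Suc by auto
  qed
  have B: "tor_boundaries C i \<alpha> = ?pair (tor_boundaries F i \<alpha>) (?B i)"
  proof -
    have "tor_boundaries C i \<alpha> = {emb_even (?k i x) + emb_odd (- ?k' i y) | x y.
        x \<in> kmod_deg F (Suc i) \<alpha> \<and> y \<in> kmod_deg F i (\<alpha> - \<mu>)}"
      unfolding tor_boundaries_def mod k_diff[symmetric] nat.case by blast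
    also have "\<dots> = ?pair (tor_boundaries F i \<alpha>) ((\<lambda>y. - ?k' i y) ` kmod_deg F i (\<alpha> - \<mu>))"
      unfolding tor_boundaries_def by blast
    \<comment> \<open>The sign of the shifted differential does not affect its image, which is a
      subspace.\<close>
    also have "(\<lambda>y. - ?k' i y) ` kmod_deg F i (\<alpha> - \<mu>) = ?B i"
    proof (cases i)
      case 0
      then show ?thesis using kvec.subspace_0[OF subspace_kmod_deg[of F i "\<alpha> - \<mu>"]] by auto
    next
      case (Suc j)
      have "- x \<in> tor_boundaries F j (\<alpha> - \<mu>) \<longleftrightarrow> x \<in> tor_boundaries F j (\<alpha> - \<mu>)" for x
        using kvec.subspace_neg[OF subspace_tor_boundaries[of F j "\<alpha> - \<mu>"]] by (metis add.inverse_inverse)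
      then show ?thesis
        using Suc by (auto simp: tor_boundaries_def image_iff) (metis add.inverse_inverse)
    qed
    finally show ?thesis .
  qed
  have sub: "kvec.subspace (?Z i)" "kvec.subspace (?B i)"
    by (auto simp: subspace_tor_cycles subspace_tor_boundaries split: nat.split)
  obtain W where W: "finite W" "tor_cycles F i \<alpha> \<subseteq> kvec.span W" "tor_boundaries F i \<alpha> \<subseteq> kvec.span W"
    by (rule tor_dims[OF F])
  obtain W' where W': "finite W'" "?Z i \<subseteq> kvec.span W'" "?B i \<subseteq> kvec.span W'"
  proof (cases i)
    case 0
    then show thesis using that[of "{}"] by simp
  next
    case (Suc j)
    then show thesis using that by (auto intro: tor_dims[OF F, of j "\<alpha> - \<mu>"])
  qed
  \<comment> \<open>Differences are taken in the naturals, so splitting the difference of two sums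
    requires that boundaries have at most the dimension of cycles, in both summands.\<close>
  have le: "kvec.dim U \<le> kvec.dim V" if "U \<subseteq> V" "V \<subseteq> kvec.span T" "finite T" for U V T :: "(nat \<Rightarrow>\<^sub>0 'k) set"
  proof -
    obtain b where b: "b \<subseteq> V" "kvec.independent b" "V \<subseteq> kvec.span b" "card b = kvec.dim V"
      by (rule kvec.basis_exists)
    have "finite b" using kvec.independent_span_bound[OF that(3) b(2)] b(1) that(2) by blast
    then show ?thesis using kvec.dim_le_card[of U b] b that(1) by auto
  qed
  have ZB: "?B i \<subseteq> ?Z i"
    using tor_boundaries_subset[OF F] by (auto split: nat.split)
  have "tor_dim C i \<alpha> = (kvec.dim (tor_cycles F i \<alpha>) + kvec.dim (?Z i)) -
      (kvec.dim (tor_boundaries F i \<alpha>) + kvec.dim (?B i))"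
    unfolding tor_dim_def Z B
    by (subst (1 2) kvec_dim_emb_sum[where W = W and W' = W'])
      (use W W' sub subspace_tor_cycles subspace_tor_boundaries in auto)
  also have "\<dots> = tor_dim F i \<alpha> + (kvec.dim (?Z i) - kvec.dim (?B i))"
    using le[OF tor_boundaries_subset[OF F] W(2,1)] le[OF ZB W'(2,1)] by (simp add: tor_dim_def)
  also have "kvec.dim (?Z i) - kvec.dim (?B i) = (case i of 0 \<Rightarrow> 0 | Suc j \<Rightarrow> tor_dim F j (\<alpha> - \<mu>))"
    by (auto simp: tor_dim_def split: nat.split)
  finally show ?thesis by (simp add: C_def)
qed

section \<open>Lattice ideals\<close>

definition is_lattice :: "nat \<Rightarrow> int vec set \<Rightarrow> bool" where
  "is_lattice s L \<longleftrightarrow> L \<subseteq> carrier_vec s \<and> 0\<^sub>v s \<in> L \<and> (\<forall>a\<in>L. \<forall>b\<in>L. a + b \<in> L) \<and> (\<forall>a\<in>L. - a \<in> L)"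

lemma
  assumes "is_lattice s L"
  shows is_lattice_carrier: "a \<in> L \<Longrightarrow> a \<in> carrier_vec s"
    and is_lattice_0: "0\<^sub>v s \<in> L"
    and is_lattice_add: "a \<in> L \<Longrightarrow> b \<in> L \<Longrightarrow> a + b \<in> L"
    and is_lattice_uminus: "a \<in> L \<Longrightarrow> - a \<in> L"
  using assms by (auto simp: is_lattice_def)

lemma is_lattice_diff:
  assumes L: "is_lattice s L" and "a \<in> L" "b \<in> L" shows "a - b \<in> L"
proof -
  have "a - b = a + - b"
    using assms by (intro minus_add_uminus_vec[where n = s] is_lattice_carrier[OF L])
  then show ?thesis using assms by (simp add: is_lattice_add is_lattice_uminus)
qed

lemma is_lattice_mat_kernel: "is_lattice (dim_col A) (mat_kernel A)"
proof -
  have "A *\<^sub>v (- v) = - (A *\<^sub>v v)" if "v \<in> carrier_vec (dim_col A)" for v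
    using that by (intro eq_vecI) auto
  then show ?thesis
    by (auto simp: is_lattice_def mat_kernel_def mult_add_distrib_mat_vec[where nr = "dim_row A" and nc = "dim_col A"])
qed

section \<open>Exponent vectors of monomials\<close>

definition expvec :: "nat \<Rightarrow> (nat \<Rightarrow>\<^sub>0 nat) \<Rightarrow> int vec" where
  "expvec s m = vec s (\<lambda>j. int (lookup m j))"

definition vec_exp :: "int vec \<Rightarrow> (nat \<Rightarrow>\<^sub>0 nat)" where
  "vec_exp v = (\<Sum>j<dim_vec v. single j (nat (v $ j)))"

lemma expvec_carrier [simp]: "expvec s m \<in> carrier_vec s"
  and dim_expvec [simp]: "dim_vec (expvec s m) = s"
  and index_expvec [simp]: "j < s \<Longrightarrow> expvec s m $ j = int (lookup m j)"
  by (simp_all add: expvec_def)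

lemma mon_deg_expvec: "mon_deg A m = A *\<^sub>v expvec (dim_col A) m"
  by (simp add: mon_deg_def expvec_def)

lemma lookup_vec_exp: "lookup (vec_exp v) j = (if j < dim_vec v then nat (v $ j) else 0)"
  by (simp add: vec_exp_def lookup_sum lookup_single when_def)

lemma keys_vec_exp: "v \<in> carrier_vec s \<Longrightarrow> keys (vec_exp v) \<subseteq> {..<s}"
  by (auto simp: in_keys_iff lookup_vec_exp split: if_splits)

lemma expvec_vec_exp: "v \<in> carrier_vec s \<Longrightarrow> nonneg_vec v \<Longrightarrow> expvec s (vec_exp v) = v"
  by (intro eq_vecI) (auto simp: lookup_vec_exp nonneg_vec_def)

lemma expvec_inject: "keys m \<subseteq> {..<s} \<Longrightarrow> keys m' \<subseteq> {..<s} \<Longrightarrow> expvec s m = expvec s m' \<Longrightarrow> m = m'"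
proof (rule poly_mapping_eqI)
  fix j assume *: "keys m \<subseteq> {..<s}" "keys m' \<subseteq> {..<s}" "expvec s m = expvec s m'"
  show "lookup m j = lookup m' j"
  proof (cases "j < s")
    case True
    then show ?thesis using arg_cong[OF *(3), of "\<lambda>v. v $ j"] by simp
  next
    case False
    then have "j \<notin> keys m" "j \<notin> keys m'" using * by auto
    then show ?thesis by (simp add: in_keys_iff)
  qed
qed

lemma pos_neg_vec [simp]: "dim_vec (pos_vec v) = dim_vec v" "dim_vec (neg_vec v) = dim_vec v"
  "nonneg_vec (pos_vec v)" "nonneg_vec (neg_vec v)"
  by (simp_all add: pos_vec_def neg_vec_def nonneg_vec_def)

lemma pos_neg_vec_carrier [simp]:
  "v \<in> carrier_vec s \<Longrightarrow> pos_vec v \<in> carrier_vec s" "v \<in> carrier_vec s \<Longrightarrow> neg_vec v \<in> carrier_vec s"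
  by (auto intro!: carrier_vecI dest: carrier_vecD)

lemma pos_vec_minus_neg_vec: "pos_vec v - neg_vec v = v"
  by (intro eq_vecI) (auto simp: pos_vec_def neg_vec_def)

lemma binom_eq: "binom v = single (vec_exp (pos_vec v)) 1 - single (vec_exp (neg_vec v)) 1"
  by (simp add: binom_def xpow_def vec_exp_def)

lemma binom_mpolys: "v \<in> carrier_vec s \<Longrightarrow> binom v \<in> mpolys s"
  unfolding binom_eq by (intro mpolys_diff mpolys_single keys_vec_exp) simp_all

text \<open>The common factor \<open>w\<close> is the componentwise minimum of the two exponents,
  that is, m minus the positive part of the difference; dividing it out leaves the binomial of the
  difference.\<close>

lemma monomial_difference:
  fixes c :: "'k::comm_ring_1"
  assumes m: "keys m \<subseteq> {..<s}" "keys m' \<subseteq> {..<s}"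
  obtains w where "keys w \<subseteq> {..<s}"
    "single m c - single m' c = single w c * binom (expvec s m - expvec s m')"
proof -
  let ?v = "expvec s m - expvec s m'"
  define w where "w = m - vec_exp (pos_vec ?v)"
  have *: "lookup m j = 0" "lookup m' j = 0" if "\<not> j < s" for j
    using m that by (auto simp flip: not_in_keys_iff_lookup_eq_zero)
  have eq: "m = w + vec_exp (pos_vec ?v)" "m' = w + vec_exp (neg_vec ?v)"
    by (rule poly_mapping_eqI;
        auto simp: w_def lookup_add lookup_minus lookup_vec_exp pos_vec_def neg_vec_def * max_def)+
  have "single m c - single m' c = single w c * binom ?v"
    by (simp only: binom_eq right_diff_distrib mult_single mult_1_right eq[symmetric])
  moreover have "keys w \<subseteq> {..<s}"
    using m by (auto simp: w_def in_keys_iff lookup_minus subset_iff)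
  ultimately show thesis using that by blast
qed

text \<open>The coefficient, at the class of \<open>u\<close>, of the image of \<open>p\<close> in
  the group ring of Z^s/L. The dimension of \<open>u\<close> supplies the number of
  variables.\<close>

definition class_sum :: "int vec set \<Rightarrow> int vec \<Rightarrow> 'k::comm_ring_1 mpoly \<Rightarrow> 'k" where
  "class_sum L u p = (\<Sum>m\<in>keys p. if expvec (dim_vec u) m - u \<in> L then lookup p m else 0)"

lemma class_sum_add: "class_sum L u (p + q) = class_sum L u p + class_sum L u q"
  unfolding class_sum_def by (rule setsum_keys_plus_distrib) auto

lemma class_sum_0 [simp]: "class_sum L u 0 = 0"
  by (simp add: class_sum_def)

lemma class_sum_single:
  "class_sum L u (single m c) = (if expvec (dim_vec u) m - u \<in> L then c else 0)"
  by (simp add: class_sum_def)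

lemma class_sum_diff: "class_sum L u (p - q) = class_sum L u p - class_sum L u q"
  using class_sum_add[of L u "p - q" q] by simp

text \<open>In the group ring a monomial acts by translation, so the class of \<open>u\<close> is
  moved back by the exponent of \<open>w\<close>.\<close>

lemma class_sum_monom_mult:
  assumes u: "u \<in> carrier_vec s"
  shows "class_sum L u (single w c * p) = c * class_sum L (u - expvec s w) p"
proof (induction p rule: poly_mapping_add_induct)
  case (single m)
  have "expvec s (w + m) - u = expvec s m - (u - expvec s w)"
    using u by (intro eq_vecI) (auto simp: lookup_add)
  then show ?case using u by (simp add: mult_single class_sum_single)
qed (auto simp: class_sum_add distrib_left)

text \<open>The kernel of the map from R to the group ring of Z^s/L, given by linear conditions. For
  a lattice L it coincides with the ideal generated by the binomials of L, see
  \<open>mideal_binom_eq_lattice_ideal\<close>.\<close>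

definition lattice_ideal :: "nat \<Rightarrow> int vec set \<Rightarrow> 'k::comm_ring_1 mpoly set" where
  "lattice_ideal s L = {p \<in> mpolys s. \<forall>u\<in>carrier_vec s. class_sum L u p = 0}"

lemma is_ideal_lattice_ideal: "is_ideal s (lattice_ideal s L)"
proof -
  have "c * p \<in> lattice_ideal s L" if "c \<in> mpolys s" and p: "p \<in> lattice_ideal s L"
    for c p :: "'k::comm_ring_1 mpoly"
    using that(1)
  proof (induction rule: mpolys_induct)
    case (single m c)
    then show ?case using p by (auto simp: lattice_ideal_def class_sum_monom_mult intro!: mpolys_single)
  qed (auto simp: lattice_ideal_def class_sum_add distrib_right)
  then show ?thesis
    by (auto simp: is_ideal_def lattice_ideal_def class_sum_add)
qed

lemma hpart_add: "hpart A \<alpha> (p + q) = hpart A \<alpha> p + hpart A \<alpha> q"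
  by (rule poly_mapping_eqI) (simp add: lookup_hpart lookup_add)

lemma hpart_0 [simp]: "hpart A \<alpha> 0 = 0"
  by (rule poly_mapping_eqI) (simp add: lookup_hpart)

lemma hpart_single: "hpart A \<alpha> (single m c) = (if mon_deg A m = \<alpha> then single m c else 0)"
  by (rule poly_mapping_eqI) (auto simp: lookup_hpart lookup_single when_def)

text \<open>The degree is constant on every class modulo L because A vanishes on L. So a class sum
  of a homogeneous component is either the full class sum or 0.\<close>

lemma homogeneous_lattice_ideal:
  fixes A :: "int mat"
  assumes L: "L \<subseteq> mat_kernel A"
  shows "homogeneous_ideal A (lattice_ideal (dim_col A) L :: 'k::comm_ring_1 mpoly set)"
  unfolding homogeneous_ideal_def
proof (intro ballI allI)
  fix p :: "'k mpoly" and \<alpha> assume p: "p \<in> lattice_ideal (dim_col A) L"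
  have "class_sum L u (hpart A \<alpha> q) = (if A *\<^sub>v u = \<alpha> then class_sum L u q else 0)"
    if u: "u \<in> carrier_vec (dim_col A)" for q :: "'k mpoly" and u
  proof (induction q rule: poly_mapping_add_induct)
    case (single m)
    have "mon_deg A m = A *\<^sub>v u" if "expvec (dim_col A) m - u \<in> L"
    proof -
      have "A *\<^sub>v (expvec (dim_col A) m - u) = 0\<^sub>v (dim_row A)"
        using that L by (auto simp: mat_kernel_def)
      then have eq: "mon_deg A m - A *\<^sub>v u = 0\<^sub>v (dim_row A)"
        using u by (simp add: mon_deg_expvec mult_minus_distrib_mat_vec[where nr = "dim_row A" and nc = "dim_col A"])
      have "mon_deg A m $ i = (A *\<^sub>v u) $ i" if "i < dim_row A" for i
        using that arg_cong[OF eq, of "\<lambda>v. v $ i"] by simp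
      then show ?thesis
        by (intro eq_vecI) (auto simp: carrier_vecD[OF mon_deg_carrier])
    qed
    then show ?case using u by (auto simp: hpart_single class_sum_single)
  qed (auto simp: hpart_add class_sum_add)
  moreover have "hpart A \<alpha> p \<in> mpolys (dim_col A)"
    using p by (auto simp: lattice_ideal_def mpolys_def in_keys_iff lookup_hpart split: if_splits)
  ultimately show "hpart A \<alpha> p \<in> lattice_ideal (dim_col A) L"
    using p by (auto simp: lattice_ideal_def)
qed

lemma monomial_difference_in_lattice_ideal:
  assumes L: "is_lattice s L" and m: "keys m \<subseteq> {..<s}" "keys m' \<subseteq> {..<s}"
    and d: "expvec s m - expvec s m' \<in> L"
  shows "single m c - single m' c \<in> lattice_ideal s L"
proof -
  have "expvec s m - u \<in> L \<longleftrightarrow> expvec s m' - u \<in> L" if u: "u \<in> carrier_vec s" for u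
  proof -
    have "expvec s m - u = (expvec s m' - u) + (expvec s m - expvec s m')"
      "expvec s m' - u = (expvec s m - u) - (expvec s m - expvec s m')"
      using u by (auto intro!: eq_vecI)
    then show ?thesis using is_lattice_add[OF L _ d] is_lattice_diff[OF L _ d] by metis
  qed
  then show ?thesis
    using m by (auto simp: lattice_ideal_def class_sum_diff class_sum_single mpolys_single)
qed

lemma binom_in_lattice_ideal:
  assumes L: "is_lattice s L" and a: "a \<in> L"
  shows "binom a \<in> lattice_ideal s L"
proof -
  have "a \<in> carrier_vec s" using is_lattice_carrier[OF L a] .
  then show ?thesis
    unfolding binom_eq using a
    by (intro monomial_difference_in_lattice_ideal[OF L] keys_vec_exp)
      (simp_all add: expvec_vec_exp pos_vec_minus_neg_vec)
qed

text \<open>Induction on the number of terms. Since the class sums vanish, no term is alone in its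
  class; moving its coefficient to another monomial present in the class removes the term and costs
  only a difference that lies in X.\<close>

lemma lattice_ideal_subset:
  fixes X :: "'k::comm_ring_1 mpoly set"
  assumes L: "is_lattice s L" and X: "0 \<in> X" "\<And>p q. p \<in> X \<Longrightarrow> q \<in> X \<Longrightarrow> p + q \<in> X"
    "\<And>m m' c. keys m \<subseteq> {..<s} \<Longrightarrow> keys m' \<subseteq> {..<s} \<Longrightarrow> expvec s m - expvec s m' \<in> L \<Longrightarrow>
       single m c - single m' c \<in> X"
  shows "lattice_ideal s L \<subseteq> X"
proof
  fix p :: "'k mpoly" assume "p \<in> lattice_ideal s L"
  then show "p \<in> X"
  proof (induction "card (keys p)" arbitrary: p rule: less_induct)
    case less
    show ?case
    proof (cases "p = 0")
      case False
      then obtain m where m: "m \<in> keys p" by (metis all_not_in_conv keys_eq_empty)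
      have "\<exists>m'\<in>keys p - {m}. expvec s m' - expvec s m \<in> L"
      proof (rule ccontr)
        assume *: "\<not> ?thesis"
        have "class_sum L (expvec s m) p = (\<Sum>m'\<in>{m}. if expvec s m' - expvec s m \<in> L then lookup p m' else 0)"
          unfolding class_sum_def dim_expvec using * m by (intro sum.mono_neutral_right) auto
        moreover have "expvec s m - expvec s m = 0\<^sub>v s" by (intro eq_vecI) auto
        ultimately have "class_sum L (expvec s m) p = lookup p m"
          using is_lattice_0[OF L] by simp
        then show False using less.prems m by (auto simp: lattice_ideal_def in_keys_iff)
      qed
      then obtain m' where m': "m' \<in> keys p" "m' \<noteq> m" "expvec s m' - expvec s m \<in> L" by blast
      define b where "b = single m (lookup p m) - single m' (lookup p m)"
      have km: "keys m \<subseteq> {..<s}" "keys m' \<subseteq> {..<s}"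
        using less.prems m m'(1) by (auto simp: lattice_ideal_def dest: mpolysD)
      have "expvec s m - expvec s m' = - (expvec s m' - expvec s m)" by (intro eq_vecI) auto
      then have d: "expvec s m - expvec s m' \<in> L" using is_lattice_uminus[OF L m'(3)] by simp
      have "keys (p - b) \<subseteq> keys p - {m}"
        using m m' by (auto simp: b_def in_keys_iff lookup_minus lookup_single when_def split: if_splits)
      then have "card (keys (p - b)) < card (keys p)"
        using m by (meson card_Diff1_less card_mono finite_Diff finite_keys le_less_trans)
      moreover have "p - b \<in> lattice_ideal s L"
        unfolding b_def
        by (intro is_ideal_diff[OF is_ideal_lattice_ideal] less.prems monomial_difference_in_lattice_ideal[OF L] km d)
      ultimately have "p - b \<in> X" by (rule less.hyps)
      moreover have "b \<in> X" unfolding b_def by (intro X(3) km d)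
      ultimately show ?thesis using X(2)[of "p - b" b] by simp
    qed (simp add: X)
  qed
qed

section \<open>Ideals generated by binomials\<close>

lemma mideal_subset:
  assumes "is_ideal s I" "G \<subseteq> I" shows "mideal s G \<subseteq> I"
  using assms by (auto simp: mideal_def intro!: is_ideal_sum is_ideal_mult)

lemma mult_generator_in_mideal:
  assumes "g \<in> G" "q \<in> mpolys s" shows "q * g \<in> mideal s G"
  unfolding mideal_def using assms by (auto intro!: exI[of _ "{g}"] exI[of _ "\<lambda>_. q"])

lemma is_ideal_mideal: "is_ideal s (mideal s G :: 'k::comm_ring_1 mpoly set)"
  unfolding is_ideal_def
proof (intro conjI ballI)
  show "0 \<in> mideal s G" unfolding mideal_def by (auto intro!: exI[of _ "{}"])
next
  fix p p' :: "'k mpoly" assume "p \<in> mideal s G" "p' \<in> mideal s G"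
  then obtain T q T' q' where T: "finite T" "T \<subseteq> G" "\<forall>g\<in>T. q g \<in> mpolys s" "p = (\<Sum>g\<in>T. q g * g)"
    and T': "finite T'" "T' \<subseteq> G" "\<forall>g\<in>T'. q' g \<in> mpolys s" "p' = (\<Sum>g\<in>T'. q' g * g)"
    unfolding mideal_def by blast
  define r where "r g = (if g \<in> T then q g else 0) + (if g \<in> T' then q' g else 0)" for g
  have "p = (\<Sum>g\<in>T \<union> T'. (if g \<in> T then q g else 0) * g)" "p' = (\<Sum>g\<in>T \<union> T'. (if g \<in> T' then q' g else 0) * g)"
    unfolding T(4) T'(4) using T(1) T'(1) by (auto intro!: sum.mono_neutral_cong_left)
  then have "p + p' = (\<Sum>g\<in>T \<union> T'. r g * g)"
    by (simp add: r_def distrib_right sum.distrib)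
  moreover have "\<forall>g\<in>T \<union> T'. r g \<in> mpolys s" using T(3) T'(3) by (auto simp: r_def)
  ultimately show "p + p' \<in> mideal s G"
    unfolding mideal_def using T(1,2) T'(1,2) by blast
next
  fix c p :: "'k mpoly" assume c: "c \<in> mpolys s" and "p \<in> mideal s G"
  then obtain T q where T: "finite T" "T \<subseteq> G" "\<forall>g\<in>T. q g \<in> mpolys s" "p = (\<Sum>g\<in>T. q g * g)"
    unfolding mideal_def by blast
  have "c * p = (\<Sum>g\<in>T. (c * q g) * g)" by (simp add: T(4) sum_distrib_left mult.assoc)
  moreover have "\<forall>g\<in>T. c * q g \<in> mpolys s" using T(3) c by auto
  ultimately show "c * p \<in> mideal s G"
    unfolding mideal_def using T(1,2) by (auto intro!: exI[of _ T] exI[of _ "\<lambda>g. c * q g"])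
qed

lemma monomial_difference_in_mideal:
  assumes "keys m \<subseteq> {..<s}" "keys m' \<subseteq> {..<s}" "expvec s m - expvec s m' \<in> L"
  shows "single m c - single m' c \<in> mideal s (binom ` L)"
  using monomial_difference[OF assms(1,2), of c] assms(3)
  by (metis imageI mpolys_single mult_generator_in_mideal)

lemma mideal_binom_eq_lattice_ideal:
  assumes L: "is_lattice s L" shows "mideal s (binom ` L) = lattice_ideal s L"
proof
  show "mideal s (binom ` L) \<subseteq> (lattice_ideal s L :: 'a mpoly set)"
    using binom_in_lattice_ideal[OF L] by (intro mideal_subset is_ideal_lattice_ideal) auto
  show "lattice_ideal s L \<subseteq> (mideal s (binom ` L) :: 'a mpoly set)"
    by (intro lattice_ideal_subset[OF L] is_ideal_0[OF is_ideal_mideal] is_ideal_add[OF is_ideal_mideal]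
        monomial_difference_in_mideal)
qed

text \<open>The class sums of \<open>r\<close> would be invariant under translation by \<open>\<tau>\<close>, hence zero since \<open>r\<close> has
  finitely many terms.\<close>

lemma binom_nonzerodivisor:
  fixes r :: "'k::comm_ring_1 mpoly"
  assumes L: "is_lattice s L" and \<tau>: "\<tau> \<in> carrier_vec s"
    and inf: "\<And>n :: int. n \<cdot>\<^sub>v \<tau> \<in> L \<Longrightarrow> n = 0"
    and r: "r \<in> mpolys s" "binom \<tau> * r \<in> lattice_ideal s L"
  shows "r \<in> lattice_ideal s L"
proof (rule ccontr)
  assume "r \<notin> lattice_ideal s L"
  then obtain u where u: "u \<in> carrier_vec s" "class_sum L u r \<noteq> 0"
    using r(1) by (auto simp: lattice_ideal_def)
  have step: "class_sum L (v + \<tau>) r = class_sum L v r" if v: "v \<in> carrier_vec s" for v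
  proof -
    \<comment> \<open>Chosen such that the two monomials of \<open>binom \<tau>\<close> translate it
      back to \<open>v\<close> and to \<open>v + \<tau>\<close>.\<close>
    let ?w = "v + pos_vec \<tau>"
    have "class_sum L ?w (binom \<tau> * r) = 0"
      using r(2) v \<tau> by (auto simp: lattice_ideal_def)
    then have "class_sum L (?w - pos_vec \<tau>) r = class_sum L (?w - neg_vec \<tau>) r"
      unfolding binom_eq left_diff_distrib class_sum_diff
      using v \<tau> by (simp add: class_sum_monom_mult[where s = s] expvec_vec_exp)
    moreover have "?w - pos_vec \<tau> = v" using v \<tau> by (intro eq_vecI) auto
    moreover have "?w - neg_vec \<tau> = v + \<tau>" using v \<tau>
      by (intro eq_vecI) (auto simp: pos_vec_def neg_vec_def)
    ultimately show ?thesis by simp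
  qed
  have "class_sum L (u + int n \<cdot>\<^sub>v \<tau>) r = class_sum L u r" for n
  proof (induction n)
    case 0
    have "u + int 0 \<cdot>\<^sub>v \<tau> = u" using u(1) \<tau> by (intro eq_vecI) auto
    then show ?case by simp
  next
    case (Suc n)
    have "u + int (Suc n) \<cdot>\<^sub>v \<tau> = (u + int n \<cdot>\<^sub>v \<tau>) + \<tau>"
      using u(1) \<tau> by (intro eq_vecI) (auto simp: algebra_simps)
    then show ?case using step[of "u + int n \<cdot>\<^sub>v \<tau>"] Suc u(1) \<tau> by simp
  qed
  then have ne: "class_sum L (u + int n \<cdot>\<^sub>v \<tau>) r \<noteq> 0" for n
    using u by simp
  have "\<exists>m\<in>keys r. expvec s m - (u + int n \<cdot>\<^sub>v \<tau>) \<in> L" for n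
  proof (rule ccontr)
    assume "\<not> ?thesis"
    then have "class_sum L (u + int n \<cdot>\<^sub>v \<tau>) r = 0"
      unfolding class_sum_def using u(1) \<tau> by (intro sum.neutral) auto
    then show False using ne by blast
  qed
  \<comment> \<open>Pigeonhole: each class of u + n \<tau> contains a term of \<open>r\<close>, so
    two different n share a monomial, and a nonzero multiple of \<tau> falls into L.\<close>
  then obtain g where g: "\<And>n. g n \<in> keys r" "\<And>n. expvec s (g n) - (u + int n \<cdot>\<^sub>v \<tau>) \<in> L" by metis
  have "finite (range g)" using g(1) by (intro finite_subset[OF _ finite_keys[of r]]) auto
  then have "\<not> inj g" using finite_imageD infinite_UNIV_nat by blast
  then obtain n n' where n: "n \<noteq> n'" "g n = g n'" by (auto simp: inj_on_def)
  have "(int n' - int n) \<cdot>\<^sub>v \<tau> = (expvec s (g n) - (u + int n \<cdot>\<^sub>v \<tau>)) - (expvec s (g n') - (u + int n' \<cdot>\<^sub>v \<tau>))"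
    using u(1) \<tau> n(2) by (intro eq_vecI) (auto simp: algebra_simps)
  then have "(int n' - int n) \<cdot>\<^sub>v \<tau> \<in> L" using is_lattice_diff[OF L g(2) g(2)] by metis
  then show False using inf n(1) by fastforce
qed

section \<open>Sums of lattices supported on disjoint blocks\<close>

locale block_lattices =
  fixes s k :: nat and U :: "nat \<Rightarrow> nat set" and H :: "nat \<Rightarrow> int vec set"
  assumes disjoint: "i < k \<Longrightarrow> i' < k \<Longrightarrow> j \<in> U i \<Longrightarrow> j \<in> U i' \<Longrightarrow> i = i'"
    and lattice: "i < k \<Longrightarrow> is_lattice s (H i)"
    and supp: "i < k \<Longrightarrow> a \<in> H i \<Longrightarrow> j < s \<Longrightarrow> j \<notin> U i \<Longrightarrow> a $ j = 0"
begin

definition restr :: "nat set \<Rightarrow> int vec \<Rightarrow> int vec" where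
  "restr V a = vec s (\<lambda>j. if j \<in> V then a $ j else 0)"

text \<open>The sum of the \<open>H i\<close>, described by restriction to the blocks so that the
  components of an element can be read off directly. \<open>sum_restr\<close> and
  \<open>sum_of_block_vectors\<close> give the link to actual sums.\<close>

definition sum_lattice :: "int vec set" where
  "sum_lattice = {a \<in> carrier_vec s. (\<forall>i<k. restr (U i) a \<in> H i) \<and>
     (\<forall>j<s. a $ j \<noteq> 0 \<longrightarrow> (\<exists>i<k. j \<in> U i))}"

lemma restr_simps [simp]: "restr V a \<in> carrier_vec s" "dim_vec (restr V a) = s"
  "j < s \<Longrightarrow> restr V a $ j = (if j \<in> V then a $ j else 0)"
  by (simp_all add: restr_def)

lemma is_lattice_sum_lattice: "is_lattice s sum_lattice"
proof -
  have restr: "restr V (a + b) = restr V a + restr V b" "restr V (- a) = - restr V a"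
    if "a \<in> carrier_vec s" "b \<in> carrier_vec s" for V a b
    using that by (auto intro!: eq_vecI)
  have "restr V (0\<^sub>v s) = 0\<^sub>v s" for V by (intro eq_vecI) auto
  then have "0\<^sub>v s \<in> sum_lattice"
    using is_lattice_0[OF lattice] by (simp add: sum_lattice_def)
  moreover have "a + b \<in> sum_lattice" if ab: "a \<in> sum_lattice" "b \<in> sum_lattice" for a b
  proof -
    have c: "a \<in> carrier_vec s" "b \<in> carrier_vec s" using ab by (auto simp: sum_lattice_def)
    have "\<exists>i<k. j \<in> U i" if "j < s" "(a + b) $ j \<noteq> 0" for j
    proof -
      have "a $ j \<noteq> 0 \<or> b $ j \<noteq> 0" using that c by auto
      then show ?thesis using ab that(1) unfolding sum_lattice_def by blast
    qed
    moreover have "restr (U i) (a + b) \<in> H i" if "i < k" for i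
      unfolding restr(1)[OF c] using ab that by (intro is_lattice_add[OF lattice]) (auto simp: sum_lattice_def)
    ultimately show ?thesis using c unfolding sum_lattice_def by simp
  qed
  moreover have "- a \<in> sum_lattice" if a: "a \<in> sum_lattice" for a
  proof -
    have c: "a \<in> carrier_vec s" using a by (auto simp: sum_lattice_def)
    have "restr (U i) (- a) \<in> H i" if "i < k" for i
      unfolding restr(2)[OF c c] using a that by (intro is_lattice_uminus[OF lattice]) (auto simp: sum_lattice_def)
    moreover have "\<exists>i<k. j \<in> U i" if "j < s" "(- a) $ j \<noteq> 0" for j
      using that a c by (simp add: sum_lattice_def)
    ultimately show ?thesis using c unfolding sum_lattice_def by simp
  qed
  moreover have "sum_lattice \<subseteq> carrier_vec s" by (auto simp: sum_lattice_def)
  ultimately show ?thesis unfolding is_lattice_def by blast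
qed

lemma block_subset: "i < k \<Longrightarrow> H i \<subseteq> sum_lattice"
proof
  fix a assume i: "i < k" and a: "a \<in> H i"
  have ac: "a \<in> carrier_vec s" using is_lattice_carrier[OF lattice[OF i] a] .
  have "restr (U i') a \<in> H i'" if i': "i' < k" for i'
  proof (cases "i' = i")
    case True
    have "restr (U i) a = a" using ac supp[OF i a] by (intro eq_vecI) auto
    then show ?thesis using a True by simp
  next
    case False
    then have "restr (U i') a = 0\<^sub>v s"
      using ac supp[OF i a] disjoint[OF i i'] by (intro eq_vecI) auto
    then show ?thesis using is_lattice_0[OF lattice[OF i']] by simp
  qed
  then show "a \<in> sum_lattice"
    unfolding sum_lattice_def using ac supp[OF i a] i by blast
qed

definition block_ideal :: "'k::comm_ring_1 mpoly set" where
  "block_ideal = (\<Sum>i<k. mideal s (binom ` H i))"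

lemma block_ideal_iff:
  "p \<in> block_ideal \<longleftrightarrow> (\<exists>f. p = (\<Sum>i<k. f i) \<and> (\<forall>i<k. f i \<in> mideal s (binom ` H i)))"
  unfolding block_ideal_def by (subst set_sum_alt) auto

lemma is_ideal_block_ideal: "is_ideal s (block_ideal :: 'k::comm_ring_1 mpoly set)"
  unfolding is_ideal_def
proof (intro conjI ballI)
  show "0 \<in> (block_ideal :: 'k mpoly set)"
    unfolding block_ideal_iff by (intro exI[of _ "\<lambda>_. 0"]) (simp add: is_ideal_0[OF is_ideal_mideal])
next
  fix p q :: "'k mpoly" assume "p \<in> block_ideal" "q \<in> block_ideal"
  then obtain f g where "p = (\<Sum>i<k. f i)" "\<forall>i<k. f i \<in> mideal s (binom ` H i)"
    "q = (\<Sum>i<k. g i)" "\<forall>i<k. g i \<in> mideal s (binom ` H i)" unfolding block_ideal_iff by blast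
  then show "p + q \<in> block_ideal"
    unfolding block_ideal_iff
    by (intro exI[of _ "\<lambda>i. f i + g i"]) (auto simp: sum.distrib intro: is_ideal_add[OF is_ideal_mideal])
next
  fix c p :: "'k mpoly" assume c: "c \<in> mpolys s" and "p \<in> block_ideal"
  then obtain f where "p = (\<Sum>i<k. f i)" "\<forall>i<k. f i \<in> mideal s (binom ` H i)"
    unfolding block_ideal_iff by blast
  then show "c * p \<in> block_ideal"
    unfolding block_ideal_iff using is_ideal_mult[OF is_ideal_mideal c]
    by (intro exI[of _ "\<lambda>i. c * f i"]) (auto simp: sum_distrib_left)
qed

lemma mideal_subset_block_ideal:
  assumes "i < k" "p \<in> mideal s (binom ` H i)" shows "p \<in> block_ideal"
  unfolding block_ideal_iff using assms is_ideal_0[OF is_ideal_mideal]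
  by (intro exI[of _ "\<lambda>j. if j = i then p else 0"]) auto

lemma block_ideal_subset:
  assumes "is_lattice s L" "\<And>i. i < k \<Longrightarrow> H i \<subseteq> L"
  shows "block_ideal \<subseteq> lattice_ideal s L"
proof -
  have "mideal s (binom ` H i) \<subseteq> lattice_ideal s L" if "i < k" for i
    using assms(2)[OF that] binom_in_lattice_ideal[OF assms(1)]
    by (intro mideal_subset is_ideal_lattice_ideal) auto
  then show ?thesis
    by (auto simp: block_ideal_iff subset_iff intro!: is_ideal_sum[OF is_ideal_lattice_ideal])
qed

text \<open>Two monomials in the same class are joined by changing one block at a time, each change
  being a multiple of a binomial of a single \<open>H i\<close>. The intermediate exponents mix
  entries of the two given ones, hence stay nonnegative.\<close>

lemma block_ideal_eq: "block_ideal = (lattice_ideal s sum_lattice :: 'k::comm_ring_1 mpoly set)"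
proof
  show "block_ideal \<subseteq> (lattice_ideal s sum_lattice :: 'k mpoly set)"
    by (rule block_ideal_subset[OF is_lattice_sum_lattice block_subset])
  \<comment> \<open>Induction on \<open>n\<close>: the two exponents may differ only in the first
    \<open>n\<close> blocks.\<close>
  have diff: "single m c - single m' c \<in> (block_ideal :: 'k mpoly set)"
    if m: "keys m \<subseteq> {..<s}" "keys m' \<subseteq> {..<s}" "expvec s m - expvec s m' \<in> sum_lattice"
      and n: "n \<le> k" "\<And>j. j < s \<Longrightarrow> lookup m j \<noteq> lookup m' j \<Longrightarrow> \<exists>i<n. j \<in> U i" for n m m' and c :: 'k
    using m n
  proof (induction n arbitrary: m)
    case 0
    then have "expvec s m = expvec s m'" by (intro eq_vecI) auto
    then have "m = m'" using 0 by (intro expvec_inject) auto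
    then show ?case using is_ideal_0[OF is_ideal_block_ideal] by simp
  next
    case (Suc n)
    let ?a = "expvec s m - expvec s m'"
    define v where "v = vec s (\<lambda>j. if j \<in> U n then int (lookup m' j) else int (lookup m j))"
    define w where "w = vec_exp v"
    have "v \<in> carrier_vec s" "nonneg_vec v" by (auto simp: v_def nonneg_vec_def)
    then have w: "expvec s w = v" "keys w \<subseteq> {..<s}"
      unfolding w_def by (simp_all add: expvec_vec_exp keys_vec_exp)
    have n: "n < k" using Suc.prems by simp
    have lookup_w: "lookup w j = (if j \<in> U n then lookup m' j else lookup m j)" if "j < s" for j
      using that by (auto simp: w_def lookup_vec_exp v_def)
    have H: "restr (U n) ?a \<in> H n" using Suc.prems(3) n by (auto simp: sum_lattice_def)
    moreover have "expvec s m - expvec s w = restr (U n) ?a"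
      unfolding w by (intro eq_vecI) (auto simp: v_def)
    ultimately have 1: "single m c - single w c \<in> (block_ideal :: 'k mpoly set)"
      using Suc.prems w(2) by (intro mideal_subset_block_ideal[OF n] monomial_difference_in_mideal) auto
    have "expvec s w - expvec s m' = ?a - restr (U n) ?a"
      unfolding w by (intro eq_vecI) (auto simp: v_def)
    then have "expvec s w - expvec s m' \<in> sum_lattice"
      using is_lattice_diff[OF is_lattice_sum_lattice Suc.prems(3)] block_subset[OF n] H by auto
    moreover have "\<exists>i<n. j \<in> U i" if "j < s" "lookup w j \<noteq> lookup m' j" for j
      using that Suc.prems(5)[of j] lookup_w[of j] by (auto simp: less_Suc_eq split: if_splits)
    ultimately have "single w c - single m' c \<in> (block_ideal :: 'k mpoly set)"
      using w(2) Suc.prems by (intro Suc.IH) auto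
    from is_ideal_add[OF is_ideal_block_ideal 1 this] show ?case by simp
  qed
  show "lattice_ideal s sum_lattice \<subseteq> (block_ideal :: 'k mpoly set)"
  proof (intro lattice_ideal_subset[OF is_lattice_sum_lattice] is_ideal_0[OF is_ideal_block_ideal]
      is_ideal_add[OF is_ideal_block_ideal])
    fix m m' c assume *: "keys m \<subseteq> {..<s}" "keys m' \<subseteq> {..<s}" "expvec s m - expvec s m' \<in> sum_lattice"
    have "\<exists>i<k. j \<in> U i" if "j < s" "lookup m j \<noteq> lookup m' j" for j
      using *(3) that by (auto simp: sum_lattice_def)
    then show "single m c - single m' c \<in> (block_ideal :: 'k mpoly set)"
      by (rule diff[OF * order_refl])
  qed
qed

text \<open>If \<open>u - v = a + n \<tau>\<close> with \<open>n > 0\<close>, then subtracting from \<open>u\<close> the components of \<open>a\<close> in the blocks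
  on which \<open>\<tau> \<ge> 0\<close> gives an exponent vector \<open>u' \<ge> \<tau>\<^sub>+\<close> that is congruent to \<open>u\<close> modulo \<open>J\<close>, and the
  monomial with exponent \<open>u' - \<tau>\<close> is congruent to it modulo \<open>binom \<tau>\<close>.\<close>

lemma gluing_step:
  assumes \<tau>: "\<tau> \<in> carrier_vec s"
    and sign: "\<And>i. i < k \<Longrightarrow> (\<forall>j\<in>U i. j < s \<longrightarrow> 0 \<le> \<tau> $ j) \<or> (\<forall>j\<in>U i. j < s \<longrightarrow> \<tau> $ j \<le> 0)"
    and m: "keys m \<subseteq> {..<s}" "keys m' \<subseteq> {..<s}" and a: "a \<in> sum_lattice"
    and eq: "expvec s m - expvec s m' = a + int n \<cdot>\<^sub>v \<tau>"
  shows "\<exists>r\<in>mpolys s. (single m c - single m' c) - r * binom \<tau> \<in> (lattice_ideal s sum_lattice :: 'k::comm_ring_1 mpoly set)"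
  using m(1) a eq
proof (induction n arbitrary: m a)
  case 0
  have "a \<in> carrier_vec s" using is_lattice_carrier[OF is_lattice_sum_lattice 0(2)] .
  then have "expvec s m - expvec s m' = a"
    using 0 \<tau> by (intro eq_vecI) auto
  then show ?case
    using 0 m monomial_difference_in_lattice_ideal[OF is_lattice_sum_lattice, of m m']
    by (intro bexI[of _ 0]) auto
next
  case (Suc n)
  let ?J = "lattice_ideal s sum_lattice :: 'k mpoly set"
  have ac: "a \<in> carrier_vec s" using is_lattice_carrier[OF is_lattice_sum_lattice Suc.prems(2)] .
  \<comment> \<open>Blocks on which \<tau> vanishes are included here; on the remaining blocks
    \<tau> \<le> 0 by \<open>sign\<close>.\<close>
  define G where "G = (\<Union>i\<in>{i. i < k \<and> (\<forall>j\<in>U i. j < s \<longrightarrow> 0 \<le> \<tau> $ j)}. U i)"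
  define b where "b = restr G a"
  have bL: "b \<in> sum_lattice"
  proof -
    have "restr (U i) b \<in> H i" if i: "i < k" for i
    proof (cases "\<forall>j\<in>U i. j < s \<longrightarrow> 0 \<le> \<tau> $ j")
      case True
      then have "restr (U i) b = restr (U i) a" using i by (intro eq_vecI) (auto simp: b_def G_def)
      then show ?thesis using Suc.prems(2) i by (auto simp: sum_lattice_def)
    next
      case False
      then have "restr (U i) b = 0\<^sub>v s" using i disjoint[OF i]
        by (intro eq_vecI) (auto simp: b_def G_def)
      then show ?thesis using is_lattice_0[OF lattice[OF i]] by simp
    qed
    moreover have "\<exists>i<k. j \<in> U i" if "j < s" "b $ j \<noteq> 0" for j
      using that Suc.prems(2) by (auto simp: b_def sum_lattice_def split: if_splits)
    ultimately show ?thesis by (auto simp: sum_lattice_def b_def)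
  qed
  have coord: "int (lookup m j) = int (lookup m' j) + a $ j + (int n + 1) * \<tau> $ j" if "j < s" for j
    using arg_cong[OF Suc.prems(3), of "\<lambda>v. v $ j"] that ac \<tau> by (simp add: algebra_simps)
  have bounds: "0 \<le> int (lookup m j) - b $ j \<and> 0 \<le> int (lookup m j) - b $ j - \<tau> $ j" if j: "j < s" for j
  proof -
    \<comment> \<open>In cases \<open>good\<close> and \<open>free\<close>, \<open>coord\<close>
      leaves the entry of m' plus n + 1 or, after subtracting \<tau>, n copies of a nonnegative
      entry of \<tau>. In case \<open>bad\<close> nothing is taken away, since \<open>b\<close> is 0
      there and \<tau> nonpositive. Case \<open>free\<close> concerns positions outside all
      blocks.\<close>
    consider (good) "j \<in> G" "b $ j = a $ j" "0 \<le> \<tau> $ j" | (bad) "b $ j = 0" "\<tau> $ j \<le> 0"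
      | (free) "b $ j = 0" "a $ j = 0" "0 \<le> \<tau> $ j"
    proof (cases "j \<in> G")
      case True
      then show thesis using good j by (auto simp: b_def G_def)
    next
      case False
      then have b0: "b $ j = 0" using j by (simp add: b_def)
      show thesis
      proof (cases "\<exists>i<k. j \<in> U i")
        case True
        then obtain i where i: "i < k" "j \<in> U i" by blast
        then have "\<not> (\<forall>j\<in>U i. j < s \<longrightarrow> 0 \<le> \<tau> $ j)" using False by (auto simp: G_def)
        then have "\<tau> $ j \<le> 0" using sign[OF i(1)] i(2) j by blast
        then show thesis using bad b0 by blast
      next
        case F: False
        then have "a $ j = 0" using Suc.prems(2) j by (auto simp: sum_lattice_def)
        then show thesis using b0 bad free by (cases "0 \<le> \<tau> $ j") auto
      qed
    qed
    then show ?thesis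
    proof cases
      case good
      then have "0 \<le> int n * \<tau> $ j" by simp
      then show ?thesis using good coord[OF j] by (simp add: algebra_simps)
    next
      case free
      then have "0 \<le> int n * \<tau> $ j" by simp
      then show ?thesis using free coord[OF j] by (simp add: algebra_simps)
    qed auto
  qed
  define v1 where "v1 = expvec s m - b"
  define v2 where "v2 = v1 - \<tau>"
  have v: "v1 \<in> carrier_vec s" "v2 \<in> carrier_vec s" "nonneg_vec v1" "nonneg_vec v2"
    using bounds \<tau> by (auto simp: v1_def v2_def nonneg_vec_def b_def)
  define m1 where "m1 = vec_exp v1"
  define m2 where "m2 = vec_exp v2"
  have m12: "expvec s m1 = v1" "expvec s m2 = v2" "keys m1 \<subseteq> {..<s}" "keys m2 \<subseteq> {..<s}"
    using v by (simp_all add: m1_def m2_def expvec_vec_exp keys_vec_exp)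
  have "expvec s m - expvec s m1 = b" unfolding m12 v1_def by (intro eq_vecI) (auto simp: b_def)
  then have 1: "single m c - single m1 c \<in> ?J"
    using monomial_difference_in_lattice_ideal[OF is_lattice_sum_lattice Suc.prems(1) m12(3)] bL by simp
  have "expvec s m1 - expvec s m2 = \<tau>" unfolding m12 v2_def using v(1) \<tau> by (intro eq_vecI) auto
  then obtain w where w: "keys w \<subseteq> {..<s}" "single m1 c - single m2 c = single w c * binom \<tau>"
    using monomial_difference[OF m12(3,4), of c] by metis
  \<comment> \<open>One copy of \<tau> has been split off and \<open>b\<close> has been moved out of
    \<open>a\<close>, so the induction hypothesis applies to \<open>m2\<close> and
    \<open>a - b\<close>.\<close>
  have "expvec s m2 - expvec s m' = (a - b) + int n \<cdot>\<^sub>v \<tau>"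
    unfolding m12 v2_def v1_def using coord ac \<tau> by (intro eq_vecI) (auto simp: b_def algebra_simps)
  then obtain r where r: "r \<in> mpolys s" "(single m2 c - single m' c) - r * binom \<tau> \<in> ?J"
    using Suc.IH[OF m12(4) is_lattice_diff[OF is_lattice_sum_lattice Suc.prems(2) bL]] by blast
  have "(single m c - single m' c) - (single w c + r) * binom \<tau> =
      (single m c - single m1 c) + ((single m2 c - single m' c) - r * binom \<tau>)"
    using w(2) by (simp add: algebra_simps)
  also have "\<dots> \<in> ?J" by (rule is_ideal_add[OF is_ideal_lattice_ideal 1 r(2)])
  finally show ?case
    using r(1) w(1) by (intro bexI[of _ "single w c + r"]) (auto simp: mpolys_single)
qed

text \<open>By \<open>lattice_ideal_subset\<close> the hard inclusion concerns only differences of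
  two monomials congruent modulo K. \<open>gluing_step\<close> covers nonnegative multiples of
  \<tau>; for negative ones the two monomials are exchanged. Conversely, \<open>binom \<tau>\<close>
  and the ideal of the smaller lattice lie in the ideal of K.\<close>

lemma gluing:
  fixes q :: "'k::comm_ring_1 mpoly"
  assumes \<tau>: "\<tau> \<in> carrier_vec s"
    and sign: "\<And>i. i < k \<Longrightarrow> (\<forall>j\<in>U i. j < s \<longrightarrow> 0 \<le> \<tau> $ j) \<or> (\<forall>j\<in>U i. j < s \<longrightarrow> \<tau> $ j \<le> 0)"
    and K: "is_lattice s K" "K = {a + n \<cdot>\<^sub>v \<tau> | a n. a \<in> sum_lattice}"
  shows "q \<in> lattice_ideal s K \<longleftrightarrow> (\<exists>r\<in>mpolys s. q - r * binom \<tau> \<in> lattice_ideal s sum_lattice)"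
proof -
  let ?J = "lattice_ideal s sum_lattice :: 'k mpoly set"
  define X where "X = {q :: 'k mpoly. \<exists>r\<in>mpolys s. q - r * binom \<tau> \<in> ?J}"
  have sub: "sum_lattice \<subseteq> K"
  proof
    fix a assume a: "a \<in> sum_lattice"
    then have "a = a + 0 \<cdot>\<^sub>v \<tau>"
      using \<tau> is_lattice_carrier[OF is_lattice_sum_lattice] by (intro eq_vecI) auto
    then show "a \<in> K" unfolding K(2) using a by blast
  qed
  have "\<tau> = 0\<^sub>v s + 1 \<cdot>\<^sub>v \<tau>" using \<tau> by (intro eq_vecI) auto
  then have \<tau>K: "\<tau> \<in> K" unfolding K(2) using is_lattice_0[OF is_lattice_sum_lattice] by blast
  have "lattice_ideal s K \<subseteq> X"
  proof (rule lattice_ideal_subset[OF K(1)])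
    show "0 \<in> X" using is_ideal_0[OF is_ideal_lattice_ideal] by (auto simp: X_def intro!: bexI[of _ 0])
    show "p + p' \<in> X" if p: "p \<in> X" "p' \<in> X" for p p'
    proof -
      obtain r r' where r: "r \<in> mpolys s" "p - r * binom \<tau> \<in> ?J" "r' \<in> mpolys s" "p' - r' * binom \<tau> \<in> ?J"
        using p unfolding X_def by blast
      have "p + p' - (r + r') * binom \<tau> = (p - r * binom \<tau>) + (p' - r' * binom \<tau>)"
        by (simp add: algebra_simps)
      also have "\<dots> \<in> ?J" by (rule is_ideal_add[OF is_ideal_lattice_ideal r(2,4)])
      finally show ?thesis using r(1,3) unfolding X_def by blast
    qed
    fix m m' c assume m: "keys m \<subseteq> {..<s}" "keys m' \<subseteq> {..<s}" "expvec s m - expvec s m' \<in> K"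
    then obtain a z where az: "expvec s m - expvec s m' = a + z \<cdot>\<^sub>v \<tau>" "a \<in> sum_lattice"
      unfolding K(2) by blast
    show "single m c - single m' c \<in> X"
    proof (cases "0 \<le> z")
      case True
      then show ?thesis
        using gluing_step[OF \<tau> sign m(1,2) az(2), of "nat z" c] az(1) by (simp add: X_def)
    next
      case False
      have "expvec s m' - expvec s m = - (expvec s m - expvec s m')" by (intro eq_vecI) auto
      also have "\<dots> = - a + (- z) \<cdot>\<^sub>v \<tau>"
        unfolding az(1) using \<tau> is_lattice_carrier[OF is_lattice_sum_lattice az(2)] by (intro eq_vecI) auto
      finally obtain r where r: "r \<in> mpolys s" "(single m' c - single m c) - r * binom \<tau> \<in> ?J"
        using gluing_step[OF \<tau> sign m(2,1) is_lattice_uminus[OF is_lattice_sum_lattice az(2)], of "nat (- z)" c]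
          False by auto
      have "single m c - single m' c - (- r) * binom \<tau> = - ((single m' c - single m c) - r * binom \<tau>)"
        by simp
      also have "\<dots> \<in> ?J" by (rule is_ideal_uminus[OF is_ideal_lattice_ideal r(2)])
      finally show ?thesis using r(1) unfolding X_def by (intro CollectI bexI[of _ "- r"]) auto
    qed
  qed
  moreover have "q \<in> lattice_ideal s K" if "q \<in> X"
  proof -
    obtain r where r: "r \<in> mpolys s" "q - r * binom \<tau> \<in> ?J" using \<open>q \<in> X\<close> unfolding X_def by blast
    have "?J \<subseteq> lattice_ideal s K"
      unfolding block_ideal_eq[symmetric] using block_subset sub by (intro block_ideal_subset K(1)) blast
    then have "(q - r * binom \<tau>) + r * binom \<tau> \<in> lattice_ideal s K"
      using r by (intro is_ideal_add[OF is_ideal_lattice_ideal] is_ideal_mult[OF is_ideal_lattice_ideal]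
          binom_in_lattice_ideal[OF K(1) \<tau>K]) auto
    then show ?thesis by simp
  qed
  ultimately show ?thesis unfolding X_def by blast
qed

end

section \<open>The block decomposition of the kernel\<close>

context block_lattices
begin

lemma sum_restr:
  assumes a: "a \<in> sum_lattice" and j: "j < s"
  shows "(\<Sum>i<k. restr (U i) a $ j) = a $ j"
proof (cases "\<exists>i<k. j \<in> U i")
  case True
  then obtain i where i: "i < k" "j \<in> U i" by blast
  have "(\<Sum>i'<k. restr (U i') a $ j) = (\<Sum>i'\<in>{i}. restr (U i') a $ j)"
  proof (rule sum.mono_neutral_right)
    have "j \<notin> U i'" if "i' < k" "i' \<noteq> i" for i' using disjoint i that by blast
    then show "\<forall>i'\<in>{..<k} - {i}. restr (U i') a $ j = 0" using j by simp
  qed (use i in auto)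
  then show ?thesis using i j by simp
next
  case False
  then have "a $ j = 0" using a j by (auto simp: sum_lattice_def)
  then show ?thesis using False j by simp
qed

text \<open>Because the supports are disjoint, restricting the sum to block \<open>i\<close>
  recovers \<open>w i\<close>.\<close>

lemma sum_of_block_vectors:
  assumes w: "\<And>i. i < k \<Longrightarrow> w i \<in> H i"
  shows "vec s (\<lambda>j. \<Sum>i<k. w i $ j) \<in> sum_lattice"
proof -
  let ?a = "vec s (\<lambda>j. \<Sum>i<k. w i $ j)"
  have "restr (U i) ?a = w i" if i: "i < k" for i
  proof (rule eq_vecI)
    have dim: "dim_vec (w i) = s" using is_lattice_carrier[OF lattice[OF i] w[OF i]] by simp
    then show "dim_vec (restr (U i) ?a) = dim_vec (w i)" by simp
    fix j assume "j < dim_vec (w i)"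
    then have j: "j < s" using dim by simp
    show "restr (U i) ?a $ j = w i $ j"
    proof (cases "j \<in> U i")
      case True
      have "(\<Sum>i'<k. w i' $ j) = (\<Sum>i'\<in>{i}. w i' $ j)"
      proof (rule sum.mono_neutral_right)
        have "w i' $ j = 0" if "i' < k" "i' \<noteq> i" for i'
          using disjoint i True supp[OF that(1) w[OF that(1)] j] that by blast
        then show "\<forall>i'\<in>{..<k} - {i}. w i' $ j = 0" by auto
      qed (use i in auto)
      then show ?thesis using True j by simp
    next
      case False
      then show ?thesis using supp[OF i w[OF i] j] j by simp
    qed
  qed
  moreover have "\<exists>i<k. j \<in> U i" if j: "j < s" and ne: "?a $ j \<noteq> 0" for j
  proof (rule ccontr)
    assume "\<not> ?thesis"
    then have "w i $ j = 0" if "i < k" for i using supp[OF that w[OF that] j] that by blast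
    then show False using j ne by simp
  qed
  ultimately show ?thesis unfolding sum_lattice_def using w by simp
qed

end

lemma in_listset_iff:
  "xs \<in> listset Hs \<longleftrightarrow> length xs = length Hs \<and> (\<forall>i<length Hs. xs ! i \<in> Hs ! i)"
proof (induction Hs arbitrary: xs)
  case (Cons G Hs)
  show ?case by (cases xs) (auto simp: set_Cons_def Cons.IH nth_Cons split: nat.splits)
qed auto

lemma foldr_add_vec:
  assumes "set vs \<subseteq> carrier_vec s"
  shows "foldr (+) vs (0\<^sub>v s) = vec s (\<lambda>j. \<Sum>i<length vs. vs ! i $ j :: int)"
  using assms
proof (induction vs)
  case (Cons v vs)
  then show ?case by (intro eq_vecI) (auto simp: sum.lessThan_Suc_shift simp del: sum.lessThan_Suc)
qed (auto intro!: eq_vecI)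

text \<open>Existence of decompositions gives the description of K. Uniqueness, applied to n \<tau>
  viewed once as a sum of block vectors and once as a multiple of \<tau>, shows that \<tau> has
  infinite order modulo the block lattices.\<close>

lemma (in block_lattices) direct_sum_facts:
  assumes K: "internal_direct_sum s K (map H [0..<k] @ [range (\<lambda>m :: int. m \<cdot>\<^sub>v \<tau>)])"
    and \<tau>: "\<tau> \<in> carrier_vec s" "\<tau> \<noteq> 0\<^sub>v s"
  shows "K = {a + n \<cdot>\<^sub>v \<tau> | a n. a \<in> sum_lattice}" and "n \<cdot>\<^sub>v \<tau> \<in> sum_lattice \<Longrightarrow> n = 0"
proof -
  let ?Hs = "map H [0..<k] @ [range (\<lambda>m :: int. m \<cdot>\<^sub>v \<tau>)]"
  let ?sum = "\<lambda>vs. foldr (+) vs (0\<^sub>v s)"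
  have inj: "inj_on ?sum (listset ?Hs)" and im: "?sum ` listset ?Hs = K"
    using K by (auto simp: internal_direct_sum_def bij_betw_def)
  define dec where "dec a n = map (\<lambda>i. restr (U i) a) [0..<k] @ [n \<cdot>\<^sub>v \<tau>]" for a n
  have dec: "dec a n \<in> listset ?Hs" if "a \<in> sum_lattice" for a n
    using that unfolding in_listset_iff dec_def by (auto simp: nth_append sum_lattice_def less_Suc_eq)
  have sum_dec: "?sum (dec a n) = a + n \<cdot>\<^sub>v \<tau>" if a: "a \<in> sum_lattice" for a n
  proof -
    have "set (dec a n) \<subseteq> carrier_vec s" using \<tau> by (auto simp: dec_def)
    moreover have "length (dec a n) = Suc k" by (simp add: dec_def)
    ultimately have "?sum (dec a n) = vec s (\<lambda>j. \<Sum>i<Suc k. dec a n ! i $ j)"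
      using foldr_add_vec by metis
    also have "\<dots> = a + n \<cdot>\<^sub>v \<tau>"
      using sum_restr[OF a] \<tau> is_lattice_carrier[OF is_lattice_sum_lattice a]
      by (intro eq_vecI) (auto simp: dec_def nth_append)
    finally show ?thesis .
  qed
  have "v \<in> {a + n \<cdot>\<^sub>v \<tau> | a n. a \<in> sum_lattice}" if v: "v \<in> K" for v
  proof -
    obtain vs where "vs \<in> listset ?Hs" and v: "v = ?sum vs" using v im by blast
    then have len: "length vs = Suc k" and vs: "\<And>i. i < Suc k \<Longrightarrow> vs ! i \<in> ?Hs ! i"
      unfolding in_listset_iff by auto
    have H: "vs ! i \<in> H i" if "i < k" for i using vs[of i] that by (simp add: nth_append)
    obtain n where n: "vs ! k = n \<cdot>\<^sub>v \<tau>" using vs[of k] by (auto simp: nth_append)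
    have "vs ! i \<in> carrier_vec s" if "i < Suc k" for i
    proof (cases "i = k")
      case False
      then have "i < k" using that by simp
      then show ?thesis using is_lattice_carrier[OF lattice H] by blast
    qed (use n \<tau> in simp)
    then have "set vs \<subseteq> carrier_vec s" using len by (auto simp: in_set_conv_nth)
    then have "v = vec s (\<lambda>j. \<Sum>i<Suc k. vs ! i $ j)" using foldr_add_vec len v by simp
    also have "\<dots> = vec s (\<lambda>j. \<Sum>i<k. vs ! i $ j) + n \<cdot>\<^sub>v \<tau>"
      using \<tau> n by (intro eq_vecI) auto
    finally show ?thesis using sum_of_block_vectors[OF H] by blast
  qed
  moreover have "a + n \<cdot>\<^sub>v \<tau> \<in> K" if "a \<in> sum_lattice" for a n
    using dec[OF that] im sum_dec[OF that] by (metis imageI)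
  ultimately show "K = {a + n \<cdot>\<^sub>v \<tau> | a n. a \<in> sum_lattice}" by blast
  assume n: "n \<cdot>\<^sub>v \<tau> \<in> sum_lattice"
  have 0: "0\<^sub>v s \<in> sum_lattice" by (rule is_lattice_0[OF is_lattice_sum_lattice])
  have "?sum (dec (n \<cdot>\<^sub>v \<tau>) 0) = ?sum (dec (0\<^sub>v s) n)"
    unfolding sum_dec[OF n] sum_dec[OF 0] using \<tau> by (intro eq_vecI) auto
  then have "dec (n \<cdot>\<^sub>v \<tau>) 0 = dec (0\<^sub>v s) n" using inj_onD[OF inj] dec[OF n] dec[OF 0] by blast
  then have eq: "0 \<cdot>\<^sub>v \<tau> = n \<cdot>\<^sub>v \<tau>" by (simp add: dec_def)
  obtain j where j: "j < s" "\<tau> $ j \<noteq> 0" using \<tau> by (metis carrier_vecD eq_vecI index_zero_vec)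
  then show "n = 0" using arg_cong[OF eq, of "\<lambda>v. v $ j"] \<tau>(1) by simp
qed

lemma col_offset_Suc:
  "i < length As \<Longrightarrow> col_offset As (Suc i) = col_offset As i + dim_col (As ! i)"
  by (simp add: col_offset_def take_Suc_conv_app_nth)

lemma col_offset_mono: "i \<le> i' \<Longrightarrow> i' \<le> length As \<Longrightarrow> col_offset As i \<le> col_offset As i'"
proof (induction i' rule: dec_induct)
  case (step n)
  then show ?case using col_offset_Suc[of n As] by simp
qed simp

text \<open>The blocks are consecutive intervals, hence disjoint. The inequality leaves room for the
  extra columns at the end, whose positions belong to no block.\<close>

lemma block_lattices_block_kernel:
  assumes s: "sum_list (map dim_col As) \<le> s"
  shows "block_lattices s (length As) (block_cols As) (block_kernel s As)"
proof
  have less: "j < j'" if "i < i'" "i' < length As" "j \<in> block_cols As i" "j' \<in> block_cols As i'" for i i' j j'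
    using that col_offset_mono[of "Suc i" i' As] col_offset_Suc[of i As] by (auto simp: block_cols_def)
  show "i = i'" if "i < length As" "i' < length As" "j \<in> block_cols As i" "j \<in> block_cols As i'" for i i' j
    using that less[of i i' j j] less[of i' i j j] by (metis less_irrefl linorder_neqE_nat)
  show "a $ j = 0" if "i < length As" "a \<in> block_kernel s As i" "j < s" "j \<notin> block_cols As i" for i a j
    using that by (auto simp: block_kernel_def block_cols_def place_vec_def mat_kernel_def)
  show "is_lattice s (block_kernel s As i)" if i: "i < length As" for i
  proof -
    let ?p = "col_offset As i" and ?n = "dim_col (As ! i)"
    have L: "is_lattice ?n (mat_kernel (As ! i))" by (rule is_lattice_mat_kernel)
    have add: "place_vec s ?p v + place_vec s ?p w = place_vec s ?p (v + w)"
      if "v \<in> carrier_vec ?n" "w \<in> carrier_vec ?n" for v w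
      using that by (auto simp: place_vec_def intro!: eq_vecI)
    have neg: "- place_vec s ?p v = place_vec s ?p (- v)" if "v \<in> carrier_vec ?n" for v
      using that by (auto simp: place_vec_def intro!: eq_vecI)
    have zero: "place_vec s ?p (0\<^sub>v ?n) = 0\<^sub>v s"
      by (auto simp: place_vec_def intro!: eq_vecI)
    show ?thesis
      unfolding is_lattice_def block_kernel_def
    proof (intro conjI ballI)
      show "place_vec s ?p ` mat_kernel (As ! i) \<subseteq> carrier_vec s" by (auto simp: place_vec_def)
      show "0\<^sub>v s \<in> place_vec s ?p ` mat_kernel (As ! i)"
        using is_lattice_0[OF L] zero by (metis imageI)
      show "a + b \<in> place_vec s ?p ` mat_kernel (As ! i)"
        if "a \<in> place_vec s ?p ` mat_kernel (As ! i)" "b \<in> place_vec s ?p ` mat_kernel (As ! i)" for a b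
        using that add is_lattice_carrier[OF L] is_lattice_add[OF L] by auto
      show "- a \<in> place_vec s ?p ` mat_kernel (As ! i)"
        if "a \<in> place_vec s ?p ` mat_kernel (As ! i)" for a
        using that neg is_lattice_carrier[OF L] is_lattice_uminus[OF L] by auto
    qed
  qed
qed

section \<open>Betti numbers of the cone, and the conclusion\<close>

lemma tor_dim_eq_0:
  fixes F :: "'k::field free_complex"
  assumes "\<And>b. b \<in> fbasis F i \<Longrightarrow> fdeg F i b \<noteq> \<alpha>"
  shows "tor_dim F i \<alpha> = 0"
proof -
  have empty: "{b \<in> fbasis F i. fdeg F i b = \<alpha>} = {}" using assms by auto
  have "kmod_deg F i \<alpha> \<subseteq> kvec.span {}"
    unfolding kmod_deg_def empty by auto
  then have "tor_cycles F i \<alpha> \<subseteq> kvec.span {}"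
    using tor_cycles_D by blast
  then have "kvec.dim (tor_cycles F i \<alpha>) = 0"
    using kvec.dim_le_card[of "tor_cycles F i \<alpha>" "{}"] by simp
  then show ?thesis by (simp add: tor_dim_def)
qed

text \<open>Two conventions for the shifted term have to agree. \<open>betti\<close> is 0 by
  definition if i - 1 is negative or \<alpha> - \<mu> has a negative coordinate; the cone has no
  shifted summand at stage 0, and in the other case Tor vanishes because the basis degrees of F are
  nonnegative.\<close>

lemma betti_cone:
  fixes I J :: "'k::field mpoly set"
  assumes A: "positive_grading A"
    and J: "is_ideal (dim_col A) J" "homogeneous_ideal A J"
    and I: "is_ideal (dim_col A) I" "homogeneous_ideal A I"
      "\<And>q. q \<in> I \<longleftrightarrow> (\<exists>r\<in>mpolys (dim_col A). q - r * p \<in> J)"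
    and p: "p \<in> homog A \<mu>" "\<mu> \<in> carrier_vec (dim_row A)" "lookup p 0 = 0"
    and nzd: "\<And>r. r \<in> mpolys (dim_col A) \<Longrightarrow> p * r \<in> J \<Longrightarrow> r \<in> J"
    and \<alpha>: "0 \<le> i" "\<alpha> \<in> carrier_vec (dim_row A)" "nonneg_vec \<alpha>"
  shows "betti A I i \<alpha> = betti A J i \<alpha> + betti A J (i - 1) (\<alpha> - \<mu>)"
proof -
  obtain F where F: "graded_free_resolution A J F" "\<And>i b. b \<in> fbasis F i \<Longrightarrow> nonneg_vec (fdeg F i b)"
    by (rule resolution_exists[OF A J]) blast
  have C: "graded_free_resolution A I (cone p \<mu> F)"
    by (rule cone_resolution[OF F(1) J(1) p(1,2) nzd I(3)])
  obtain n where n: "i = int n" using \<alpha>(1) by (metis nonneg_int_cases)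
  have "betti A J (i - 1) (\<alpha> - \<mu>) = (case n of 0 \<Rightarrow> 0 | Suc j \<Rightarrow> tor_dim F j (\<alpha> - \<mu>))"
  proof (cases n)
    case (Suc j)
    have carr: "\<alpha> - \<mu> \<in> carrier_vec (dim_row A)" using \<alpha>(2) p(2) by simp
    show ?thesis
    proof (cases "nonneg_vec (\<alpha> - \<mu>)")
      case True
      then show ?thesis using betti_eq[OF F(1) J carr True, of j] by (simp add: n Suc)
    next
      case False
      then have "tor_dim F j (\<alpha> - \<mu>) = 0" using F(2) by (intro tor_dim_eq_0) metis
      then show ?thesis using False by (simp add: betti_def Suc)
    qed
  qed (simp add: n betti_def)
  then show ?thesis
    using betti_eq[OF C I(1,2) \<alpha>(2,3), of n] betti_eq[OF F(1) J \<alpha>(2,3), of n]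
      cone_tor_dim[OF F(1) p(3,2) \<alpha>(2), of n] by (simp add: n)
qed

theorem theorem3p5:
  fixes As :: "int mat list" and cs :: "int vec list" and A :: "int mat"
    and N s :: nat and \<tau> \<mu> :: "int vec"
    and J :: "'k::{alg_closed_field, field_char_0} mpoly set"
  assumes "\<forall>c\<in>set cs. c \<in> carrier_vec N"
    and "sum_list (map dim_row As) \<le> N"
    and "s = sum_list (map dim_col As) + length cs"
    and "A = block_matrix N As cs"
    and "\<tau> \<in> carrier_vec s" and "\<tau> \<noteq> 0\<^sub>v s"
    and "internal_direct_sum s (mat_kernel A)
           (map (block_kernel s As) [0..<length As] @ [range (\<lambda>m::int. m \<cdot>\<^sub>v \<tau>)])"
    and "\<forall>i<length As. block_cols As i \<inter> vsupp (pos_vec \<tau>) = {} \<or>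
                       block_cols As i \<inter> vsupp (neg_vec \<tau>) = {}"
    and "induces_grading A"
    and "J = (\<Sum>i<length As. block_toric_ideal s As i)"
    and "\<mu> = poly_deg A (binom \<tau> :: 'k mpoly)"
  shows "\<forall>i \<alpha>. 0 \<le> i \<longrightarrow> \<alpha> \<in> carrier_vec N \<longrightarrow> nonneg_vec \<alpha> \<longrightarrow>
           betti A (toric_ideal A :: 'k mpoly set) i \<alpha> = betti A J i \<alpha> + betti A J (i - 1) (\<alpha> - \<mu>)"
proof (intro allI impI)
  fix i :: int and \<alpha> :: "int vec"
  assume i: "0 \<le> i" and \<alpha>: "\<alpha> \<in> carrier_vec N" "nonneg_vec \<alpha>"
  note \<tau> = assms(5,6)
  interpret block_lattices s "length As" "block_cols As" "block_kernel s As"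
    by (rule block_lattices_block_kernel) (simp add: assms(3))
  have dims: "dim_col A = s" "dim_row A = N"
    by (simp_all add: assms(3,4) block_matrix_def Let_def dim_diag_block_mat)
  have K: "is_lattice s (mat_kernel A)" using is_lattice_mat_kernel[of A] by (simp add: dims)
  note ds = direct_sum_facts[OF assms(7) \<tau>]
  have "\<tau> = 0\<^sub>v s + 1 \<cdot>\<^sub>v \<tau>" using \<tau> by (intro eq_vecI) auto
  then have \<tau>K: "\<tau> \<in> mat_kernel A" unfolding ds(1) using is_lattice_0[OF is_lattice_sum_lattice] by blast
  have LK: "sum_lattice \<subseteq> mat_kernel A"
  proof
    fix a assume a: "a \<in> sum_lattice"
    then have "a \<in> carrier_vec s" by (rule is_lattice_carrier[OF is_lattice_sum_lattice])
    then have "a = a + 0 \<cdot>\<^sub>v \<tau>" using \<tau> by (intro eq_vecI) auto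
    then show "a \<in> mat_kernel A" unfolding ds(1) using a by blast
  qed
  have sign: "(\<forall>j\<in>block_cols As i. j < s \<longrightarrow> 0 \<le> \<tau> $ j) \<or> (\<forall>j\<in>block_cols As i. j < s \<longrightarrow> \<tau> $ j \<le> 0)"
    if "i < length As" for i
  proof -
    have "vsupp (pos_vec \<tau>) = {j. j < s \<and> 0 < \<tau> $ j}" "vsupp (neg_vec \<tau>) = {j. j < s \<and> \<tau> $ j < 0}"
      using \<tau> by (auto simp: vsupp_def pos_vec_def neg_vec_def)
    then show ?thesis using assms(8) that by force
  qed
  have J: "J = lattice_ideal s sum_lattice"
    unfolding block_ideal_eq[symmetric] block_ideal_def assms(10) block_toric_ideal_def ..
  have I: "toric_ideal A = (lattice_ideal s (mat_kernel A) :: 'k mpoly set)"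
    unfolding toric_ideal_def dims by (rule mideal_binom_eq_lattice_ideal[OF K])
  have grading: "\<And>v. v \<in> mat_kernel A \<Longrightarrow> nonneg_vec v \<Longrightarrow> v = 0\<^sub>v s"
    using assms(9) dims by (auto simp: induces_grading_def)
  let ?e = "vec_exp (pos_vec \<tau>)" and ?e' = "vec_exp (neg_vec \<tau>)"
  have e: "expvec s ?e = pos_vec \<tau>" "expvec s ?e' = neg_vec \<tau>"
    using \<tau> by (simp_all add: expvec_vec_exp)
  have e0: "expvec s (0 :: nat \<Rightarrow>\<^sub>0 nat) = 0\<^sub>v s" by (intro eq_vecI) auto
  \<comment> \<open>If \<tau> had no positive or no negative entry, then -\<tau> or \<tau> would be
    a nonzero nonnegative vector in the kernel. So neither monomial of the binomial is 1, and its
    constant term is 0; the third fact says that the two monomials do not cancel.\<close>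
  have ne: "?e \<noteq> 0" "?e' \<noteq> 0" "?e \<noteq> ?e'"
  proof -
    have neg: "- \<tau> \<in> mat_kernel A" by (rule is_lattice_uminus[OF K \<tau>K])
    show "?e \<noteq> 0"
    proof
      assume "?e = 0"
      then have "pos_vec \<tau> = 0\<^sub>v s" using e e0 by metis
      then have "pos_vec \<tau> $ j = 0" if "j < s" for j using that by simp
      then have "\<tau> $ j \<le> 0" if "j < s" for j
        using that \<tau>(1) by (fastforce simp: pos_vec_def)
      then have "nonneg_vec (- \<tau>)" using \<tau>(1) by (auto simp: nonneg_vec_def)
      then have "- \<tau> = 0\<^sub>v s" by (rule grading[OF neg])
      then show False using \<tau> by (metis uminus_uminus_vec uminus_zero_vec_eq zero_carrier_vec)
    qed
    show "?e' \<noteq> 0"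
    proof
      assume "?e' = 0"
      then have "neg_vec \<tau> = 0\<^sub>v s" using e e0 by metis
      then have "neg_vec \<tau> $ j = 0" if "j < s" for j using that by simp
      then have "0 \<le> \<tau> $ j" if "j < s" for j
        using that \<tau>(1) by (fastforce simp: neg_vec_def)
      then have "nonneg_vec \<tau>" using \<tau>(1) by (auto simp: nonneg_vec_def)
      then show False using grading[OF \<tau>K] \<tau>(2) by blast
    qed
    show "?e \<noteq> ?e'"
    proof
      assume "?e = ?e'"
      then have "pos_vec \<tau> = neg_vec \<tau>" using e by metis
      then have "pos_vec \<tau> - neg_vec \<tau> = 0\<^sub>v s" using \<tau>(1) by (intro eq_vecI) auto
      then show False using \<tau>(2) by (simp add: pos_vec_minus_neg_vec)
    qed
  qed
  have "mon_deg A ?e = mon_deg A ?e' + A *\<^sub>v \<tau>"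
  proof -
    have "pos_vec \<tau> = neg_vec \<tau> + \<tau>"
      using \<tau>(1) by (intro eq_vecI) (auto simp: pos_vec_def neg_vec_def)
    moreover have "A \<in> carrier_mat N s" by (rule carrier_matI[OF dims(2,1)])
    ultimately have "A *\<^sub>v pos_vec \<tau> = A *\<^sub>v neg_vec \<tau> + A *\<^sub>v \<tau>"
      using \<tau>(1) mult_add_distrib_mat_vec[of A N s "neg_vec \<tau>" \<tau>] by (metis pos_neg_vec_carrier(2))
    then show ?thesis unfolding mon_deg_expvec dims e .
  qed
  then have deg: "mon_deg A ?e' = mon_deg A ?e"
    using \<tau>K mon_deg_carrier[of A ?e'] by (simp add: mat_kernel_def)
  \<comment> \<open>Both monomials occur, with the same degree, so the binomial is homogeneous of
    exactly one degree, as the \<open>THE\<close> in \<open>poly_deg\<close> requires.\<close>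
  have homog_iff: "binom \<tau> \<in> (homog A \<beta> :: 'k mpoly set) \<longleftrightarrow> mon_deg A ?e = \<beta>" for \<beta>
  proof -
    have "keys (binom \<tau> :: 'k mpoly) = {?e, ?e'}"
      using ne(3) by (auto simp: binom_eq in_keys_iff lookup_minus lookup_single when_def split: if_splits)
    then show ?thesis using binom_mpolys[OF \<tau>(1)] dims deg by (auto simp: homog_def)
  qed
  then have \<mu>: "\<mu> = mon_deg A ?e" unfolding assms(11) poly_deg_def by (intro the_equality) auto
  show "betti A (toric_ideal A :: 'k mpoly set) i \<alpha> = betti A J i \<alpha> + betti A J (i - 1) (\<alpha> - \<mu>)"
  proof (rule betti_cone[where p = "binom \<tau>"])
    show "positive_grading A" by (rule positive_gradingI[OF assms(9)])
    show "is_ideal (dim_col A) J" "homogeneous_ideal A J"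
      using is_ideal_lattice_ideal homogeneous_lattice_ideal[OF LK] unfolding J dims by auto
    show "is_ideal (dim_col A) (toric_ideal A :: 'k mpoly set)" "homogeneous_ideal A (toric_ideal A :: 'k mpoly set)"
      using is_ideal_lattice_ideal homogeneous_lattice_ideal[OF order_refl, of A] unfolding I dims by auto
    show "q \<in> toric_ideal A \<longleftrightarrow> (\<exists>r\<in>mpolys (dim_col A). q - r * binom \<tau> \<in> J)" for q
      unfolding I J dims by (rule gluing[OF \<tau>(1) sign K ds(1)])
    show "binom \<tau> \<in> (homog A \<mu> :: 'k mpoly set)" using homog_iff \<mu> by simp
    show "\<mu> \<in> carrier_vec (dim_row A)" by (simp add: \<mu>)
    show "lookup (binom \<tau> :: 'k mpoly) 0 = 0"
      using ne(1,2) by (simp add: binom_eq lookup_minus lookup_single when_def)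
    show "r \<in> J" if "r \<in> mpolys (dim_col A)" "binom \<tau> * r \<in> J" for r
      unfolding J
    proof (rule binom_nonzerodivisor[OF is_lattice_sum_lattice \<tau>(1)])
      show "n = 0" if "n \<cdot>\<^sub>v \<tau> \<in> sum_lattice" for n using that by (rule ds(2))
      show "r \<in> mpolys s" "binom \<tau> * r \<in> lattice_ideal s sum_lattice"
        using that unfolding J dims by auto
    qed
  qed (use i \<alpha> dims in auto)
qed

end
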